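(* Let $\alpha,\beta\in\mathbb{R}$ be any given real numbers, and for $\epsilon>0$ let $g_\epsilon=(\epsilon^2+t^{-2})^2g$ on $\mathbb{R}^4\setminus\{0\}$, where $g$ is the flat metric and $t$ is the Euclidean distance to the origin. Let $\omega=\alpha\epsilon^4\omega_2+\beta t^{-4}\omega_{-2}\in\bigwedge^+$, a closed $2$-form, with $\omega_{\pm2}$ as defined in the context. As $\epsilon\searrow0$ the manifold $(\mathbb{R}^4\setminus\{0\},g_\epsilon)$ converges, in the Gromov-Hausdorff topology, to the one-point union of two copies of $\mathbb{R}^4$. As $\epsilon\searrow0$ the form $\omega$ converges to a covariant-constant form on each copy, of magnitude $|\alpha|$ on one copy (the limit of the end $t\to\infty$) and $|\beta|$ on the other (the limit of the end $t\to0$). Further, with norms taken with respect to $g_\epsilon$, $L^2(|\nabla\omega|)\searrow0$ while $\sup|\nabla\omega|\nearrow\infty$ as $\epsilon\searrow0$.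
   Context: Write the flat metric on $\mathbb{R}^4\setminus\{0\}=\mathbb{R}^{>0}\times\mathbb{S}^3$ as $g=dt^2+t^2g_{\mathbb{S}^3}$. Let $\eta^1,\eta^2,\eta^3$ be the left-invariant unit coframe on round $\mathbb{S}^3$ with $d\eta^i=\epsilon^i{}_{jk}\eta^j\wedge\eta^k$, where $\epsilon^i{}_{jk}$ is the Levi-Civita symbol (e.g. $d\eta^1=2\eta^2\wedge\eta^3$), with $\mathbb{S}^3$ oriented by $\eta^1\wedge\eta^2\wedge\eta^3$ and $\mathbb{R}^4$ by $dt\wedge\eta^1\wedge\eta^2\wedge\eta^3$. $\bigwedge^+$ is the bundle of self-dual $2$-forms, with norm $|\omega|^2=*(\omega\wedge\omega)$. Let $F_t:\bigwedge^+|_{\{t=const\}}\to\bigwedge^1_{\{t=const\}}$ be the isometric isomorphism $F_t(\omega)=i_{\sqrt2\,dt}\omega$ (interior product), so that $F_t^{-1}(t\eta^i)=\frac1{\sqrt2}\left(t\,dt\wedge\eta^i+\frac12t^2\epsilon^i{}_{jk}\eta^j\wedge\eta^k\right)$. Let $\eta_{2},\eta_{-2}$ be divergence-free $1$-forms on round $\mathbb{S}^3$ with $*d\eta_{\pm2}=\pm2\eta_{\pm2}$, normalized so $|\eta_{\pm2}|\equiv1$ (such forms have constant norm), and put $\omega_{\pm2}=F_t^{-1}(t\eta_{\pm2})$. The Gromov-Hausdorff convergence is pointed (noncompact spaces). Convergence of $\omega$ is convergence on the complement of the join point, where the metrics converge smoothly.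
   Formalization: The claim that sup|∇ω| increases to infinity is stated only when α and β are not both zero, since for α=β=0 the form ω vanishes identically and sup|∇ω|=0 for every ε; all other claims hold for all real α, β, with L²(|∇ω|) only weakly decreasing to 0 when α=β=0. *)

theory Defs
  imports "HOL-Analysis.Analysis"
begin

section \<open>Tensor calculus on open subsets of Euclidean space\<close>

text \<open>
  Tensor fields on an open set are given by their components in the standard coordinates:
  a 1-form \<open>\<theta>\<close> by \<open>\<theta> x $ i = \<theta>(e\<^sub>i)\<close>, a 2-form (or a metric)
  \<open>\<omega>\<close> by the matrix \<open>\<omega> x $ i $ j = \<omega>(e\<^sub>i, e\<^sub>j)\<close>.
\<close>

definition pd :: "'n \<Rightarrow> (real^'n \<Rightarrow> real) \<Rightarrow> real^'n \<Rightarrow> real" where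
  "pd i f x = frechet_derivative f (at x) (axis i 1)"

definition iter_pd :: "'n list \<Rightarrow> (real^'n \<Rightarrow> real) \<Rightarrow> real^'n \<Rightarrow> real" where
  "iter_pd is f = foldr pd is f"

definition smooth_fun_on :: "(real^'n) set \<Rightarrow> (real^'n \<Rightarrow> real) \<Rightarrow> bool" where
  "smooth_fun_on U f \<longleftrightarrow> (\<forall>is. \<forall>x\<in>U. iter_pd is f differentiable (at x))"

definition smooth1_on :: "(real^'n) set \<Rightarrow> (real^'n \<Rightarrow> real^'n) \<Rightarrow> bool" where
  "smooth1_on U \<theta> \<longleftrightarrow> (\<forall>i. smooth_fun_on U (\<lambda>x. \<theta> x $ i))"

definition smooth2_on :: "(real^'n) set \<Rightarrow> (real^'n \<Rightarrow> real^'n^'n) \<Rightarrow> bool" where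
  "smooth2_on U \<omega> \<longleftrightarrow> (\<forall>i j. smooth_fun_on U (\<lambda>x. \<omega> x $ i $ j))"

text \<open>Convergence of smooth functions and of smooth 2-tensors in \<open>C\<^sup>\<infinity>\<close> on compact
  subsets of \<open>U\<close>.\<close>

definition smooth_fun_tendsto ::
  "(real^'n) set \<Rightarrow> ('i \<Rightarrow> real^'n \<Rightarrow> real) \<Rightarrow> (real^'n \<Rightarrow> real) \<Rightarrow> 'i filter \<Rightarrow> bool" where
  "smooth_fun_tendsto U f f0 F \<longleftrightarrow>
     (\<forall>\<^sub>F a in F. smooth_fun_on U (f a)) \<and> smooth_fun_on U f0 \<and>
     (\<forall>is K. compact K \<and> K \<subseteq> U \<longrightarrow>
        uniform_limit K (\<lambda>a. iter_pd is (f a)) (iter_pd is f0) F)"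

definition smooth2_tendsto ::
  "(real^'n) set \<Rightarrow> ('i \<Rightarrow> real^'n \<Rightarrow> real^'n^'n) \<Rightarrow> (real^'n \<Rightarrow> real^'n^'n) \<Rightarrow> 'i filter \<Rightarrow> bool" where
  "smooth2_tendsto U T T0 F \<longleftrightarrow>
     (\<forall>i j. smooth_fun_tendsto U (\<lambda>a x. T a x $ i $ j) (\<lambda>x. T0 x $ i $ j) F)"

definition alternating :: "real^'n^'n \<Rightarrow> bool" where
  "alternating w \<longleftrightarrow> transpose w = - w"

definition wedge :: "real^'n \<Rightarrow> real^'n \<Rightarrow> real^'n^'n" where
  "wedge a b = (\<chi> i j. a$i * b$j - a$j * b$i)"

definition eval2 :: "real^'n^'n \<Rightarrow> real^'n \<Rightarrow> real^'n \<Rightarrow> real" where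
  "eval2 w u v = (\<Sum>i\<in>UNIV. \<Sum>j\<in>UNIV. w$i$j * u$i * v$j)"

definition ext_d1 :: "(real^'n \<Rightarrow> real^'n) \<Rightarrow> real^'n \<Rightarrow> real^'n^'n" where
  "ext_d1 \<theta> x = (\<chi> i j. pd i (\<lambda>y. \<theta> y $ j) x - pd j (\<lambda>y. \<theta> y $ i) x)"

definition ext_d2 :: "(real^'n \<Rightarrow> real^'n^'n) \<Rightarrow> real^'n \<Rightarrow> real^'n^'n^'n" where
  "ext_d2 \<omega> x = (\<chi> i j k. pd i (\<lambda>y. \<omega> y $ j $ k) x + pd j (\<lambda>y. \<omega> y $ k $ i) x
                          + pd k (\<lambda>y. \<omega> y $ i $ j) x)"

definition closed_form2_on :: "(real^'n) set \<Rightarrow> (real^'n \<Rightarrow> real^'n^'n) \<Rightarrow> bool" where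
  "closed_form2_on U \<omega> \<longleftrightarrow>
     smooth2_on U \<omega> \<and> (\<forall>x\<in>U. alternating (\<omega> x)) \<and> (\<forall>x\<in>U. ext_d2 \<omega> x = 0)"

definition pullback1 ::
  "(real^'n \<Rightarrow> real^'n) \<Rightarrow> (real^'n \<Rightarrow> real^'n) \<Rightarrow> real^'n \<Rightarrow> real^'n" where
  "pullback1 f \<theta> x = (\<chi> i. \<Sum>k\<in>UNIV. \<theta> (f x) $ k * pd i (\<lambda>y. f y $ k) x)"

text \<open>Pullback of an arbitrary covariant 2-tensor; used for 2-forms and for metrics.\<close>

definition pullback2 ::
  "(real^'n \<Rightarrow> real^'n) \<Rightarrow> (real^'n \<Rightarrow> real^'n^'n) \<Rightarrow> real^'n \<Rightarrow> real^'n^'n" where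
  "pullback2 f T x = (\<chi> i j. \<Sum>k\<in>UNIV. \<Sum>l\<in>UNIV.
      T (f x) $ k $ l * pd i (\<lambda>y. f y $ k) x * pd j (\<lambda>y. f y $ l) x)"

section \<open>Riemannian metrics\<close>

text \<open>\<open>christoffel g x k i j\<close> is \<open>\<Gamma>\<^sup>k\<^sub>i\<^sub>j\<close> of the Levi-Civita connection of \<open>g\<close>.\<close>

definition christoffel :: "(real^'n \<Rightarrow> real^'n^'n) \<Rightarrow> real^'n \<Rightarrow> 'n \<Rightarrow> 'n \<Rightarrow> 'n \<Rightarrow> real" where
  "christoffel g x k i j = 1/2 * (\<Sum>l\<in>UNIV. matrix_inv (g x) $ k $ l *
     (pd i (\<lambda>y. g y $ j $ l) x + pd j (\<lambda>y. g y $ i $ l) x - pd l (\<lambda>y. g y $ i $ j) x))"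

text \<open>Component \<open>$ i $ j $ k\<close> is \<open>(\<nabla>\<^sub>i \<omega>)\<^sub>j\<^sub>k\<close>.\<close>

definition cov_deriv2 ::
  "(real^'n \<Rightarrow> real^'n^'n) \<Rightarrow> (real^'n \<Rightarrow> real^'n^'n) \<Rightarrow> real^'n \<Rightarrow> real^'n^'n^'n" where
  "cov_deriv2 g \<omega> x = (\<chi> i j k. pd i (\<lambda>y. \<omega> y $ j $ k) x
     - (\<Sum>l\<in>UNIV. christoffel g x l i j * \<omega> x $ l $ k)
     - (\<Sum>l\<in>UNIV. christoffel g x l i k * \<omega> x $ j $ l))"

definition parallel_on ::
  "(real^'n) set \<Rightarrow> (real^'n \<Rightarrow> real^'n^'n) \<Rightarrow> (real^'n \<Rightarrow> real^'n^'n) \<Rightarrow> bool" where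
  "parallel_on U g \<omega> \<longleftrightarrow> smooth2_on U \<omega> \<and> (\<forall>x\<in>U. cov_deriv2 g \<omega> x = 0)"

text \<open>
  The factor \<open>1/2\<close> makes \<open>e\<^sup>i \<and> e\<^sup>j\<close> (\<open>i < j\<close>) orthonormal when \<open>e\<^sup>i\<close> is an orthonormal coframe;
  on self-dual forms this is the norm \<open>|\<omega>|\<^sup>2 = *(\<omega> \<and> \<omega>)\<close>, see \<open>self_dual_norm\<close> below.
  \<open>form2_deriv_norm\<close> is the induced norm on 1-forms with values in 2-forms.
\<close>

definition form2_norm :: "real^'n^'n \<Rightarrow> real^'n^'n \<Rightarrow> real" where
  "form2_norm G w = (let H = matrix_inv G in
     sqrt (1/2 * (\<Sum>i\<in>UNIV. \<Sum>j\<in>UNIV. \<Sum>k\<in>UNIV. \<Sum>l\<in>UNIV. H$i$k * H$j$l * w$i$j * w$k$l)))"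

definition form2_deriv_norm :: "real^'n^'n \<Rightarrow> real^'n^'n^'n \<Rightarrow> real" where
  "form2_deriv_norm G T = (let H = matrix_inv G in
     sqrt (1/2 * (\<Sum>i\<in>UNIV. \<Sum>j\<in>UNIV. \<Sum>k\<in>UNIV. \<Sum>i'\<in>UNIV. \<Sum>j'\<in>UNIV. \<Sum>k'\<in>UNIV.
       H$i$i' * H$j$j' * H$k$k' * T$i$j$k * T$i'$j'$k')))"

definition riem_speed ::
  "(real^'n \<Rightarrow> real^'n^'n) \<Rightarrow> (real \<Rightarrow> real^'n) \<Rightarrow> real \<Rightarrow> real" where
  "riem_speed g \<gamma> s =
     sqrt (eval2 (g (\<gamma> s)) (vector_derivative \<gamma> (at s)) (vector_derivative \<gamma> (at s)))"

text \<open>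
  A \<open>valid_path\<close> is only continuously differentiable off a finite set and may have unbounded
  speed there, so finite length is required explicitly.  Off \<open>U\<close> the distance is set to \<open>0\<close>, because
  \<open>Metric_space\<close> asks for a function that is nonnegative on the whole type.
\<close>

definition riem_dist ::
  "(real^'n) set \<Rightarrow> (real^'n \<Rightarrow> real^'n^'n) \<Rightarrow> real^'n \<Rightarrow> real^'n \<Rightarrow> real" where
  "riem_dist U g x y = (if x \<in> U \<and> y \<in> U then
     Inf {integral {0..1} (riem_speed g \<gamma>) | \<gamma>.
            valid_path \<gamma> \<and> path_image \<gamma> \<subseteq> U \<and> pathstart \<gamma> = x \<and> pathfinish \<gamma> = y \<and>
            riem_speed g \<gamma> integrable_on {0..1}}
     else 0)"

definition riem_volume :: "(real^'n) set \<Rightarrow> (real^'n \<Rightarrow> real^'n^'n) \<Rightarrow> (real^'n) measure" where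
  "riem_volume U g = density (restrict_space lborel U) (\<lambda>x. ennreal (sqrt (det (g x))))"

definition L2_norm :: "'a measure \<Rightarrow> ('a \<Rightarrow> real) \<Rightarrow> real" where
  "L2_norm M h = sqrt (\<integral>x. (h x)\<^sup>2 \<partial>M)"

section \<open>Pointed Gromov-Hausdorff convergence\<close>

text \<open>
  \<open>f\<close> maps the \<open>r\<close>-ball about \<open>p\<close> in \<open>X\<close> to \<open>Y\<close>, takes \<open>p\<close> to \<open>q\<close>, has distortion less than \<open>\<delta>\<close>
  there, and its image is \<open>\<delta>\<close>-dense in the \<open>(r - \<delta>)\<close>-ball about \<open>q\<close>.  Pointed convergence is the
  definition of Burago, Burago and Ivanov, A Course in Metric Geometry, Section 8.1.
\<close>

definition GH_approx :: "real \<Rightarrow> real \<Rightarrow> 'a set \<Rightarrow> ('a \<Rightarrow> 'a \<Rightarrow> real) \<Rightarrow> 'a \<Rightarrow>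
    'b set \<Rightarrow> ('b \<Rightarrow> 'b \<Rightarrow> real) \<Rightarrow> 'b \<Rightarrow> ('a \<Rightarrow> 'b) \<Rightarrow> bool" where
  "GH_approx r \<delta> X d p Y e q f \<longleftrightarrow>
     f p = q \<and>
     (\<forall>x\<in>X. d p x < r \<longrightarrow> f x \<in> Y) \<and>
     (\<forall>x\<in>X. \<forall>x'\<in>X. d p x < r \<and> d p x' < r \<longrightarrow> \<bar>e (f x) (f x') - d x x'\<bar> < \<delta>) \<and>
     (\<forall>y\<in>Y. e q y < r - \<delta> \<longrightarrow> (\<exists>x\<in>X. d p x < r \<and> e (f x) y < \<delta>))"

definition pointed_GH_tendsto :: "('i \<Rightarrow> 'a set) \<Rightarrow> ('i \<Rightarrow> 'a \<Rightarrow> 'a \<Rightarrow> real) \<Rightarrow> ('i \<Rightarrow> 'a) \<Rightarrow>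
    'b set \<Rightarrow> ('b \<Rightarrow> 'b \<Rightarrow> real) \<Rightarrow> 'b \<Rightarrow> 'i filter \<Rightarrow> bool" where
  "pointed_GH_tendsto X d p Y e q F \<longleftrightarrow>
     (\<forall>\<^sub>F a in F. Metric_space (X a) (d a) \<and> p a \<in> X a) \<and> Metric_space Y e \<and> q \<in> Y \<and>
     (\<forall>r>0. \<forall>\<delta>>0. \<forall>\<^sub>F a in F. \<exists>f. GH_approx r \<delta> (X a) (d a) (p a) Y e q f)"

text \<open>
  The one-point union of two copies of \<open>\<real>\<^sup>4\<close>, joined at their origins, realised inside
  \<open>\<real>\<^sup>4 \<times> \<real>\<^sup>4\<close>.  The distance is the Euclidean one within each copy and
  \<open>norm x + norm y\<close> between \<open>(x, 0)\<close> and \<open>(0, y)\<close>.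
\<close>

definition wedge_R4 :: "((real^4) \<times> (real^4)) set" where
  "wedge_R4 = {(x, y). x = 0 \<or> y = 0}"

definition wedge_R4_dist :: "(real^4) \<times> (real^4) \<Rightarrow> (real^4) \<times> (real^4) \<Rightarrow> real" where
  "wedge_R4_dist a b = dist (fst a) (fst b) + dist (snd a) (snd b)"

section \<open>The round three-sphere\<close>

definition punctured_R4 :: "(real^4) set" where
  "punctured_R4 = - {0}"

text \<open>Quaternion multiplication, with \<open>real^4\<close> having the basis \<open>1, i, j, k\<close>.\<close>

definition qmult :: "real^4 \<Rightarrow> real^4 \<Rightarrow> real^4" where
  "qmult a b = (\<chi> i.
     if i = 1 then a$1 * b$1 - a$2 * b$2 - a$3 * b$3 - a$4 * b$4
     else if i = 2 then a$1 * b$2 + a$2 * b$1 + a$3 * b$4 - a$4 * b$3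
     else if i = 3 then a$1 * b$3 - a$2 * b$4 + a$3 * b$1 + a$4 * b$2
     else a$1 * b$4 + a$2 * b$3 - a$3 * b$2 + a$4 * b$1)"

definition imag_unit :: "3 \<Rightarrow> real^4" where
  "imag_unit m = (if m = 1 then axis 2 1 else if m = 2 then axis 3 1 else axis 4 1)"

text \<open>
  A 1-form on the unit sphere is a map \<open>\<eta>\<close> with \<open>\<eta> p\<close> in \<open>T\<^sub>p S\<^sup>3 = {v. v \<bullet> p = 0}\<close>, identified with its
  dual by the round metric.  \<open>coframe m\<close> is the left-invariant unit coframe; the minus sign
  gives the structure equations \<open>d\<eta>\<^sup>1 = 2 \<eta>\<^sup>2 \<and> \<eta>\<^sup>3\<close> and cyclically, and thereby the orientation.  Indices of type
  \<open>3\<close> are added modulo 3, so that \<open>m, m + 1, m + 2\<close> is a cyclic permutation of \<open>1, 2, 3\<close>.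
\<close>

definition coframe :: "3 \<Rightarrow> real^4 \<Rightarrow> real^4" where
  "coframe m p = - qmult p (imag_unit m)"

definition sphere_form1 :: "(real^4 \<Rightarrow> real^4) \<Rightarrow> bool" where
  "sphere_form1 \<eta> \<longleftrightarrow>
     (\<forall>p\<in>sphere 0 1. \<eta> p \<bullet> p = 0) \<and> smooth1_on punctured_R4 (pullback1 sgn \<eta>)"

text \<open>
  A form on the sphere is regarded, as usual on a product \<open>\<real>\<^sup>>\<^sup>0 \<times> S\<^sup>3\<close>, as a form on \<open>\<real>\<^sup>4 - {0}\<close> via the projection
  \<open>sgn x = x / norm x\<close>; this pullback commutes with \<open>d\<close>.  The Hodge stars \<open>\<Lambda>\<^sup>1 \<rightarrow> \<Lambda>\<^sup>2\<close> and \<open>\<Lambda>\<^sup>2 \<rightarrow> \<Lambda>\<^sup>1\<close>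
  of the sphere are written in the oriented orthonormal coframe.
\<close>

definition sphere_star1 :: "(real^4 \<Rightarrow> real^4) \<Rightarrow> real^4 \<Rightarrow> real^4^4" where
  "sphere_star1 \<eta> p =
     (\<Sum>m\<in>UNIV. (\<eta> p \<bullet> coframe m p) *\<^sub>R wedge (coframe (m + 1) p) (coframe (m + 2) p))"

definition sphere_star2 :: "(real^4 \<Rightarrow> real^4^4) \<Rightarrow> real^4 \<Rightarrow> real^4" where
  "sphere_star2 \<zeta> p =
     (\<Sum>m\<in>UNIV. eval2 (\<zeta> p) (coframe (m + 1) p) (coframe (m + 2) p) *\<^sub>R coframe m p)"

definition sphere_div_free :: "(real^4 \<Rightarrow> real^4) \<Rightarrow> bool" where
  "sphere_div_free \<eta> \<longleftrightarrow>
     (\<forall>x\<in>punctured_R4. ext_d2 (pullback2 sgn (sphere_star1 \<eta>)) x = 0)"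

definition sphere_star_d :: "(real^4 \<Rightarrow> real^4) \<Rightarrow> real^4 \<Rightarrow> real^4" where
  "sphere_star_d \<eta> = sphere_star2 (ext_d1 (pullback1 sgn \<eta>))"

section \<open>Self-dual forms on the cone\<close>

text \<open>The oriented orthonormal coframe \<open>dt, t\<eta>\<^sup>1, t\<eta>\<^sup>2, t\<eta>\<^sup>3\<close> of the flat metric.\<close>

definition cone_dt :: "real^4 \<Rightarrow> real^4" where
  "cone_dt x = sgn x"

definition cone_coframe :: "3 \<Rightarrow> real^4 \<Rightarrow> real^4" where
  "cone_coframe m x = norm x *\<^sub>R pullback1 sgn (coframe m) x"

text \<open>
  The Hodge star on 2-forms for the flat metric, and hence for every metric conformal to it. As the
  coframe is orthonormal for the Euclidean inner product, its members also serve as the dual frame.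
\<close>

definition hodge_star :: "real^4 \<Rightarrow> real^4^4 \<Rightarrow> real^4^4" where
  "hodge_star x w = (\<Sum>m\<in>UNIV.
      eval2 w (cone_dt x) (cone_coframe m x) *\<^sub>R
        wedge (cone_coframe (m + 1) x) (cone_coframe (m + 2) x) +
      eval2 w (cone_coframe (m + 1) x) (cone_coframe (m + 2) x) *\<^sub>R
        wedge (cone_dt x) (cone_coframe m x))"

definition self_dual :: "real^4 \<Rightarrow> real^4^4 \<Rightarrow> bool" where
  "self_dual x w \<longleftrightarrow> alternating w \<and> hodge_star x w = w"

text \<open>The interior product with \<open>\<surd>2 \<partial>\<^sub>t\<close>, and its inverse on self-dual forms.\<close>

definition F_map :: "real^4 \<Rightarrow> real^4^4 \<Rightarrow> real^4" where
  "F_map x w = (\<chi> j. eval2 w (sqrt 2 *\<^sub>R cone_dt x) (axis j 1))"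

definition F_inv :: "real^4 \<Rightarrow> real^4 \<Rightarrow> real^4^4" where
  "F_inv x = inv_into {w. self_dual x w} (F_map x)"

text \<open>The form \<open>F\<^sub>t\<inverse>(t\<eta>)\<close> on \<open>\<real>\<^sup>4 - {0}\<close> for a 1-form \<open>\<eta>\<close> on the sphere.\<close>

definition sd_form :: "(real^4 \<Rightarrow> real^4) \<Rightarrow> real^4 \<Rightarrow> real^4^4" where
  "sd_form \<eta> x = F_inv x (norm x *\<^sub>R pullback1 sgn \<eta> x)"

section \<open>The metrics and the forms\<close>

definition flat_metric :: "real^4 \<Rightarrow> real^4^4" where
  "flat_metric x = mat 1"

definition g_eps :: "real \<Rightarrow> real^4 \<Rightarrow> real^4^4" where
  "g_eps \<epsilon> x = (\<epsilon>\<^sup>2 + 1 / (norm x)\<^sup>2)\<^sup>2 *\<^sub>R flat_metric x"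

definition omega_eps ::
  "real \<Rightarrow> real \<Rightarrow> (real^4 \<Rightarrow> real^4) \<Rightarrow> (real^4 \<Rightarrow> real^4) \<Rightarrow> real \<Rightarrow> real^4 \<Rightarrow> real^4^4" where
  "omega_eps \<alpha> \<beta> \<eta>p \<eta>m \<epsilon> x =
     (\<alpha> * \<epsilon>^4) *\<^sub>R sd_form \<eta>p x + (\<beta> / norm x ^ 4) *\<^sub>R sd_form \<eta>m x"

text \<open>\<open>|\<nabla>\<omega>|\<close> with connection and norm of \<open>g\<^sub>\<epsilon>\<close>.\<close>

definition grad_norm_eps ::
  "real \<Rightarrow> real \<Rightarrow> (real^4 \<Rightarrow> real^4) \<Rightarrow> (real^4 \<Rightarrow> real^4) \<Rightarrow> real \<Rightarrow> real^4 \<Rightarrow> real" where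
  "grad_norm_eps \<alpha> \<beta> \<eta>p \<eta>m \<epsilon> x =
     form2_deriv_norm (g_eps \<epsilon> x) (cov_deriv2 (g_eps \<epsilon>) (omega_eps \<alpha> \<beta> \<eta>p \<eta>m \<epsilon>) x)"

text \<open>
  Coordinates in which \<open>g\<^sub>\<epsilon>\<close> becomes flat on the end \<open>t \<rightarrow> \<infinity>\<close> (\<open>y = \<epsilon>\<^sup>2 x\<close>) and on the end \<open>t \<rightarrow> 0\<close>
  (\<open>y = x / t\<^sup>2\<close>); the functions express \<open>x\<close> through \<open>y\<close>.
\<close>

definition chart_infty :: "real \<Rightarrow> real^4 \<Rightarrow> real^4" where
  "chart_infty \<epsilon> y = (1 / \<epsilon>\<^sup>2) *\<^sub>R y"

definition chart_zero :: "real^4 \<Rightarrow> real^4" where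
  "chart_zero y = (1 / (norm y)\<^sup>2) *\<^sub>R y"

section \<open>Consistency with the conventions for the frame, the norm and \<open>F\<^sub>t\<inverse>\<close>\<close>

lemma coframe_left_invariant: "coframe m (qmult q p) = qmult q (coframe m p)"
  by (simp add: coframe_def qmult_def vec_eq_iff forall_4 algebra_simps)

lemma coframe_scale: "coframe m (c *\<^sub>R p) = c *\<^sub>R coframe m p"
  by (simp add: coframe_def qmult_def vec_eq_iff forall_4 algebra_simps)

lemma coframe_nth:
  "coframe 1 p $ 1 = p$2" "coframe 1 p $ 2 = - p$1" "coframe 1 p $ 3 = - p$4" "coframe 1 p $ 4 = p$3"
  "coframe 2 p $ 1 = p$3" "coframe 2 p $ 2 = p$4" "coframe 2 p $ 3 = - p$1" "coframe 2 p $ 4 = - p$2"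
  "coframe 3 p $ 1 = p$4" "coframe 3 p $ 2 = - p$3" "coframe 3 p $ 3 = p$2" "coframe 3 p $ 4 = - p$1"
  by (simp_all add: coframe_def imag_unit_def qmult_def axis_def)

lemma coframe_orthonormal:
  assumes "norm p = 1"
  shows "coframe m p \<bullet> coframe n p = (if m = n then 1 else 0)" and "coframe m p \<bullet> p = 0"
proof -
  have n: "p$1 * p$1 + p$2 * p$2 + p$3 * p$3 + p$4 * p$4 = 1"
    using assms by (simp add: norm_eq_1 inner_vec_def sum_4)
  show "coframe m p \<bullet> p = 0"
    using exhaust_3[of m] by (auto simp: inner_vec_def sum_4 coframe_nth)
  show "coframe m p \<bullet> coframe n p = (if m = n then 1 else 0)"
    using exhaust_3[of m] exhaust_3[of n] n
    by (auto simp: inner_vec_def sum_4 coframe_nth algebra_simps)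
qed

lemma pd_eqI:
  assumes "(f has_derivative f') (at x)"
  shows "pd i f x = f' (axis i 1)"
  unfolding pd_def using frechet_derivative_at[OF assms] by simp

lemma pd_sgn:
  fixes x :: "real^'n"
  assumes "x \<noteq> 0"
  shows "pd i (\<lambda>y. sgn y $ k) x =
           ((if i = k then 1 else 0) - sgn x $ i * sgn x $ k) / norm x"
proof -
  have e: "(\<lambda>y::real^'n. sgn y $ k) = (\<lambda>y. y $ k / norm y)"
    by (auto simp: sgn_div_norm field_simps)
  have "((\<lambda>y. y $ k / norm y) has_derivative
          (\<lambda>h. (h $ k * norm x - x $ k * (h \<bullet> sgn x)) / (norm x * norm x))) (at x)"
    using assms
    by (auto intro!: has_derivative_divide' bounded_linear.has_derivative[OF bounded_linear_vec_nth]
         has_derivative_ident has_derivative_norm)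
  then have "pd i (\<lambda>y. sgn y $ k) x =
      (axis i 1 $ k * norm x - x $ k * (axis i 1 \<bullet> sgn x)) / (norm x * norm x)"
    unfolding e by (rule pd_eqI)
  also have "\<dots> = ((if i = k then 1 else 0) * norm x - x $ k * sgn x $ i) / (norm x * norm x)"
    by (simp add: inner_axis') (simp add: axis_def)
  finally show ?thesis
    using assms by (cases "i = k") (simp_all add: sgn_div_norm field_simps)
qed

lemma sum_pd_sgn:
  fixes x :: "real^'n"
  assumes "x \<noteq> 0" and "a \<bullet> sgn x = 0"
  shows "(\<Sum>k\<in>UNIV. a $ k * pd i (\<lambda>y. sgn y $ k) x) = a $ i / norm x"
proof -
  have "(\<Sum>k\<in>UNIV. a $ k * pd i (\<lambda>y. sgn y $ k) x) =
      (\<Sum>k\<in>UNIV. (if i = k then a $ k / norm x else 0)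
                  - sgn x $ i / norm x * (a $ k * sgn x $ k))"
    by (rule sum.cong) (auto simp: pd_sgn[OF assms(1)] diff_divide_distrib right_diff_distrib mult_ac)
  also have "\<dots> = a $ i / norm x - sgn x $ i / norm x * (a \<bullet> sgn x)"
    by (simp only: sum_subtractf sum.delta' finite UNIV_I if_True inner_vec_def inner_real_def
          flip: sum_distrib_left)
  finally show ?thesis using assms(2) by simp
qed

lemma pullback1_sgn:
  fixes x :: "real^'n"
  assumes "x \<noteq> 0" and "\<theta> (sgn x) \<bullet> sgn x = 0"
  shows "pullback1 sgn \<theta> x = (1 / norm x) *\<^sub>R \<theta> (sgn x)"
  using sum_pd_sgn[OF assms] by (simp add: pullback1_def vec_eq_iff)

lemma pullback2_sgn_wedge:
  fixes x :: "real^'n"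
  assumes "x \<noteq> 0" and "a \<bullet> sgn x = 0" and "b \<bullet> sgn x = 0"
  shows "pullback2 sgn (\<lambda>_. wedge a b) x = (1 / (norm x)\<^sup>2) *\<^sub>R wedge a b"
proof -
  let ?P = "\<lambda>a i. \<Sum>k\<in>UNIV. a $ k * pd i (\<lambda>y. sgn y $ k) x"
  have "(\<Sum>k\<in>UNIV. \<Sum>l\<in>UNIV.
      wedge a b $ k $ l * pd i (\<lambda>y. sgn y $ k) x * pd j (\<lambda>y. sgn y $ l) x)
      = ?P a i * ?P b j - ?P b i * ?P a j" for i j
    unfolding sum_product sum_subtractf[symmetric]
    by (intro sum.cong refl) (simp add: wedge_def algebra_simps)
  then show ?thesis
    using sum_pd_sgn[OF assms(1,2)] sum_pd_sgn[OF assms(1,3)]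
    by (simp add: pullback2_def wedge_def vec_eq_iff power2_eq_square diff_divide_distrib mult.commute)
qed

lemma pullback1_sgn_coframe:
  assumes "x \<noteq> 0"
  shows "pullback1 sgn (coframe m) x = (1 / (norm x)\<^sup>2) *\<^sub>R coframe m x"
  using pullback1_sgn[OF assms, of "coframe m"] coframe_orthonormal(2)[of "sgn x" m] assms
    coframe_scale[of m "1 / norm x" x]
  by (simp add: norm_sgn power2_eq_square sgn_div_norm inverse_eq_divide)

lemma norm_sq_4: "(norm (x::real^4))\<^sup>2 = x$1 * x$1 + x$2 * x$2 + x$3 * x$3 + x$4 * x$4"
  by (simp only: power2_norm_eq_inner inner_vec_def sum_4 inner_real_def)

lemma pd_coframe:
  assumes "x \<noteq> 0"
  shows "pd i (\<lambda>y. pullback1 sgn (coframe m) y $ j) x =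
    coframe m (axis i 1) $ j / (norm x)\<^sup>2 - 2 * x $ i * coframe m x $ j / ((norm x)\<^sup>2)\<^sup>2"
proof -
  have "linear (\<lambda>y. coframe m y $ j)"
    by (rule linearI)
      (auto simp: coframe_scale, simp add: coframe_def qmult_def algebra_simps)
  then have "((\<lambda>y. coframe m y $ j) has_derivative (\<lambda>y. coframe m y $ j)) (at x)"
    by (simp add: linear_imp_has_derivative)
  moreover have "((\<lambda>y. y \<bullet> y) has_derivative (\<lambda>h. x \<bullet> h + h \<bullet> x)) (at x)"
    by (intro has_derivative_inner has_derivative_ident)
  ultimately have "((\<lambda>y. coframe m y $ j / (y \<bullet> y)) has_derivative
     (\<lambda>h. (coframe m h $ j * (x \<bullet> x) - coframe m x $ j * (x \<bullet> h + h \<bullet> x)) / ((x \<bullet> x) * (x \<bullet> x)))) (at x)"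
    using assms by (intro has_derivative_divide') auto
  then have "((\<lambda>y. pullback1 sgn (coframe m) y $ j) has_derivative
     (\<lambda>h. (coframe m h $ j * (x \<bullet> x) - coframe m x $ j * (x \<bullet> h + h \<bullet> x)) / ((x \<bullet> x) * (x \<bullet> x)))) (at x)"
    by (rule has_derivative_transform_within_open[of _ _ _ _ "- {0}"])
      (use assms in \<open>auto simp: pullback1_sgn_coframe power2_norm_eq_inner\<close>)
  from pd_eqI[OF this, of i] have "pd i (\<lambda>y. pullback1 sgn (coframe m) y $ j) x =
     (coframe m (axis i 1) $ j * (x \<bullet> x) - coframe m x $ j * (2 * x $ i)) / ((x \<bullet> x) * (x \<bullet> x))"
    by (simp add: inner_axis inner_axis')
  then show ?thesis
    using assms unfolding power2_norm_eq_inner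
    by (simp add: divide_simps power2_eq_square) (simp add: algebra_simps)?
qed

lemma axis_nth_4:
  "axis (1::4) (1::real) $ 1 = 1" "axis (1::4) (1::real) $ 2 = 0"
  "axis (1::4) (1::real) $ 3 = 0" "axis (1::4) (1::real) $ 4 = 0"
  "axis (2::4) (1::real) $ 1 = 0" "axis (2::4) (1::real) $ 2 = 1"
  "axis (2::4) (1::real) $ 3 = 0" "axis (2::4) (1::real) $ 4 = 0"
  "axis (3::4) (1::real) $ 1 = 0" "axis (3::4) (1::real) $ 2 = 0"
  "axis (3::4) (1::real) $ 3 = 1" "axis (3::4) (1::real) $ 4 = 0"
  "axis (4::4) (1::real) $ 1 = 0" "axis (4::4) (1::real) $ 2 = 0"
  "axis (4::4) (1::real) $ 3 = 0" "axis (4::4) (1::real) $ 4 = 1"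
  by (simp_all add: axis_def)

lemma coframe_curl:
  "(norm x)\<^sup>2 * (coframe m (axis i 1) $ j - coframe m (axis j 1) $ i)
    - 2 * (x $ i * coframe m x $ j - x $ j * coframe m x $ i) =
   2 * wedge (coframe (m + 1) x) (coframe (m + 2) x) $ i $ j"
proof -
  have three: "(4::3) = 1" "(5::3) = 2" by simp_all
  have "\<forall>m. \<forall>i j. (x$1 * x$1 + x$2 * x$2 + x$3 * x$3 + x$4 * x$4) *
      (coframe m (axis i 1) $ j - coframe m (axis j 1) $ i)
      - 2 * (x $ i * coframe m x $ j - x $ j * coframe m x $ i) =
      2 * wedge (coframe (m + 1) x) (coframe (m + 2) x) $ i $ j"
    unfolding forall_3 forall_4 wedge_def vec_lambda_beta
    by (simp add: coframe_nth axis_nth_4 three algebra_simps)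
  then show ?thesis unfolding norm_sq_4 by blast
qed

lemma structure_equations:
  assumes "x \<noteq> 0"
  shows "ext_d1 (pullback1 sgn (coframe m)) x =
    2 *\<^sub>R wedge (pullback1 sgn (coframe (m + 1)) x) (pullback1 sgn (coframe (m + 2)) x)"
proof -
  define N where "N = (norm x)\<^sup>2"
  have N0: "N \<noteq> 0" using assms by (simp add: N_def)
  have "N\<^sup>2 * (ext_d1 (pullback1 sgn (coframe m)) x $ i $ j) =
    N\<^sup>2 * ((2 *\<^sub>R wedge (pullback1 sgn (coframe (m + 1)) x) (pullback1 sgn (coframe (m + 2)) x)) $ i $ j)"
    for i j
  proof -
    have "N\<^sup>2 * (ext_d1 (pullback1 sgn (coframe m)) x $ i $ j) =
      N * (coframe m (axis i 1) $ j - coframe m (axis j 1) $ i)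
      - 2 * (x $ i * coframe m x $ j - x $ j * coframe m x $ i)"
      using N0 unfolding ext_d1_def vec_lambda_beta pd_coframe[OF assms] N_def[symmetric]
      by (simp add: divide_simps) (simp add: power2_eq_square algebra_simps)?
    also have "\<dots> = 2 * wedge (coframe (m + 1) x) (coframe (m + 2) x) $ i $ j"
      unfolding N_def by (rule coframe_curl)
    also have "\<dots> = N\<^sup>2 * ((2 *\<^sub>R wedge (pullback1 sgn (coframe (m + 1)) x)
                                        (pullback1 sgn (coframe (m + 2)) x)) $ i $ j)"
      using N0 unfolding pullback1_sgn_coframe[OF assms] N_def[symmetric]
      by (simp add: wedge_def divide_simps) (simp add: power2_eq_square algebra_simps)?
    finally show ?thesis .
  qed
  then show ?thesis using N0 by (simp add: vec_eq_iff)
qed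

lemma cone_coframe_eq: "x \<noteq> 0 \<Longrightarrow> cone_coframe m x = coframe m (sgn x)"
  using coframe_scale[of m "1 / norm x" x]
  by (simp add: cone_coframe_def pullback1_sgn_coframe sgn_div_norm power2_eq_square inverse_eq_divide)

lemma eval2_wedge: "eval2 (wedge a b) u v = (a \<bullet> u) * (b \<bullet> v) - (a \<bullet> v) * (b \<bullet> u)"
proof -
  have "eval2 (wedge a b) u v =
      (\<Sum>i\<in>UNIV. a$i * u$i) * (\<Sum>j\<in>UNIV. b$j * v$j) - (\<Sum>i\<in>UNIV. b$i * u$i) * (\<Sum>j\<in>UNIV. a$j * v$j)"
    unfolding eval2_def wedge_def sum_subtractf[symmetric] sum_product
    by (intro sum.cong refl) (simp add: algebra_simps)
  then show ?thesis by (simp add: inner_vec_def mult.commute)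
qed

lemma eval2_linear:
  "eval2 (w + w') u v = eval2 w u v + eval2 w' u v"
  "eval2 (c *\<^sub>R w) u v = c * eval2 w u v"
  "eval2 w (c *\<^sub>R u) v = c * eval2 w u v"
  by (simp_all add: eval2_def sum.distrib[symmetric] sum_distrib_left algebra_simps)

definition sd_frame :: "real^4 \<Rightarrow> 3 \<Rightarrow> real^4^4" where
  "sd_frame u m = wedge u (coframe m u) + wedge (coframe (m + 1) u) (coframe (m + 2) u)"

lemma eval2_sd_frame:
  assumes "norm u = 1"
  shows "eval2 (sd_frame u m) u v = coframe m u \<bullet> v"
    and "eval2 (sd_frame u m) (coframe (n + 1) u) (coframe (n + 2) u) = (if m = n then 1 else 0)"
proof -
  have u: "u \<bullet> u = 1" "u \<bullet> coframe k u = 0" "coframe k u \<bullet> u = 0" for k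
    using assms coframe_orthonormal(2)[OF assms] by (simp_all add: norm_eq_1 inner_commute)
  show "eval2 (sd_frame u m) u v = coframe m u \<bullet> v"
    unfolding sd_frame_def eval2_linear eval2_wedge by (simp add: u)
  show "eval2 (sd_frame u m) (coframe (n + 1) u) (coframe (n + 2) u) = (if m = n then 1 else 0)"
    unfolding sd_frame_def eval2_linear eval2_wedge
    using exhaust_3[of m] exhaust_3[of n]
    by (auto simp: u coframe_orthonormal(1)[OF assms])
qed

lemma alternating_sd_frame: "alternating (\<Sum>m\<in>UNIV. c m *\<^sub>R sd_frame u m)"
  by (simp add: alternating_def transpose_def vec_eq_iff sum_3 sd_frame_def wedge_def algebra_simps)

lemma self_dual_iff:
  assumes "x \<noteq> 0"
  shows "self_dual x w \<longleftrightarrow> (\<exists>c. w = (\<Sum>m\<in>UNIV. c m *\<^sub>R sd_frame (sgn x) m))"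
    (is "_ \<longleftrightarrow> (\<exists>c. w = ?S c)")
proof
  have n: "norm (sgn x) = 1" using assms by (simp add: norm_sgn)
  have h: "hodge_star x w = (\<Sum>m\<in>UNIV.
      eval2 w (sgn x) (coframe m (sgn x)) *\<^sub>R
        wedge (coframe (m + 1) (sgn x)) (coframe (m + 2) (sgn x)) +
      eval2 w (coframe (m + 1) (sgn x)) (coframe (m + 2) (sgn x)) *\<^sub>R
        wedge (sgn x) (coframe m (sgn x)))" for w
    using assms by (simp add: hodge_star_def cone_dt_def cone_coframe_eq)
  show "self_dual x w" if "\<exists>c. w = ?S c"
  proof -
    from that obtain c where w: "w = ?S c" by blast
    have "eval2 w (sgn x) (coframe m (sgn x)) = c m"
      "eval2 w (coframe (m + 1) (sgn x)) (coframe (m + 2) (sgn x)) = c m" for m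
      unfolding w sum_3 eval2_linear eval2_sd_frame[OF n] coframe_orthonormal(1)[OF n]
      using exhaust_3[of m] by auto
    then have "hodge_star x w = w"
      unfolding h by (simp add: w sd_frame_def scaleR_add_right add.commute)
    then show ?thesis unfolding self_dual_def using alternating_sd_frame[of c "sgn x"] w by simp
  qed
  show "\<exists>c. w = ?S c" if "self_dual x w"
  proof -
    define A where "A m = eval2 w (sgn x) (coframe m (sgn x))" for m
    define B where "B m = eval2 w (coframe (m + 1) (sgn x)) (coframe (m + 2) (sgn x))" for m
    have w: "w = (\<Sum>m\<in>UNIV. A m *\<^sub>R wedge (coframe (m + 1) (sgn x)) (coframe (m + 2) (sgn x)) +
      B m *\<^sub>R wedge (sgn x) (coframe m (sgn x)))"
      using that unfolding self_dual_def h A_def B_def by simp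
    have u: "sgn x \<bullet> sgn x = 1" "sgn x \<bullet> coframe k (sgn x) = 0" "coframe k (sgn x) \<bullet> sgn x = 0" for k
      using n coframe_orthonormal(2)[OF n] by (simp_all add: norm_eq_1 inner_commute)
    have "A m = B m" for m
      unfolding A_def by (subst w) (use exhaust_3[of m] in
        \<open>auto simp: sum_3 eval2_linear eval2_wedge u coframe_orthonormal(1)[OF n]\<close>)
    then have "w = ?S A"
      by (subst w) (simp add: sd_frame_def scaleR_add_right add.commute)
    then show ?thesis by blast
  qed
qed

text \<open>\<open>|\<omega>|\<^sup>2 = *(\<omega> \<and> \<omega>)\<close>: for a 2-form on an oriented orthonormal frame \<open>e\<^sub>0, \<dots>, e\<^sub>3\<close> the value
  \<open>(\<omega> \<and> \<omega>)(e\<^sub>0, e\<^sub>1, e\<^sub>2, e\<^sub>3)\<close> is twice the cyclic sum of \<open>\<omega>(e\<^sub>0, e\<^sub>1) \<omega>(e\<^sub>2, e\<^sub>3)\<close>.\<close>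

lemma self_dual_norm:
  assumes "x \<noteq> 0" and "self_dual x w"
  shows "(form2_norm (flat_metric x) w)\<^sup>2 =
    2 * (\<Sum>m\<in>UNIV. eval2 w (cone_dt x) (cone_coframe m x) *
                    eval2 w (cone_coframe (m + 1) x) (cone_coframe (m + 2) x))"
proof -
  have n: "norm (sgn x) = 1" using assms by (simp add: norm_sgn)
  obtain c where w: "w = (\<Sum>m\<in>UNIV. c m *\<^sub>R sd_frame (sgn x) m)"
    using assms self_dual_iff by blast
  have e: "eval2 w (sgn x) (coframe m (sgn x)) = c m"
      "eval2 w (coframe (m + 1) (sgn x)) (coframe (m + 2) (sgn x)) = c m" for m
    unfolding w sum_3 eval2_linear eval2_sd_frame[OF n] coframe_orthonormal(1)[OF n]
    using exhaust_3[of m] by auto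
  have inv: "matrix_inv (mat 1 :: real^4^4) = mat 1"
    by (simp add: matrix_inv_def)
  have alt: "eval2 w b a = - eval2 w a b" for a b
    unfolding w sum_3 eval2_linear sd_frame_def eval2_wedge by (simp add: algebra_simps)
  have "(\<Sum>i\<in>UNIV. \<Sum>j\<in>UNIV. w $ i $ j * (wedge a b) $ i $ j) = eval2 w a b - eval2 w b a" for a b
    by (simp add: eval2_def wedge_def sum_subtractf[symmetric] algebra_simps)
  then have ww: "(\<Sum>i\<in>UNIV. \<Sum>j\<in>UNIV. w $ i $ j * (wedge a b) $ i $ j) = 2 * eval2 w a b" for a b
    using alt[of a b] by simp
  have "(\<Sum>i\<in>UNIV. \<Sum>j\<in>UNIV. w $ i $ j * w $ i $ j) =
      (\<Sum>i\<in>UNIV. \<Sum>j\<in>UNIV. w $ i $ j * (\<Sum>m\<in>UNIV. c m * sd_frame (sgn x) m $ i $ j))"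
    by (subst (2) w) simp
  also have "\<dots> = (\<Sum>m\<in>UNIV. c m * (\<Sum>i\<in>UNIV. \<Sum>j\<in>UNIV. w $ i $ j * sd_frame (sgn x) m $ i $ j))"
    by (simp add: sum_3 distrib_left sum.distrib sum_distrib_left mult_ac)
  also have "\<dots> = (\<Sum>m\<in>UNIV. c m * (4 * c m))"
    by (intro sum.cong refl)
      (simp add: sd_frame_def distrib_left sum.distrib ww e)
  finally have s: "(\<Sum>i\<in>UNIV. \<Sum>j\<in>UNIV. w $ i $ j * w $ i $ j) = 4 * (\<Sum>m\<in>UNIV. c m * c m)"
    by (simp add: sum_distrib_left mult_ac)
  have "form2_norm (flat_metric x) w = sqrt (1/2 * (\<Sum>i\<in>UNIV. \<Sum>j\<in>UNIV. w $ i $ j * w $ i $ j))"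
    unfolding form2_norm_def flat_metric_def inv Let_def
    by (simp add: mat_def sum_4)
  moreover have "0 \<le> (\<Sum>m\<in>UNIV. c m * c m)" by (simp add: sum_nonneg)
  ultimately show ?thesis
    unfolding s using assms(1) by (simp add: cone_dt_def cone_coframe_eq e)
qed

lemma coframe_expansion:
  assumes "norm u = 1" and "v \<bullet> u = 0"
  shows "(\<Sum>m\<in>UNIV. (v \<bullet> coframe m u) *\<^sub>R coframe m u) = v"
proof -
  define z where "z = v - (\<Sum>m\<in>UNIV. (v \<bullet> coframe m u) *\<^sub>R coframe m u)"
  have z0: "z \<bullet> u = 0" "z \<bullet> coframe m u = 0" for m
    using exhaust_3[of m] assms(2) coframe_orthonormal[OF assms(1)]
    by (auto simp: z_def sum_3 inner_diff_left inner_add_left)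
  have n: "u$1 * u$1 + u$2 * u$2 + u$3 * u$3 + u$4 * u$4 = 1"
    using norm_sq_4[of u] assms by simp
  have a: "z$1 * u$1 + z$2 * u$2 + z$3 * u$3 + z$4 * u$4 = 0"
    and b: "z$1 * u$2 - z$2 * u$1 - z$3 * u$4 + z$4 * u$3 = 0"
    and c: "z$1 * u$3 + z$2 * u$4 - z$3 * u$1 - z$4 * u$2 = 0"
    and d: "z$1 * u$4 - z$2 * u$3 + z$3 * u$2 - z$4 * u$1 = 0"
    using z0(1) z0(2)[of 1] z0(2)[of 2] z0(2)[of 3] by (simp_all add: inner_vec_def sum_4 coframe_nth)
  have "z$1 = 0" using n a b c d by algebra
  moreover have "z$2 = 0" using n a b c d by algebra
  moreover have "z$3 = 0" using n a b c d by algebra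
  moreover have "z$4 = 0" using n a b c d by algebra
  ultimately have "z = 0" by (simp add: vec_eq_iff forall_4)
  then show ?thesis by (simp add: z_def)
qed

lemma F_map_sd_frame:
  assumes "x \<noteq> 0"
  shows "F_map x (\<Sum>m\<in>UNIV. c m *\<^sub>R sd_frame (sgn x) m) =
    sqrt 2 *\<^sub>R (\<Sum>m\<in>UNIV. c m *\<^sub>R coframe m (sgn x))"
proof -
  have n: "norm (sgn x) = 1" using assms by (simp add: norm_sgn)
  show ?thesis
    unfolding F_map_def cone_dt_def sum_3 eval2_linear eval2_sd_frame(1)[OF n]
    by (simp add: vec_eq_iff inner_axis)
qed

lemma sd_form_formula:
  assumes "x \<noteq> 0" and "\<eta> (sgn x) \<bullet> sgn x = 0"
  shows "sd_form \<eta> x = (1 / sqrt 2) *\<^sub>R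
    (norm x *\<^sub>R wedge (cone_dt x) (pullback1 sgn \<eta> x) +
     (norm x)\<^sup>2 *\<^sub>R pullback2 sgn (sphere_star1 \<eta>) x)" (is "_ = ?R")
proof -
  let ?u = "sgn x"
  have n: "norm ?u = 1" using assms by (simp add: norm_sgn)
  define c where "c m = \<eta> ?u \<bullet> coframe m ?u" for m
  have eta: "\<eta> ?u = (\<Sum>m\<in>UNIV. c m *\<^sub>R coframe m ?u)"
    using coframe_expansion[OF n assms(2)] by (simp add: c_def)
  have "pullback2 sgn (sphere_star1 \<eta>) x =
      (\<Sum>m\<in>UNIV. c m *\<^sub>R pullback2 sgn (\<lambda>_. wedge (coframe (m + 1) ?u) (coframe (m + 2) ?u)) x)"
    by (simp add: pullback2_def sphere_star1_def c_def sum_3 vec_eq_iff algebra_simps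
        sum.distrib sum_distrib_left)
  then have star: "(norm x)\<^sup>2 *\<^sub>R pullback2 sgn (sphere_star1 \<eta>) x =
      (\<Sum>m\<in>UNIV. c m *\<^sub>R wedge (coframe (m + 1) ?u) (coframe (m + 2) ?u))"
    using assms(1) by (simp add: pullback2_sgn_wedge[OF assms(1)] coframe_orthonormal(2)[OF n]
        scaleR_sum_right)
  have "norm x *\<^sub>R wedge (cone_dt x) (pullback1 sgn \<eta> x) = wedge ?u (\<eta> ?u)"
    using assms(1) by (simp add: pullback1_sgn[of x \<eta>, OF assms] cone_dt_def wedge_def vec_eq_iff field_simps)
  also have "\<dots> = (\<Sum>m\<in>UNIV. c m *\<^sub>R wedge ?u (coframe m ?u))"
    unfolding eta by (simp add: wedge_def vec_eq_iff sum_3 algebra_simps)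
  finally have R: "?R = (\<Sum>m\<in>UNIV. (c m / sqrt 2) *\<^sub>R sd_frame ?u m)"
    unfolding star by (simp add: sd_frame_def sum_3 algebra_simps)
  have sd: "self_dual x ?R" unfolding self_dual_iff[OF assms(1)] R
    by (rule exI[of _ "\<lambda>m. c m / sqrt 2"]) simp
  have "F_map x ?R = (\<Sum>m\<in>UNIV. c m *\<^sub>R coframe m ?u)"
    unfolding R F_map_sd_frame[OF assms(1)] by (simp add: scaleR_sum_right)
  also have "\<dots> = norm x *\<^sub>R pullback1 sgn \<eta> x"
    using assms(1) by (simp add: pullback1_sgn[of x \<eta>, OF assms] flip: eta)
  finally have F: "F_map x ?R = norm x *\<^sub>R pullback1 sgn \<eta> x" .
  have "inj_on (F_map x) {w. self_dual x w}"
  proof (rule inj_onI, clarify)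
    fix w w' assume "self_dual x w" "self_dual x w'" and eq: "F_map x w = F_map x w'"
    then obtain a b where a: "w = (\<Sum>m\<in>UNIV. a m *\<^sub>R sd_frame ?u m)"
      and b: "w' = (\<Sum>m\<in>UNIV. b m *\<^sub>R sd_frame ?u m)"
      unfolding self_dual_iff[OF assms(1)] by blast
    have ab: "(\<Sum>m\<in>UNIV. a m *\<^sub>R coframe m ?u) = (\<Sum>m\<in>UNIV. b m *\<^sub>R coframe m ?u)"
      using eq unfolding a b F_map_sd_frame[OF assms(1)] by simp
    have ip: "(\<Sum>m\<in>UNIV. a m *\<^sub>R coframe m ?u) \<bullet> coframe k ?u = a k" for a k
      using exhaust_3[of k]
      by (elim disjE) (simp_all add: sum_3 inner_add_left coframe_orthonormal(1)[OF n])
    have "a k = b k" for k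
      using ip[of a k, unfolded ab, unfolded ip[of b k]] by (rule sym)
    then have "a = b" by blast
    then show "w = w'" unfolding a b by (rule arg_cong)
  qed
  from inv_into_f_f[OF this] sd show ?thesis
    unfolding sd_form_def F_inv_def F[symmetric] by simp
qed

end

theory Submission
  imports Defs
begin

text \<open>
  Three facts carry the theorem.

  First, the two eigenforms are explicit. If \<open>*d\<eta> = 2s\<eta>\<close> with \<open>s = \<plusminus>1\<close>, the 2-form \<open>\<Psi> = d(t\<^sup>2\<eta>)\<close> equals
  \<open>2(t dt \<and> \<eta> + s t\<^sup>2 *\<eta>)\<close>; it is closed, self-dual or anti-self-dual according to \<open>s\<close>, and of constant length
  when \<open>|\<eta>| = 1\<close>. Closed and (anti-)self-dual, its components in linear coordinates are harmonic, and
  \<open>0 = \<Delta>|\<Psi>|\<^sup>2 / 2 = |\<nabla>\<Psi>|\<^sup>2 + \<langle>\<Psi>, \<Delta>\<Psi>\<rangle>\<close> makes them constant (\<open>closed_dual_form_constant\<close>). Hence \<open>\<omega>\<^sub>2\<close> is a constant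
  self-dual form \<open>A\<close>, and \<open>\<omega>\<^sub>-\<^sub>2\<close> arises from a constant anti-self-dual form \<open>B\<close> by the reflection in the hyperplane
  orthogonal to \<open>x\<close> (\<open>sd_form_plus\<close>, \<open>sd_form_minus\<close>). In other words \<open>t\<^sup>-\<^sup>4\<omega>\<^sub>-\<^sub>2\<close> is the pullback of \<open>B\<close> under the
  inversion \<open>x / t\<^sup>2\<close>.

  The limits of \<open>\<omega>\<close> and of the metric can now be read off: in the coordinate \<open>y\<close> of either end the metric is
  \<open>(1 + \<epsilon>\<^sup>2/|y|\<^sup>2)\<^sup>2\<close> times the flat one, and \<open>\<omega>\<close> is \<open>\<alpha>A\<close>, respectively \<open>\<beta>B\<close>, plus \<open>\<epsilon>\<^sup>4\<close> times a form that does
  not depend on \<open>\<epsilon>\<close>.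

  Second, \<open>|\<nabla>\<omega>|\<close> has a closed form. The Christoffel terms of a conformally flat metric and the derivative of an
  inverted form are multiples of one and the same algebraic expression \<open>twist\<close>, and with \<open>N = t\<^sup>2\<close> this leads to
  \<open>|\<nabla>\<omega>|\<^sup>2 = \<epsilon>\<^sup>-\<^sup>2 24 (\<epsilon>\<^sup>2N)\<^sup>5 (1 + \<epsilon>\<^sup>2N)\<^sup>-\<^sup>8 |\<alpha>A - (\<beta>/\<epsilon>\<^sup>2N) B'|\<^sup>2\<close>, where \<open>B'\<close> is the reflected \<open>B\<close>
  (\<open>grad_norm_model_form\<close>). So \<open>|\<nabla>\<omega>|(x) = G(\<epsilon>x)/\<epsilon>\<close> with one profile \<open>G\<close>, which is bounded and square integrable for the
  volume of \<open>g\<^sub>1\<close>, and vanishes identically only if \<open>\<alpha> = \<beta> = 0\<close>. As \<open>g\<^sub>\<epsilon>\<close> is \<open>\<epsilon>\<^sup>2 g\<^sub>1\<close> after rescaling, the \<open>L\<^sup>2\<close> norm is a constant times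
  \<open>\<epsilon>\<close> and the supremum a constant times \<open>1/\<epsilon>\<close>.

  Third, with \<open>s = \<epsilon>\<^sup>2t - 1/t\<close> the metric is \<open>ds\<^sup>2 + (s\<^sup>2 + 4\<epsilon>\<^sup>2) g\<^sub>S\<^sub>3\<close>, a wormhole whose neck \<open>s = 0\<close>, the sphere
  \<open>t = 1/\<epsilon>\<close>, has diameter of order \<open>\<epsilon>\<close>. Sending \<open>x\<close> to the point with polar coordinates \<open>(|s|, x/t)\<close> in the copy of
  \<open>\<real>\<^sup>4\<close> chosen by the sign of \<open>s\<close> does not increase distances, because \<open>s\<^sup>2 \<le> s\<^sup>2 + 4\<epsilon>\<^sup>2\<close>
  (\<open>wedge_map_lower\<close>). Conversely two points can be joined either by a segment away from the origin, where the metric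
  is nearly flat, or through the neck, at a cost that tends to \<open>0\<close> with \<open>\<epsilon>\<close> (\<open>wedge_map_upper\<close>).
\<close>

section \<open>Calculus of smooth functions\<close>

lemma differentiable_cong_open:
  fixes f g :: "real^'n \<Rightarrow> real"
  assumes "open U" and "x \<in> U" and "\<And>y. y \<in> U \<Longrightarrow> f y = g y"
  shows "f differentiable (at x) \<longleftrightarrow> g differentiable (at x)" and "pd i f x = pd i g x"
proof -
  have e: "(f has_derivative D) (at x) \<longleftrightarrow> (g has_derivative D) (at x)" for D
    using has_derivative_transform_within_open[of f D x UNIV U g]
      has_derivative_transform_within_open[of g D x UNIV U f] assms by auto
  show "f differentiable (at x) \<longleftrightarrow> g differentiable (at x)"
    unfolding differentiable_def e ..
  show "pd i f x = pd i g x"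
    unfolding pd_def frechet_derivative_def e ..
qed

lemma pd_const [simp]: "pd i (\<lambda>x. c) x = 0"
  by (rule pd_eqI[OF has_derivative_const])

lemma pd_component [simp]: "pd i (\<lambda>x::real^'n. x $ k) x = (if i = k then 1 else 0)"
proof -
  have "((\<lambda>x::real^'n. x $ k) has_derivative (\<lambda>h. h $ k)) (at x)"
    by (rule bounded_linear.has_derivative[OF bounded_linear_vec_nth has_derivative_ident])
  from pd_eqI[OF this] show ?thesis by (auto simp add: axis_def)
qed

lemma differentiable_component [simp]: "(\<lambda>x::real^'n. x $ k) differentiable (at x)"
  by (rule bounded_linear_imp_differentiable) (rule bounded_linear_vec_nth)

lemma pd_add:
  assumes "f differentiable (at x)" and "g differentiable (at x)"
  shows "pd i (\<lambda>y. f y + g y) x = pd i f x + pd i g x"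
  using pd_eqI[OF has_derivative_add[OF assms[unfolded frechet_derivative_works]]]
  by (simp add: pd_def)

lemma pd_diff:
  assumes "f differentiable (at x)" and "g differentiable (at x)"
  shows "pd i (\<lambda>y. f y - g y) x = pd i f x - pd i g x"
  using pd_eqI[OF has_derivative_diff[OF assms[unfolded frechet_derivative_works]]]
  by (simp add: pd_def)

lemma pd_mult:
  assumes "f differentiable (at x)" and "g differentiable (at x)"
  shows "pd i (\<lambda>y. f y * g y) x = f x * pd i g x + pd i f x * g x"
  using pd_eqI[OF has_derivative_mult[OF assms[unfolded frechet_derivative_works]]]
  by (simp add: pd_def)

lemma pd_cmult:
  assumes "f differentiable (at x)"
  shows "pd i (\<lambda>y. c * f y) x = c * pd i f x"
  using pd_mult[OF differentiable_const assms, of i c] by simp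

lemma pd_sum:
  assumes "\<And>k. k \<in> I \<Longrightarrow> f k differentiable (at x)"
  shows "pd i (\<lambda>y. \<Sum>k\<in>I. f k y) x = (\<Sum>k\<in>I. pd i (f k) x)"
proof -
  have "((\<lambda>y. \<Sum>k\<in>I. f k y) has_derivative (\<lambda>h. \<Sum>k\<in>I. frechet_derivative (f k) (at x) h)) (at x)"
    using assms by (intro has_derivative_sum) (simp add: frechet_derivative_works)
  from pd_eqI[OF this] show ?thesis by (simp add: pd_def)
qed

lemma pd_inverse:
  fixes f :: "real^'n \<Rightarrow> real"
  assumes "f differentiable (at x)" and "f x \<noteq> 0"
  shows "pd i (\<lambda>y. inverse (f y)) x = - (pd i f x * (inverse (f x) * inverse (f x)))"
proof -
  have "((\<lambda>y. inverse (f y)) has_derivative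
      (\<lambda>h. - (inverse (f x) * frechet_derivative f (at x) h * inverse (f x)))) (at x)"
    by (rule Deriv.has_derivative_inverse[OF assms(2) assms(1)[unfolded frechet_derivative_works]])
  from pd_eqI[OF this] show ?thesis by (simp add: pd_def)
qed

lemma has_derivative_pd:
  fixes f :: "real^'n \<Rightarrow> real"
  assumes "f differentiable (at x)"
  shows "(f has_derivative (\<lambda>h. \<Sum>i\<in>UNIV. h $ i * pd i f x)) (at x)"
proof -
  let ?D = "frechet_derivative f (at x)"
  have D: "(f has_derivative ?D) (at x)"
    using assms frechet_derivative_works by blast
  then have lin: "linear ?D" by (rule has_derivative_linear)
  have "?D h = (\<Sum>i\<in>UNIV. h $ i * pd i f x)" for h
  proof -
    have "?D h = ?D (\<Sum>i\<in>UNIV. (h $ i) *\<^sub>R axis i 1)"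
      by (metis basis_expansion scalar_mult_eq_scaleR)
    also have "\<dots> = (\<Sum>i\<in>UNIV. h $ i * pd i f x)"
      by (simp add: linear_sum[OF lin] linear_scale[OF lin] pd_def)
    finally show ?thesis .
  qed
  then have "?D = (\<lambda>h. \<Sum>i\<in>UNIV. h $ i * pd i f x)" by (rule ext)
  then show ?thesis using D by simp
qed

lemma iter_pd_simps [simp]:
  "iter_pd [] f = f" "iter_pd (i # is) f = pd i (iter_pd is f)"
  "iter_pd (is @ [i]) f = iter_pd is (pd i f)"
  by (simp_all add: iter_pd_def)

lemma iter_pd_cong:
  assumes "open U" and "\<And>y. y \<in> U \<Longrightarrow> f y = g y" and "x \<in> U"
  shows "iter_pd is f x = iter_pd is g x"
  using assms(3)
proof (induction "is" arbitrary: x)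
  case (Cons i "is")
  show ?case using differentiable_cong_open(2)[OF assms(1) Cons.prems Cons.IH] by simp
qed (simp add: assms)

lemma smooth_fun_on_cong:
  assumes "open U" and "\<And>y. y \<in> U \<Longrightarrow> f y = g y"
  shows "smooth_fun_on U f \<longleftrightarrow> smooth_fun_on U g"
proof -
  have "iter_pd is f differentiable (at x) \<longleftrightarrow> iter_pd is g differentiable (at x)" if "x \<in> U" for "is" x
    by (rule differentiable_cong_open(1)[OF assms(1) that]) (rule iter_pd_cong[OF assms])
  then show ?thesis unfolding smooth_fun_on_def by blast
qed

lemma smooth_fun_on_differentiable: "smooth_fun_on U f \<Longrightarrow> x \<in> U \<Longrightarrow> f differentiable (at x)"
  unfolding smooth_fun_on_def by (metis iter_pd_simps(1))

lemma smooth_fun_on_pd: "smooth_fun_on U f \<Longrightarrow> smooth_fun_on U (pd i f)"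
  unfolding smooth_fun_on_def by (metis iter_pd_simps(3))

lemma smooth_fun_on_iter_pd: "smooth_fun_on U f \<Longrightarrow> smooth_fun_on U (iter_pd is f)"
  by (induction "is") (auto simp: smooth_fun_on_pd)

text \<open>Smoothness is the largest property of functions that implies differentiability and is inherited,
  up to equality on \<open>U\<close>, by partial derivatives.  This is what makes the closure properties below
  provable without a product rule for iterated derivatives.\<close>

lemma smooth_fun_on_coinduct:
  assumes "open U" and "P f"
    and diff: "\<And>f x. P f \<Longrightarrow> x \<in> U \<Longrightarrow> f differentiable (at x)"
    and step: "\<And>f i. P f \<Longrightarrow> \<exists>g. P g \<and> (\<forall>x\<in>U. pd i f x = g x)"
  shows "smooth_fun_on U f"
proof -
  have "\<forall>f. P f \<longrightarrow> (\<forall>x\<in>U. iter_pd is f differentiable (at x))" for "is"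
  proof (induction "is" rule: rev_induct)
    case (snoc i "is")
    show ?case
    proof (intro allI impI ballI)
      fix f x assume "P f" "x \<in> U"
      from step[OF this(1), of i] obtain g where g: "P g" "\<forall>x\<in>U. pd i f x = g x" by blast
      then have "iter_pd is (pd i f) y = iter_pd is g y" if "y \<in> U" for y
        using iter_pd_cong[OF assms(1) _ that, of "pd i f" g] by simp
      from differentiable_cong_open(1)[OF assms(1) \<open>x \<in> U\<close> this] snoc g(1) \<open>x \<in> U\<close>
      show "iter_pd (is @ [i]) f differentiable (at x)" by simp
    qed
  qed (use diff in auto)
  then show ?thesis using assms(2) unfolding smooth_fun_on_def by blast
qed

lemma smooth_fun_on_const [simp]: "open U \<Longrightarrow> smooth_fun_on U (\<lambda>x. c)"
  by (rule smooth_fun_on_coinduct[where P = "\<lambda>f. \<exists>c. f = (\<lambda>x. c)"]) auto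

lemma smooth_fun_on_component [simp]:
  assumes "open U" shows "smooth_fun_on U (\<lambda>x::real^'n. x $ k)"
proof (rule smooth_fun_on_coinduct[OF assms, where P = "\<lambda>f. f = (\<lambda>x. x $ k) \<or> (\<exists>c. f = (\<lambda>x. c))"])
  fix f :: "real^'n \<Rightarrow> real" and i
  assume f: "f = (\<lambda>x. x $ k) \<or> (\<exists>c. f = (\<lambda>x. c))"
  show "\<exists>g. (g = (\<lambda>x. x $ k) \<or> (\<exists>c. g = (\<lambda>x. c))) \<and> (\<forall>x\<in>U. pd i f x = g x)"
    by (rule exI[of _ "\<lambda>x. pd i f 0"]) (use f in auto)
qed auto

text \<open>The three operations have to be closed off together, since the derivative of an inverse contains
  products and inverses again.\<close>

inductive smooth_alg :: "(real^'n) set \<Rightarrow> (real^'n \<Rightarrow> real) \<Rightarrow> bool" for U where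
  base: "smooth_fun_on U f \<Longrightarrow> smooth_alg U f"
| add: "smooth_alg U f \<Longrightarrow> smooth_alg U g \<Longrightarrow> smooth_alg U (\<lambda>x. f x + g x)"
| mult: "smooth_alg U f \<Longrightarrow> smooth_alg U g \<Longrightarrow> smooth_alg U (\<lambda>x. f x * g x)"
| inv: "smooth_alg U f \<Longrightarrow> (\<And>x. x \<in> U \<Longrightarrow> f x \<noteq> 0) \<Longrightarrow> smooth_alg U (\<lambda>x. inverse (f x))"

lemma smooth_alg_step:
  assumes "open U" and "smooth_alg U f"
  shows "(\<forall>x\<in>U. f differentiable (at x)) \<and> (\<exists>g. smooth_alg U g \<and> (\<forall>x\<in>U. pd i f x = g x))"
  using assms(2)
proof (induction rule: smooth_alg.induct)
  case (base f)
  then show ?case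
    using smooth_fun_on_differentiable smooth_fun_on_pd smooth_alg.base by blast
next
  case (add f g)
  then obtain f' g' where "smooth_alg U f'" "\<forall>x\<in>U. pd i f x = f' x"
    "smooth_alg U g'" "\<forall>x\<in>U. pd i g x = g' x" by blast
  then have "smooth_alg U (\<lambda>x. f' x + g' x)" "\<forall>x\<in>U. pd i (\<lambda>x. f x + g x) x = f' x + g' x"
    using add.IH by (auto simp: pd_add intro: smooth_alg.add)
  then show ?case using add.IH by (auto intro: differentiable_add)
next
  case (mult f g)
  then obtain f' g' where "smooth_alg U f'" "\<forall>x\<in>U. pd i f x = f' x"
    "smooth_alg U g'" "\<forall>x\<in>U. pd i g x = g' x" by blast
  then have "smooth_alg U (\<lambda>x. f x * g' x + f' x * g x)"
    "\<forall>x\<in>U. pd i (\<lambda>x. f x * g x) x = f x * g' x + f' x * g x"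
    using mult by (auto simp: pd_mult intro!: smooth_alg.add smooth_alg.mult)
  then show ?case using mult.IH by (auto intro: differentiable_mult)
next
  case (inv f)
  then obtain f' where "smooth_alg U f'" "\<forall>x\<in>U. pd i f x = f' x" by blast
  then have "smooth_alg U (\<lambda>x. (-1) * (f' x * (inverse (f x) * inverse (f x))))"
    "\<forall>x\<in>U. pd i (\<lambda>x. inverse (f x)) x = (-1) * (f' x * (inverse (f x) * inverse (f x)))"
    using inv smooth_alg.mult[OF smooth_alg.base[OF smooth_fun_on_const[OF assms(1), of "-1"]]]
      smooth_alg.mult[OF \<open>smooth_alg U f'\<close> smooth_alg.mult[OF smooth_alg.inv smooth_alg.inv]]
    by (auto simp: pd_inverse)
  then show ?case using inv by (blast intro: differentiable_inverse)
qed

lemma smooth_fun_on_smooth_alg: "open U \<Longrightarrow> smooth_alg U f \<Longrightarrow> smooth_fun_on U f"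
  by (rule smooth_fun_on_coinduct[where P = "smooth_alg U"]) (use smooth_alg_step in blast)+

lemma smooth_fun_on_add:
  assumes "open U" and "smooth_fun_on U f" and "smooth_fun_on U g"
  shows "smooth_fun_on U (\<lambda>x. f x + g x)"
  by (rule smooth_fun_on_smooth_alg[OF assms(1) smooth_alg.add[OF assms(2,3)[THEN smooth_alg.base]]])

lemma smooth_fun_on_mult:
  assumes "open U" and "smooth_fun_on U f" and "smooth_fun_on U g"
  shows "smooth_fun_on U (\<lambda>x. f x * g x)"
  by (rule smooth_fun_on_smooth_alg[OF assms(1) smooth_alg.mult[OF assms(2,3)[THEN smooth_alg.base]]])

lemma smooth_fun_on_inverse:
  assumes "open U" and "smooth_fun_on U f" and "\<And>x. x \<in> U \<Longrightarrow> f x \<noteq> 0"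
  shows "smooth_fun_on U (\<lambda>x. inverse (f x))"
  by (rule smooth_fun_on_smooth_alg[OF assms(1) smooth_alg.inv[OF smooth_alg.base[OF assms(2)] assms(3)]])

lemma smooth_fun_on_diff:
  assumes "open U" and "smooth_fun_on U f" and "smooth_fun_on U g"
  shows "smooth_fun_on U (\<lambda>x. f x - g x)"
  using smooth_fun_on_add[OF assms(1,2) smooth_fun_on_mult[OF assms(1) smooth_fun_on_const[OF assms(1), of "-1"] assms(3)]]
  by simp

lemma smooth_fun_on_sum:
  assumes "open U" and "\<And>k. k \<in> I \<Longrightarrow> smooth_fun_on U (f k)"
  shows "smooth_fun_on U (\<lambda>x. \<Sum>k\<in>I. f k x)"
  using assms(2)
proof (induction I rule: infinite_finite_induct)
  case (insert a I)
  then show ?case using smooth_fun_on_add[OF assms(1), of "f a"] by simp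
qed (use assms(1) in simp_all)

lemmas smooth_intros = smooth_fun_on_add smooth_fun_on_diff smooth_fun_on_mult smooth_fun_on_inverse
  smooth_fun_on_sum smooth_fun_on_component smooth_fun_on_const smooth_fun_on_pd

lemma has_field_derivative_line:
  fixes f :: "real^'n \<Rightarrow> real"
  assumes "f differentiable (at (a + t *\<^sub>R axis i 1))"
  shows "((\<lambda>t. f (a + t *\<^sub>R axis i 1)) has_field_derivative pd i f (a + t *\<^sub>R axis i 1)) (at t)"
proof -
  let ?D = "frechet_derivative f (at (a + t *\<^sub>R axis i 1))"
  have D: "(f has_derivative ?D) (at (a + t *\<^sub>R axis i 1))"
    using assms frechet_derivative_works by blast
  have "((\<lambda>t. a + t *\<^sub>R axis i 1) has_derivative (\<lambda>h. h *\<^sub>R axis i 1)) (at t)"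
    by (auto intro!: derivative_eq_intros)
  from has_derivative_compose[OF this D]
  have "((\<lambda>t. f (a + t *\<^sub>R axis i 1)) has_derivative (\<lambda>h. ?D (h *\<^sub>R axis i 1))) (at t)" .
  moreover have "(\<lambda>h. ?D (h *\<^sub>R axis i 1)) = (*) (pd i f (a + t *\<^sub>R axis i 1))"
    using linear_scale[OF has_derivative_linear[OF D]] by (auto simp: pd_def)
  ultimately show ?thesis by (simp add: has_field_derivative_def)
qed

text \<open>The second difference of \<open>f\<close> is symmetric in the two directions, and the mean value theorem, used
  twice, turns it into a mixed derivative at a nearby point.\<close>

lemma second_difference_mvt:
  fixes f :: "real^'n \<Rightarrow> real"
  assumes f: "\<And>y. y \<in> ball x r \<Longrightarrow> f differentiable (at y)"
    and f': "\<And>y. y \<in> ball x r \<Longrightarrow> pd i f differentiable (at y)"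
    and h: "0 < h" "2 * h < r"
  shows "\<exists>z\<in>ball x r. f (x + h *\<^sub>R axis i 1 + h *\<^sub>R axis k 1) - f (x + h *\<^sub>R axis i 1)
      - f (x + h *\<^sub>R axis k 1) + f x = h * h * pd k (pd i f) z"
proof -
  have near: "x + s *\<^sub>R axis i 1 + t *\<^sub>R axis k 1 \<in> ball x r" if "0 \<le> s" "s \<le> h" "0 \<le> t" "t \<le> h" for s t
  proof -
    have "norm (s *\<^sub>R axis i (1::real) + t *\<^sub>R axis k 1 :: real^'n) \<le> \<bar>s\<bar> + \<bar>t\<bar>"
      by (rule order_trans[OF norm_triangle_ineq]) simp
    also have "\<dots> < r" using that h by linarith
    finally have "norm (x - (x + s *\<^sub>R axis i (1::real) + t *\<^sub>R axis k 1)) < r"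
      by (metis add.assoc add_diff_cancel_left' norm_minus_commute)
    then show ?thesis by (simp add: dist_norm)
  qed
  have comm: "x + t *\<^sub>R axis k 1 + s *\<^sub>R axis i 1 = x + s *\<^sub>R axis i 1 + t *\<^sub>R axis k 1" for s t
    by (simp add: algebra_simps)
  define \<phi> where "\<phi> s = f (x + h *\<^sub>R axis k 1 + s *\<^sub>R axis i 1) - f (x + s *\<^sub>R axis i 1)" for s
  have "(\<phi> has_field_derivative
      pd i f (x + h *\<^sub>R axis k 1 + s *\<^sub>R axis i 1) - pd i f (x + s *\<^sub>R axis i 1)) (at s)" if "0 \<le> s" "s \<le> h" for s
    unfolding \<phi>_def using near[of s h] near[of s 0] h that
    by (intro DERIV_diff has_field_derivative_line f) (simp_all add: comm)
  from MVT2[OF h(1), of \<phi>, OF this] obtain s where s: "0 < s" "s < h" and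
    1: "\<phi> h - \<phi> 0 = h * (pd i f (x + h *\<^sub>R axis k 1 + s *\<^sub>R axis i 1) - pd i f (x + s *\<^sub>R axis i 1))"
    by auto
  have "((\<lambda>t. pd i f (x + s *\<^sub>R axis i 1 + t *\<^sub>R axis k 1)) has_field_derivative
      pd k (pd i f) (x + s *\<^sub>R axis i 1 + t *\<^sub>R axis k 1)) (at t)" if "0 \<le> t" "t \<le> h" for t
    using near[of s t] s that by (intro has_field_derivative_line f') simp
  from MVT2[OF h(1), OF this] obtain t where t: "0 < t" "t < h" and
    2: "pd i f (x + s *\<^sub>R axis i 1 + h *\<^sub>R axis k 1) - pd i f (x + s *\<^sub>R axis i 1)
      = h * pd k (pd i f) (x + s *\<^sub>R axis i 1 + t *\<^sub>R axis k 1)" by auto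
  show ?thesis
    by (rule bexI[of _ "x + s *\<^sub>R axis i 1 + t *\<^sub>R axis k 1"])
      (use 1 2 s t near[of s t] in \<open>auto simp: \<phi>_def comm\<close>)
qed

text \<open>The point produced by the mean value theorem depends on the order of the two derivatives, but both
  points tend to \<open>x\<close> with the step, and the mixed derivatives are continuous.\<close>

lemma pd_commute:
  fixes f :: "real^'n \<Rightarrow> real"
  assumes U: "open U" "x \<in> U" and f: "smooth_fun_on U f"
  shows "pd i (pd k f) x = pd k (pd i f) x"
proof (rule ccontr)
  define e where "e = \<bar>pd i (pd k f) x - pd k (pd i f) x\<bar> / 2"
  assume "pd i (pd k f) x \<noteq> pd k (pd i f) x"
  then have e: "e > 0" by (simp add: e_def)
  have "isCont (pd i (pd k f)) x" "isCont (pd k (pd i f)) x"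
    using f U by (auto intro!: differentiable_imp_continuous_within smooth_fun_on_differentiable smooth_fun_on_pd)
  then obtain d1 d2 where d: "d1 > 0" "d2 > 0"
    "\<And>y. dist y x < d1 \<Longrightarrow> dist (pd i (pd k f) y) (pd i (pd k f) x) < e"
    "\<And>y. dist y x < d2 \<Longrightarrow> dist (pd k (pd i f) y) (pd k (pd i f) x) < e"
    unfolding continuous_at_eps_delta using e by (metis (no_types, lifting) dist_commute)
  obtain d3 where d3: "d3 > 0" "ball x d3 \<subseteq> U" using U openE by blast
  define r where "r = min d1 (min d2 d3)"
  have r: "r > 0" "ball x r \<subseteq> U" using d d3 by (auto simp: r_def)
  have sm: "f differentiable (at y)" "pd l f differentiable (at y)" if "y \<in> ball x r" for y l
    using that r(2) smooth_fun_on_differentiable[OF f] smooth_fun_on_differentiable[OF smooth_fun_on_pd[OF f]]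
    by blast+
  have h: "0 < r/3" "2 * (r/3) < r" using r(1) by auto
  obtain z where z: "z \<in> ball x r" "f (x + (r/3) *\<^sub>R axis i 1 + (r/3) *\<^sub>R axis k 1) - f (x + (r/3) *\<^sub>R axis i 1)
      - f (x + (r/3) *\<^sub>R axis k 1) + f x = r/3 * (r/3) * pd k (pd i f) z"
    using second_difference_mvt[OF sm(1) sm(2) h, where k = k] by blast
  obtain z' where z': "z' \<in> ball x r" "f (x + (r/3) *\<^sub>R axis k 1 + (r/3) *\<^sub>R axis i 1) - f (x + (r/3) *\<^sub>R axis k 1)
      - f (x + (r/3) *\<^sub>R axis i 1) + f x = r/3 * (r/3) * pd i (pd k f) z'"
    using second_difference_mvt[OF sm(1) sm(2) h, where k = i] by blast
  have comm: "x + (r/3) *\<^sub>R axis i 1 + (r/3) *\<^sub>R axis k 1 = x + (r/3) *\<^sub>R axis k 1 + (r/3) *\<^sub>R axis i 1"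
    by (simp add: add_ac)
  have "r/3 * (r/3) * pd k (pd i f) z = r/3 * (r/3) * pd i (pd k f) z'"
    unfolding z(2)[symmetric] z'(2)[symmetric] comm by linarith
  then have "pd k (pd i f) z = pd i (pd k f) z'" using r(1) by simp
  moreover have "dist (pd i (pd k f) z') (pd i (pd k f) x) < e" "dist (pd k (pd i f) z) (pd k (pd i f) x) < e"
    using d(3)[of z'] d(4)[of z] z(1) z'(1) by (auto simp: r_def dist_commute)
  ultimately have "dist (pd i (pd k f) x) (pd k (pd i f) x) < 2 * e"
    using dist_triangle3[of "pd i (pd k f) x" "pd k (pd i f) x" "pd i (pd k f) z'"] by simp
  then show False by (simp add: e_def dist_real_def)
qed

lemma smooth_fun_on_zero_derivative_constant:
  fixes f :: "real^'n \<Rightarrow> real"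
  assumes "open U" and "connected U" and "smooth_fun_on U f"
    and "\<And>i x. x \<in> U \<Longrightarrow> pd i f x = 0" and "x \<in> U" "y \<in> U"
  shows "f x = f y"
proof -
  have "(f has_derivative (\<lambda>h. 0)) (at z)" if "z \<in> U" for z
    using has_derivative_pd[of f z] smooth_fun_on_differentiable[OF assms(3) that] assms(4) that by simp
  then have d: "(f has_derivative (\<lambda>h. 0)) (at z within U)" if "z \<in> U" for z
    using that has_derivative_at_withinI by blast
  then have "continuous_on U f"
    by (meson continuous_on_eq_continuous_within has_derivative_continuous)
  then have "f constant_on U"
    using has_derivative_zero_connected_constant_on[OF assms(2,1) finite.emptyI, of f] d by simp
  then show ?thesis using assms by (auto simp: constant_on_def)
qed

section \<open>Smooth convergence\<close>

lemma iter_pd_linear: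
  assumes "open U" and "smooth_fun_on U f" and "smooth_fun_on U g" and "smooth_fun_on U h" and "x \<in> U"
  shows "iter_pd is (\<lambda>y. f y + a * g y + b * h y) x = iter_pd is f x + a * iter_pd is g x + b * iter_pd is h x"
  using assms(5)
proof (induction "is" arbitrary: x)
  case (Cons i "is")
  have d: "iter_pd is f differentiable (at x)" "iter_pd is g differentiable (at x)" "iter_pd is h differentiable (at x)"
    using assms Cons.prems by (auto intro!: smooth_fun_on_differentiable smooth_fun_on_iter_pd)
  have "pd i (iter_pd is (\<lambda>y. f y + a * g y + b * h y)) x =
      pd i (\<lambda>y. iter_pd is f y + a * iter_pd is g y + b * iter_pd is h y) x"
    by (rule differentiable_cong_open(2)[OF assms(1) Cons.prems]) (rule Cons.IH)
  also have "\<dots> = pd i (iter_pd is f) x + a * pd i (iter_pd is g) x + b * pd i (iter_pd is h) x"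
    using d by (simp add: pd_add pd_cmult differentiable_add differentiable_mult)
  finally show ?case by simp
qed simp

text \<open>All the convergence statements concern families that depend on the parameter through
  two scalar coefficients only, so that derivatives of every order converge for the same reason.\<close>

lemma smooth_fun_tendsto_linear:
  assumes U: "open U" and sm: "smooth_fun_on U f" "smooth_fun_on U g" "smooth_fun_on U h"
    and ab: "(a \<longlongrightarrow> 0) F" "(b \<longlongrightarrow> 0) F"
    and eq: "\<forall>\<^sub>F t in F. \<forall>x\<in>U. k t x = f x + a t * g x + b t * h x"
  shows "smooth_fun_tendsto U k f F"
  unfolding smooth_fun_tendsto_def
proof (intro conjI allI impI)
  show "\<forall>\<^sub>F t in F. smooth_fun_on U (k t)"
    using eq
  proof eventually_elim
    case (elim t)
    have "smooth_fun_on U (\<lambda>x. f x + a t * g x + b t * h x)"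
      using U sm by (intro smooth_intros)
    then show ?case using smooth_fun_on_cong[OF U] elim by (metis (no_types, lifting))
  qed
  show "smooth_fun_on U f" by fact
  fix "is" K assume K: "compact K \<and> K \<subseteq> U"
  have bdd: "\<exists>M. \<forall>x\<in>K. \<bar>iter_pd is u x\<bar> \<le> M" if "smooth_fun_on U u" for u
  proof -
    have "continuous_on K (iter_pd is u)"
      using smooth_fun_on_differentiable[OF smooth_fun_on_iter_pd[OF that]] K
      by (intro continuous_at_imp_continuous_on ballI differentiable_imp_continuous_within) auto
    then have "bounded (iter_pd is u ` K)" using K by (intro compact_imp_bounded compact_continuous_image) auto
    then show ?thesis by (auto simp: bounded_iff)
  qed
  obtain M where M: "\<And>x. x \<in> K \<Longrightarrow> \<bar>iter_pd is g x\<bar> \<le> M" using bdd[OF sm(2)] by blast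
  obtain L where L: "\<And>x. x \<in> K \<Longrightarrow> \<bar>iter_pd is h x\<bar> \<le> L" using bdd[OF sm(3)] by blast
  have lim: "((\<lambda>t. \<bar>a t\<bar> * M + \<bar>b t\<bar> * L) \<longlongrightarrow> 0) F"
    using ab by (auto intro!: tendsto_eq_intros)
  show "uniform_limit K (\<lambda>t. iter_pd is (k t)) (iter_pd is f) F"
  proof (rule uniform_limitI)
    fix e :: real assume "e > 0"
    with lim have "\<forall>\<^sub>F t in F. \<bar>a t\<bar> * M + \<bar>b t\<bar> * L < e" by (rule order_tendstoD)
    with eq show "\<forall>\<^sub>F t in F. \<forall>x\<in>K. dist (iter_pd is (k t) x) (iter_pd is f x) < e"
    proof eventually_elim
      case (elim t)
      show ?case
      proof
        fix x assume x: "x \<in> K"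
        have "iter_pd is (k t) x = iter_pd is (\<lambda>x. f x + a t * g x + b t * h x) x"
          by (rule iter_pd_cong[OF U]) (use elim(1) x K in auto)
        also have "\<dots> = iter_pd is f x + a t * iter_pd is g x + b t * iter_pd is h x"
          by (rule iter_pd_linear[OF U sm]) (use x K in auto)
        finally have "dist (iter_pd is (k t) x) (iter_pd is f x)
            = \<bar>a t * iter_pd is g x + b t * iter_pd is h x\<bar>" by (simp add: dist_real_def)
        also have "\<dots> \<le> \<bar>a t\<bar> * \<bar>iter_pd is g x\<bar> + \<bar>b t\<bar> * \<bar>iter_pd is h x\<bar>"
          unfolding abs_mult[symmetric] by (rule abs_triangle_ineq)
        also have "\<dots> \<le> \<bar>a t\<bar> * M + \<bar>b t\<bar> * L"
          using M[OF x] L[OF x] by (intro add_mono mult_left_mono) auto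
        also have "\<dots> < e" by (rule elim(2))
        finally show "dist (iter_pd is (k t) x) (iter_pd is f x) < e" .
      qed
    qed
  qed
qed

section \<open>Rigidity of closed self-dual forms of constant length\<close>

lemma open_punctured [simp]: "open punctured_R4"
  by (simp add: punctured_R4_def open_Compl)

lemma connected_punctured: "connected punctured_R4"
proof -
  have "connected ((UNIV :: (real^4) set) - {0})"
    by (intro connected_punctured_convex) (auto simp: aff_dim_UNIV)
  then show ?thesis by (simp add: punctured_R4_def Compl_eq_Diff_UNIV)
qed

lemma in_punctured [simp]: "x \<in> punctured_R4 \<longleftrightarrow> x \<noteq> 0"
  by (simp add: punctured_R4_def)

text \<open>The self-dual forms (\<open>s = 1\<close>) and the anti-self-dual ones (\<open>s = -1\<close>) in linear coordinates. At \<open>e\<^sub>1\<close> the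
  frame \<open>dt, \<eta>\<^sup>1, \<eta>\<^sup>2, \<eta>\<^sup>3\<close> is \<open>e\<^sub>1, -e\<^sub>2, -e\<^sub>3, -e\<^sub>4\<close>, so the orientation is opposite to the standard one;
  hence the signs.\<close>

definition dual_form :: "real \<Rightarrow> real^4^4 \<Rightarrow> bool" where
  "dual_form s w \<longleftrightarrow> alternating w \<and> w$3$4 = - s * w$1$2 \<and> w$2$4 = s * w$1$3 \<and> w$2$3 = - s * w$1$4"

lemma alternating_nth: "alternating w \<Longrightarrow> w $ j $ i = - w $ i $ j"
proof -
  assume "alternating w"
  then have "transpose w $ i $ j = (- w) $ i $ j" by (simp only: alternating_def)
  then show ?thesis by (simp add: transpose_def)
qed

lemma alternating_diag: "alternating w \<Longrightarrow> w $ i $ i = 0"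
  using alternating_nth[of w i i] by simp

lemma alternating_4:
  assumes "alternating (w::real^4^4)"
  shows "w$2$1 = - w$1$2" "w$3$1 = - w$1$3" "w$4$1 = - w$1$4" "w$3$2 = - w$2$3" "w$4$2 = - w$2$4"
    "w$4$3 = - w$3$4" "w$1$1 = 0" "w$2$2 = 0" "w$3$3 = 0" "w$4$4 = 0"
  using alternating_nth[OF assms, of 1 2] alternating_nth[OF assms, of 1 3] alternating_nth[OF assms, of 1 4]
    alternating_nth[OF assms, of 2 3] alternating_nth[OF assms, of 2 4] alternating_nth[OF assms, of 3 4]
    alternating_diag[OF assms]
  by simp_all

text \<open>The hypotheses are the equation \<open>dw = 0\<close> for an (anti-)self-dual form, solved for the gradient of one
  component; the mixed second derivatives of the other two cancel in the Laplacian. The indices are variables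
  because the three components differ by a cyclic permutation of \<open>2, 3, 4\<close>.\<close>

lemma laplacian_zero:
  assumes U: "open U" and sm: "smooth_fun_on U f" "smooth_fun_on U g" "smooth_fun_on U h"
    and eq: "\<And>y. y \<in> U \<Longrightarrow> pd i f y = s * (pd l g y - pd k h y)"
      "\<And>y. y \<in> U \<Longrightarrow> pd j f y = - pd k g y - pd l h y"
      "\<And>y. y \<in> U \<Longrightarrow> pd k f y = s * pd i h y + pd j g y"
      "\<And>y. y \<in> U \<Longrightarrow> pd l f y = pd j h y - s * pd i g y"
    and x: "x \<in> U"
  shows "pd i (pd i f) x + pd j (pd j f) x + pd k (pd k f) x + pd l (pd l f) x = 0"
proof -
  have d: "pd m g differentiable (at x)" "pd m h differentiable (at x)" for m
    using sm x by (auto intro: smooth_fun_on_differentiable smooth_fun_on_pd)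
  have "pd i (pd i f) x = s * (pd i (pd l g) x - pd i (pd k h) x)"
    using differentiable_cong_open(2)[OF U x eq(1), where i = i] d
    by (simp add: pd_cmult pd_diff differentiable_diff)
  moreover have "pd j (pd j f) x = - pd j (pd k g) x - pd j (pd l h) x"
    using differentiable_cong_open(2)[OF U x eq(2), where i = j] d pd_cmult[of "pd k g" x j "-1"]
    by (simp add: pd_diff)
  moreover have "pd k (pd k f) x = s * pd k (pd i h) x + pd k (pd j g) x"
    using differentiable_cong_open(2)[OF U x eq(3), where i = k] d
    by (simp add: pd_cmult pd_add differentiable_mult)
  moreover have "pd l (pd l f) x = pd l (pd j h) x - s * pd l (pd i g) x"
    using differentiable_cong_open(2)[OF U x eq(4), where i = l] d
    by (simp add: pd_cmult pd_diff differentiable_mult)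
  ultimately show ?thesis
    using pd_commute[OF U x sm(2), of i l] pd_commute[OF U x sm(2), of j k]
      pd_commute[OF U x sm(3), of i k] pd_commute[OF U x sm(3), of j l]
    by (simp add: algebra_simps)
qed

text \<open>Differentiating the constant \<open>a\<^sup>2 + b\<^sup>2 + c\<^sup>2\<close> twice in one direction. Summed over the directions the
  right-hand side contains only Laplacians.\<close>

lemma gradient_square_of_constant_sum:
  assumes U: "open U" and sm: "smooth_fun_on U a" "smooth_fun_on U b" "smooth_fun_on U c"
    and const: "\<And>y. y \<in> U \<Longrightarrow> a y * a y + b y * b y + c y * c y = C" and x: "x \<in> U"
  shows "(pd i a x)\<^sup>2 + (pd i b x)\<^sup>2 + (pd i c x)\<^sup>2 =
    - (a x * pd i (pd i a) x + b x * pd i (pd i b) x + c x * pd i (pd i c) x)"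
proof -
  have d: "a differentiable (at y)" "b differentiable (at y)" "c differentiable (at y)"
    "pd i a differentiable (at y)" "pd i b differentiable (at y)" "pd i c differentiable (at y)" if "y \<in> U" for y
    using sm that by (auto intro: smooth_fun_on_differentiable smooth_fun_on_pd)
  have 1: "a y * pd i a y + b y * pd i b y + c y * pd i c y = 0" if "y \<in> U" for y
  proof -
    have "pd i (\<lambda>y. a y * a y + b y * b y + c y * c y) y = pd i (\<lambda>y. C) y"
      by (rule differentiable_cong_open(2)[OF U that]) (rule const)
    then show ?thesis using d[OF that]
      by (simp add: pd_add pd_mult differentiable_add differentiable_mult algebra_simps)
  qed
  have "pd i (\<lambda>y. a y * pd i a y + b y * pd i b y + c y * pd i c y) x = pd i (\<lambda>y. 0) x"
    by (rule differentiable_cong_open(2)[OF U x]) (rule 1)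
  then show ?thesis using d[OF x]
    by (simp add: pd_add pd_mult differentiable_add differentiable_mult power2_eq_square algebra_simps)
qed

text \<open>The components \<open>a, b, c\<close> of \<open>W\<close> in the first row determine \<open>W\<close> and are harmonic, so that the constant length
  forces their gradients to vanish.\<close>

lemma closed_dual_form_constant:
  fixes W :: "real^4 \<Rightarrow> real^4^4"
  assumes U: "open U" "connected U" and s: "s * s = 1"
    and sm: "smooth2_on U W" and dual: "\<And>x. x \<in> U \<Longrightarrow> dual_form s (W x)"
    and closed: "\<And>x. x \<in> U \<Longrightarrow> ext_d2 W x = 0"
    and len: "\<And>x. x \<in> U \<Longrightarrow> (W x $ 1 $ 2)\<^sup>2 + (W x $ 1 $ 3)\<^sup>2 + (W x $ 1 $ 4)\<^sup>2 = C"
    and xy: "x \<in> U" "y \<in> U"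
  shows "W x = W y"
proof -
  define a b c where abc: "a = (\<lambda>x. W x $ 1 $ 2)" "b = (\<lambda>x. W x $ 1 $ 3)" "c = (\<lambda>x. W x $ 1 $ 4)"
  have sma: "smooth_fun_on U a" and smb: "smooth_fun_on U b" and smc: "smooth_fun_on U c"
    using sm by (simp_all add: abc smooth2_on_def)
  have d: "a differentiable (at z)" "b differentiable (at z)" "c differentiable (at z)" if "z \<in> U" for z
    using that sma smb smc smooth_fun_on_differentiable by blast+
  have comp: "W z $ 3 $ 4 = - s * a z" "W z $ 2 $ 4 = s * b z" "W z $ 2 $ 3 = - s * c z"
    "W z $ 3 $ 1 = - 1 * b z" "W z $ 4 $ 1 = - 1 * c z" "W z $ 4 $ 2 = - s * b z" if "z \<in> U" for z
    using dual[OF that] alternating_4[of "W z"] by (auto simp: dual_form_def abc)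
  have pdW: "pd i (\<lambda>z. W z $ 3 $ 4) z = - s * pd i a z" "pd i (\<lambda>z. W z $ 2 $ 4) z = s * pd i b z"
    "pd i (\<lambda>z. W z $ 2 $ 3) z = - s * pd i c z" "pd i (\<lambda>z. W z $ 3 $ 1) z = - 1 * pd i b z"
    "pd i (\<lambda>z. W z $ 4 $ 1) z = - 1 * pd i c z" "pd i (\<lambda>z. W z $ 4 $ 2) z = - s * pd i b z"
    if z: "z \<in> U" for z i
  proof -
    have lin: "pd i h z = r * pd i f z"
      if "\<And>y. y \<in> U \<Longrightarrow> h y = r * f y" and "f differentiable (at z)" for r and h f :: "real^4 \<Rightarrow> real"
      using differentiable_cong_open(2)[OF U(1) z that(1), where i = i] pd_cmult[OF that(2), of i r] by simp
    show "pd i (\<lambda>z. W z $ 3 $ 4) z = - s * pd i a z" "pd i (\<lambda>z. W z $ 2 $ 4) z = s * pd i b z"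
      "pd i (\<lambda>z. W z $ 2 $ 3) z = - s * pd i c z" "pd i (\<lambda>z. W z $ 3 $ 1) z = - 1 * pd i b z"
      "pd i (\<lambda>z. W z $ 4 $ 1) z = - 1 * pd i c z" "pd i (\<lambda>z. W z $ 4 $ 2) z = - s * pd i b z"
      by (rule lin[OF comp(1) d(1)[OF z]] lin[OF comp(2) d(2)[OF z]] lin[OF comp(3) d(3)[OF z]]
        lin[OF comp(4) d(2)[OF z]] lin[OF comp(5) d(3)[OF z]] lin[OF comp(6) d(2)[OF z]]; assumption)+
  qed
  have eqs: "s * pd 1 c z + pd 2 b z = pd 3 a z" "s * pd 1 b z + pd 4 a z = pd 2 c z"
    "pd 4 b z = s * pd 1 a z + pd 3 c z" "s * (pd 2 a z + pd 3 b z + pd 4 c z) = 0" if "z \<in> U" for z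
  proof -
    have E: "ext_d2 W z $ i $ j $ k = 0" for i j k using closed[OF that] by simp
    show "s * pd 1 c z + pd 2 b z = pd 3 a z" "s * pd 1 b z + pd 4 a z = pd 2 c z"
      "pd 4 b z = s * pd 1 a z + pd 3 c z" "s * (pd 2 a z + pd 3 b z + pd 4 c z) = 0"
      using E[of 1 2 3] E[of 1 2 4] E[of 1 3 4] E[of 2 3 4] pdW[OF that]
      by (simp_all add: ext_d2_def abc[symmetric] algebra_simps)
  qed
  have E1: "pd 2 a z + pd 3 b z + pd 4 c z = 0" if "z \<in> U" for z
    using eqs(4)[OF that] s by auto
  have ss: "s * (s * r) = r" for r using s by (metis mult.assoc mult_1)
  have e1: "pd 1 a z = s * (pd 4 b z - pd 3 c z)" if "z \<in> U" for z
    using eqs(3)[OF that] ss[of "pd 1 a z"] by simp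
  have e2: "pd 1 b z = s * (pd 2 c z - pd 4 a z)" if "z \<in> U" for z
    using eqs(2)[OF that, symmetric] ss[of "pd 1 b z"] by simp
  have e3: "pd 1 c z = s * (pd 3 a z - pd 2 b z)" if "z \<in> U" for z
    using eqs(1)[OF that, symmetric] ss[of "pd 1 c z"] by simp
  have zero: "pd i a z = 0 \<and> pd i b z = 0 \<and> pd i c z = 0" if z: "z \<in> U" for i z
  proof -
    have La: "pd 1 (pd 1 a) z + pd 2 (pd 2 a) z + pd 3 (pd 3 a) z + pd 4 (pd 4 a) z = 0"
      by (rule laplacian_zero[OF U(1) sma smb smc, of 1 s 4 3 2, OF e1 _ _ _ z])
        (use E1 eqs in \<open>simp_all add: algebra_simps eq_neg_iff_add_eq_0\<close>)
    have Lb: "pd 1 (pd 1 b) z + pd 3 (pd 3 b) z + pd 4 (pd 4 b) z + pd 2 (pd 2 b) z = 0"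
      by (rule laplacian_zero[OF U(1) smb smc sma, of 1 s 2 4 3, OF e2 _ _ _ z])
        (use E1 eqs in \<open>simp_all add: algebra_simps eq_neg_iff_add_eq_0\<close>)
    have Lc: "pd 1 (pd 1 c) z + pd 4 (pd 4 c) z + pd 2 (pd 2 c) z + pd 3 (pd 3 c) z = 0"
      by (rule laplacian_zero[OF U(1) smc sma smb, of 1 s 3 2 4, OF e3 _ _ _ z])
        (use E1 eqs in \<open>simp_all add: algebra_simps eq_neg_iff_add_eq_0\<close>)
    have len': "a y * a y + b y * b y + c y * c y = C" if "y \<in> U" for y
      using len[OF that] by (simp add: abc power2_eq_square)
    have g: "(pd i a z)\<^sup>2 + (pd i b z)\<^sup>2 + (pd i c z)\<^sup>2 =
        - (a z * pd i (pd i a) z + b z * pd i (pd i b) z + c z * pd i (pd i c) z)" for i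
      by (rule gradient_square_of_constant_sum[OF U(1) sma smb smc _ z]) (rule len')
    have "(\<Sum>i\<in>UNIV. (pd i a z)\<^sup>2 + (pd i b z)\<^sup>2 + (pd i c z)\<^sup>2) =
      - (a z * (pd 1 (pd 1 a) z + pd 2 (pd 2 a) z + pd 3 (pd 3 a) z + pd 4 (pd 4 a) z)
       + b z * (pd 1 (pd 1 b) z + pd 3 (pd 3 b) z + pd 4 (pd 4 b) z + pd 2 (pd 2 b) z)
       + c z * (pd 1 (pd 1 c) z + pd 4 (pd 4 c) z + pd 2 (pd 2 c) z + pd 3 (pd 3 c) z))"
      unfolding g sum_4 by (simp add: algebra_simps)
    also have "\<dots> = 0" unfolding La Lb Lc by simp
    finally have "(pd i a z)\<^sup>2 + (pd i b z)\<^sup>2 + (pd i c z)\<^sup>2 = 0"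
      by (subst (asm) sum_nonneg_eq_0_iff) auto
    then show ?thesis
      by (metis add_nonneg_eq_0_iff add_nonneg_nonneg power_eq_0_iff zero_le_power2)
  qed
  have "a x = a y" "b x = b y" "c x = c y"
    using smooth_fun_on_zero_derivative_constant[OF U _ _ xy] sma smb smc zero by blast+
  then show ?thesis
    using comp[OF xy(1)] comp[OF xy(2)] dual[OF xy(1)] dual[OF xy(2)] alternating_4[of "W x"] alternating_4[of "W y"]
    by (simp add: vec_eq_iff forall_4 abc dual_form_def)
qed

section \<open>The self-dual form of an eigenform\<close>

lemma pd_norm_sq:
  fixes x :: "real^'n"
  shows "pd i (\<lambda>y. (norm y)\<^sup>2) x = 2 * x $ i" and "(\<lambda>y. (norm y)\<^sup>2) differentiable (at x)"
proof -
  have "((\<lambda>y::real^'n. y \<bullet> y) has_derivative (\<lambda>h. x \<bullet> h + h \<bullet> x)) (at x)"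
    by (intro has_derivative_inner has_derivative_ident)
  then have D: "((\<lambda>y::real^'n. (norm y)\<^sup>2) has_derivative (\<lambda>h. x \<bullet> h + h \<bullet> x)) (at x)"
    by (simp add: power2_norm_eq_inner)
  from pd_eqI[OF D] show "pd i (\<lambda>y. (norm y)\<^sup>2) x = 2 * x $ i"
    by (simp add: inner_axis inner_axis')
  from D show "(\<lambda>y. (norm y)\<^sup>2) differentiable (at x)" unfolding differentiable_def by blast
qed

lemma smooth_fun_on_norm_sq: "open U \<Longrightarrow> smooth_fun_on U (\<lambda>y::real^'n. (norm y)\<^sup>2)"
  unfolding power2_norm_eq_inner inner_vec_def inner_real_def
  by (intro smooth_intros)

lemma sgn_scale_pos: "t > 0 \<Longrightarrow> sgn (t *\<^sub>R x) = sgn (x::real^'n)"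
  by (simp add: sgn_scaleR)

lemma pd_homogeneous:
  fixes f :: "real^'n \<Rightarrow> real"
  assumes hom: "\<And>t y. t > 0 \<Longrightarrow> y \<noteq> 0 \<Longrightarrow> f (t *\<^sub>R y) = t * f y"
    and diff: "\<And>y. y \<noteq> 0 \<Longrightarrow> f differentiable (at y)" and x: "x \<noteq> 0"
  shows "t > 0 \<Longrightarrow> pd i f (t *\<^sub>R x) = pd i f x" and "(\<Sum>i\<in>UNIV. x $ i * pd i f x) = f x"
proof -
  show "pd i f (t *\<^sub>R x) = pd i f x" if t: "t > 0"
  proof -
    let ?D = "frechet_derivative f (at (t *\<^sub>R x))"
    have D: "(f has_derivative ?D) (at (t *\<^sub>R x))"
      using diff[of "t *\<^sub>R x"] x t frechet_derivative_works by force
    have "((\<lambda>y. t *\<^sub>R y) has_derivative (\<lambda>h. t *\<^sub>R h)) (at x)"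
      by (auto intro!: derivative_eq_intros)
    from pd_eqI[OF has_derivative_compose[OF this D]]
    have "pd i (\<lambda>y. f (t *\<^sub>R y)) x = t * pd i f (t *\<^sub>R x)"
      using linear_scale[OF has_derivative_linear[OF D]] by (simp add: pd_def)
    moreover have "pd i (\<lambda>y. f (t *\<^sub>R y)) x = pd i (\<lambda>y. t * f y) x"
      by (rule differentiable_cong_open(2)[of "- {0}"]) (use x t hom in auto)
    ultimately show ?thesis using t pd_cmult[OF diff[OF x], of i t] by simp
  qed
  have D: "(f has_derivative (\<lambda>h. \<Sum>i\<in>UNIV. h $ i * pd i f x)) (at (1 *\<^sub>R x))"
    using has_derivative_pd[OF diff[OF x]] by simp
  have "((\<lambda>s. s *\<^sub>R x) has_derivative (\<lambda>h. h *\<^sub>R x)) (at (1::real))"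
    by (auto intro!: derivative_eq_intros)
  from has_derivative_compose[OF this D]
  have 1: "((\<lambda>s. f (s *\<^sub>R x)) has_derivative (\<lambda>h. \<Sum>i\<in>UNIV. (h *\<^sub>R x) $ i * pd i f x)) (at 1)" .
  have "((\<lambda>s. s * f x) has_derivative (\<lambda>h. h * f x)) (at (1::real))"
    by (auto intro!: derivative_eq_intros)
  then have "((\<lambda>s. f (s *\<^sub>R x)) has_derivative (\<lambda>h. h * f x)) (at (1::real))"
    by (rule has_derivative_transform_within_open[of _ _ _ _ "{0<..}"]) (use x hom in auto)
  from has_derivative_unique[OF 1 this] show "(\<Sum>i\<in>UNIV. x $ i * pd i f x) = f x"
    by (auto simp: fun_eq_iff dest: spec[of _ 1])
qed

lemma eval2_linear_right:
  "eval2 w u (v + v') = eval2 w u v + eval2 w u v'" "eval2 w u (c *\<^sub>R v) = c * eval2 w u v"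
  "eval2 w (u + u') v = eval2 w u v + eval2 w u' v"
  by (simp_all add: eval2_def sum.distrib[symmetric] sum_distrib_left algebra_simps)

lemma eval2_swap: "alternating w \<Longrightarrow> eval2 w v u = - eval2 w u v"
proof -
  assume w: "alternating w"
  have "eval2 w v u = (\<Sum>i\<in>UNIV. \<Sum>j\<in>UNIV. w$j$i * v$j * u$i)"
    unfolding eval2_def by (rule sum.swap)
  also have "\<dots> = (\<Sum>i\<in>UNIV. \<Sum>j\<in>UNIV. - (w$i$j * u$i * v$j))"
    by (intro sum.cong refl, subst alternating_nth[OF w]) simp
  finally show ?thesis by (simp add: eval2_def sum_negf)
qed

lemma eval2_axis: "eval2 w (axis i 1) (axis j 1) = w $ i $ j"
proof -
  have "w $ k $ l * axis i 1 $ k * axis j 1 $ l = (if k = i then if l = j then w $ k $ l else 0 else 0)" for k l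
    by (simp add: axis_def)
  moreover have "(\<Sum>l\<in>UNIV. if k = i then if l = j then w $ k $ l else 0 else 0) =
      (if k = i then w $ k $ j else 0)" for k
    by (cases "k = i") simp_all
  ultimately show ?thesis by (simp add: eval2_def)
qed

text \<open>The six planes spanned by two members of \<open>u, \<eta>\<^sup>1, \<eta>\<^sup>2, \<eta>\<^sup>3\<close> determine a 2-form.\<close>

lemma alternating_frame_zero:
  assumes n: "norm u = 1" and alt: "alternating w"
    and rad: "\<And>m. eval2 w u (coframe m u) = 0"
    and tan: "\<And>m. eval2 w (coframe (m + 1) u) (coframe (m + 2) u) = 0"
  shows "w = 0"
proof -
  have frame: "\<exists>p (a :: 3 \<Rightarrow> real). v = p *\<^sub>R u + (a 1 *\<^sub>R coframe 1 u + a 2 *\<^sub>R coframe 2 u + a 3 *\<^sub>R coframe 3 u)" for v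
  proof -
    let ?t = "v - (v \<bullet> u) *\<^sub>R u"
    have "?t \<bullet> u = 0" using n by (simp add: inner_diff_left norm_eq_1)
    from coframe_expansion[OF n this]
    have "v = (v \<bullet> u) *\<^sub>R u + (\<Sum>m\<in>UNIV. (?t \<bullet> coframe m u) *\<^sub>R coframe m u)" by simp
    then show ?thesis unfolding sum_3 by (intro exI[of _ "v \<bullet> u"] exI[of _ "\<lambda>m. ?t \<bullet> coframe m u"])
  qed
  have three: "(3::3) + 1 = 1" "(3::3) + 2 = 2" "(2::3) + 1 = 3" "(2::3) + 2 = 1" "(1::3) + 1 = 2" "(1::3) + 2 = 3"
    by simp_all
  have same: "eval2 w v v = 0" for v using eval2_swap[OF alt, of v v] by simp
  have v: "eval2 w u (coframe m u) = 0" "eval2 w (coframe m u) u = 0" for m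
    using rad eval2_swap[OF alt, of u "coframe m u"] by simp_all
  have t: "eval2 w (coframe 2 u) (coframe 3 u) = 0" "eval2 w (coframe 3 u) (coframe 1 u) = 0"
    "eval2 w (coframe 1 u) (coframe 2 u) = 0"
    using tan[of 1] tan[of 2] tan[of 3] unfolding three by simp_all
  have t': "eval2 w (coframe 3 u) (coframe 2 u) = 0" "eval2 w (coframe 1 u) (coframe 3 u) = 0"
    "eval2 w (coframe 2 u) (coframe 1 u) = 0"
    using t eval2_swap[OF alt] by (metis neg_0_equal_iff_equal)+
  have "eval2 w a b = 0" for a b
  proof -
    obtain p and f :: "3 \<Rightarrow> real" where a: "a = p *\<^sub>R u + (f 1 *\<^sub>R coframe 1 u + f 2 *\<^sub>R coframe 2 u + f 3 *\<^sub>R coframe 3 u)"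
      using frame by blast
    obtain q and g :: "3 \<Rightarrow> real" where b: "b = q *\<^sub>R u + (g 1 *\<^sub>R coframe 1 u + g 2 *\<^sub>R coframe 2 u + g 3 *\<^sub>R coframe 3 u)"
      using frame by blast
    show ?thesis unfolding a b
      by (simp add: eval2_linear eval2_linear_right same v t t')
  qed
  then show ?thesis by (metis eval2_axis vec_eq_iff zero_index)
qed

text \<open>The 2-form \<open>t dt \<and> \<eta> + s t\<^sup>2 *\<eta>\<close> on the cone. In linear coordinates it is constant along rays, so that its
  value at the point \<open>u\<close> of the sphere suffices.\<close>

definition cone_form :: "real \<Rightarrow> (real^4 \<Rightarrow> real^4) \<Rightarrow> real^4 \<Rightarrow> real^4^4" where
  "cone_form s \<eta> u = wedge u (\<eta> u) + s *\<^sub>R sphere_star1 \<eta> u"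

lemma alternatingI:
  assumes "\<And>i j. w $ j $ i = - w $ i $ j"
  shows "alternating w"
proof -
  have "transpose w $ i $ j = (- w) $ i $ j" for i j
    unfolding transpose_def by (simp, rule assms)
  then show ?thesis by (simp only: alternating_def vec_eq_iff) simp
qed

lemma alternating_linear:
  assumes "alternating v" and "alternating w"
  shows "alternating (v + c *\<^sub>R w)"
proof (rule alternatingI)
  fix i j
  show "(v + c *\<^sub>R w) $ j $ i = - (v + c *\<^sub>R w) $ i $ j"
    using alternating_nth[OF assms(1), of j i] alternating_nth[OF assms(2), of j i] by simp
qed

lemma dual_form_scale: "dual_form s w \<Longrightarrow> dual_form s (c *\<^sub>R w)"
  using alternating_linear[of 0 w c] by (simp add: dual_form_def alternatingI)

lemma cone_form_dual:
  assumes n: "norm u = 1" and tang: "\<eta> u \<bullet> u = 0" and unit: "norm (\<eta> u) = 1" and s: "s = 1 \<or> s = -1"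
  shows "dual_form s (cone_form s \<eta> u)"
    and "(cone_form s \<eta> u $ 1 $ 2)\<^sup>2 + (cone_form s \<eta> u $ 1 $ 3)\<^sup>2 + (cone_form s \<eta> u $ 1 $ 4)\<^sup>2 = 1"
proof -
  have three: "(4::3) = 1" "(5::3) = 2" by simp_all
  obtain c where c: "c = (\<lambda>m. \<eta> u \<bullet> coframe m u)" by blast
  have eta: "\<eta> u = c 1 *\<^sub>R coframe 1 u + c 2 *\<^sub>R coframe 2 u + c 3 *\<^sub>R coframe 3 u"
    using coframe_expansion[OF n tang] by (simp add: c sum_3)
  have star: "sphere_star1 \<eta> u = c 1 *\<^sub>R wedge (coframe 2 u) (coframe 3 u)
      + c 2 *\<^sub>R wedge (coframe 3 u) (coframe 1 u) + c 3 *\<^sub>R wedge (coframe 1 u) (coframe 2 u)"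
    by (simp add: sphere_star1_def sum_3 c three)
  have N: "u$1 * u$1 + u$2 * u$2 + u$3 * u$3 + u$4 * u$4 = 1"
    using norm_sq_4[of u] n by simp
  have "(norm (\<eta> u))\<^sup>2 = (c 1 * c 1 + c 2 * c 2 + c 3 * c 3) *
      (u$1 * u$1 + u$2 * u$2 + u$3 * u$3 + u$4 * u$4)"
    unfolding norm_sq_4 eta by (simp add: coframe_nth algebra_simps)
  then have C: "c 1 * c 1 + c 2 * c 2 + c 3 * c 3 = 1" using unit N by simp
  show "dual_form s (cone_form s \<eta> u)"
    unfolding dual_form_def
  proof (intro conjI)
    show "alternating (cone_form s \<eta> u)"
      by (simp add: alternating_def transpose_def vec_eq_iff cone_form_def star wedge_def algebra_simps)
    show "cone_form s \<eta> u $ 3 $ 4 = - s * cone_form s \<eta> u $ 1 $ 2"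
      "cone_form s \<eta> u $ 2 $ 4 = s * cone_form s \<eta> u $ 1 $ 3"
      "cone_form s \<eta> u $ 2 $ 3 = - s * cone_form s \<eta> u $ 1 $ 4"
      unfolding cone_form_def star eta using s
      by (auto simp: wedge_def coframe_nth algebra_simps)
  qed
  have "(cone_form s \<eta> u $ 1 $ 2)\<^sup>2 + (cone_form s \<eta> u $ 1 $ 3)\<^sup>2 + (cone_form s \<eta> u $ 1 $ 4)\<^sup>2 =
    (c 1 * c 1 + c 2 * c 2 + c 3 * c 3) * (u$1 * u$1 + u$2 * u$2 + u$3 * u$3 + u$4 * u$4)\<^sup>2"
    unfolding cone_form_def star eta using s
    by (auto simp: wedge_def coframe_nth power2_eq_square algebra_simps)
  then show "(cone_form s \<eta> u $ 1 $ 2)\<^sup>2 + (cone_form s \<eta> u $ 1 $ 3)\<^sup>2 + (cone_form s \<eta> u $ 1 $ 4)\<^sup>2 = 1"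
    using C N by simp
qed

text \<open>The inverse image under \<open>F\<^sub>t\<close> depends on \<open>x / t\<close> only, because \<open>t dt\<close> and \<open>t\<^sup>2\<close> absorb the scaling of the
  forms pulled back from the sphere.\<close>

lemma sd_form_eq_cone_form:
  assumes "x \<noteq> 0" and "\<eta> (sgn x) \<bullet> sgn x = 0"
  shows "sd_form \<eta> x = (1 / sqrt 2) *\<^sub>R cone_form 1 \<eta> (sgn x)"
proof -
  let ?u = "sgn x"
  have n: "norm ?u = 1" using assms by (simp add: norm_sgn)
  define c where "c m = \<eta> ?u \<bullet> coframe m ?u" for m
  have "pullback2 sgn (sphere_star1 \<eta>) x =
      (\<Sum>m\<in>UNIV. c m *\<^sub>R pullback2 sgn (\<lambda>_. wedge (coframe (m + 1) ?u) (coframe (m + 2) ?u)) x)"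
    by (simp add: pullback2_def sphere_star1_def c_def sum_3 vec_eq_iff algebra_simps
        sum.distrib sum_distrib_left)
  then have star: "(norm x)\<^sup>2 *\<^sub>R pullback2 sgn (sphere_star1 \<eta>) x = sphere_star1 \<eta> ?u"
    using assms(1) by (simp add: pullback2_sgn_wedge[OF assms(1)] coframe_orthonormal(2)[OF n]
        scaleR_sum_right sphere_star1_def c_def)
  have "norm x *\<^sub>R wedge (cone_dt x) (pullback1 sgn \<eta> x) = wedge ?u (\<eta> ?u)"
    using assms(1) by (simp add: pullback1_sgn[of x \<eta>, OF assms] cone_dt_def wedge_def vec_eq_iff field_simps)
  then show ?thesis unfolding sd_form_formula[of x \<eta>, OF assms] star by (simp add: cone_form_def)
qed

text \<open>For an eigenform, \<open>d(t\<^sup>2\<eta>) = 2t dt \<and> \<eta> + t\<^sup>2 d\<eta>\<close> is twice the form \<open>t dt \<and> \<eta> + s t\<^sup>2 *\<eta>\<close>. Being exact and of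
  constant length, the latter is constant by rigidity. In the proof \<open>\<theta>\<close> is \<open>\<eta>\<close> as a form on the cone, and
  \<open>\<psi> = t\<^sup>2\<theta>\<close>; the components of \<open>\<psi>\<close> have degree one, so it suffices to compute \<open>d\<psi>\<close> on the unit sphere.\<close>

lemma eigenform_cone_form_constant:
  assumes form: "sphere_form1 \<eta>" and s: "s = 1 \<or> s = -1"
    and eigen: "\<And>x. x \<in> sphere 0 1 \<Longrightarrow> sphere_star_d \<eta> x = (2 * s) *\<^sub>R \<eta> x"
    and unit: "\<And>x. x \<in> sphere 0 1 \<Longrightarrow> norm (\<eta> x) = 1"
  shows "\<exists>P. \<forall>x. x \<noteq> 0 \<longrightarrow> cone_form s \<eta> (sgn x) = P"
proof -
  define \<theta> where "\<theta> = pullback1 sgn \<eta>"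
  define \<psi> where "\<psi> x = (norm x)\<^sup>2 *\<^sub>R \<theta> x" for x
  have tang: "\<eta> u \<bullet> u = 0" if "norm u = 1" for u
    using form that by (auto simp: sphere_form1_def)
  have sm\<theta>: "smooth_fun_on punctured_R4 (\<lambda>x. \<theta> x $ j)" for j
    using form by (auto simp: sphere_form1_def smooth1_on_def \<theta>_def)
  have sm: "smooth_fun_on punctured_R4 (\<lambda>x. \<psi> x $ j)" for j
    unfolding \<psi>_def using sm\<theta> by (simp add: smooth_fun_on_mult smooth_fun_on_norm_sq)
  have d\<theta>: "(\<lambda>x. \<theta> x $ j) differentiable (at x)" if "x \<noteq> 0" for x j
    using smooth_fun_on_differentiable[OF sm\<theta>] that by simp
  have d\<psi>: "(\<lambda>x. \<psi> x $ j) differentiable (at x)" if "x \<noteq> 0" for x j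
    using smooth_fun_on_differentiable[OF sm] that by simp
  have \<theta>: "\<theta> x = (1 / norm x) *\<^sub>R \<eta> (sgn x)" if "x \<noteq> 0" for x
    unfolding \<theta>_def using that by (intro pullback1_sgn tang) (auto simp: norm_sgn)
  have \<psi>: "\<psi> x = norm x *\<^sub>R \<eta> (sgn x)" if "x \<noteq> 0" for x
    using that by (simp add: \<psi>_def \<theta> power2_eq_square)
  have hom: "\<psi> (t *\<^sub>R x) $ j = t * \<psi> x $ j" if "t > 0" "x \<noteq> 0" for t x j
    using that by (simp add: \<psi> sgn_scale_pos)
  have pd\<psi>: "pd i (\<lambda>x. \<psi> x $ j) x = 2 * x $ i * \<theta> x $ j + (norm x)\<^sup>2 * pd i (\<lambda>x. \<theta> x $ j) x" if "x \<noteq> 0" for i j x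
    unfolding \<psi>_def using pd_mult[OF pd_norm_sq(2) d\<theta>[OF that], of i j] by (simp add: pd_norm_sq)
  have \<psi>x: "(\<Sum>j\<in>UNIV. y $ j * \<psi> y $ j) = 0" if "y \<noteq> 0" for y
  proof -
    have "\<psi> y \<bullet> y = norm y * (\<eta> (sgn y) \<bullet> (norm y *\<^sub>R sgn y))"
      using that by (simp add: \<psi> sgn_div_norm)
    also have "\<dots> = 0" using tang[of "sgn y"] that by (simp add: norm_sgn)
    finally show ?thesis by (simp add: inner_vec_def mult.commute)
  qed
  \<comment> \<open>differentiate \<open>\<psi>(y) \<bullet> y = 0\<close>\<close>
  have rad: "(\<Sum>j\<in>UNIV. x $ j * pd i (\<lambda>x. \<psi> x $ j) x) = - \<psi> x $ i" if "x \<noteq> 0" for x i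
  proof -
    have "pd i (\<lambda>y. \<Sum>j\<in>UNIV. y $ j * \<psi> y $ j) x = pd i (\<lambda>y. 0) x"
      by (rule differentiable_cong_open(2)[of "- {0}"]) (use that \<psi>x in auto)
    moreover have "pd i (\<lambda>y. \<Sum>j\<in>UNIV. y $ j * \<psi> y $ j) x =
        (\<Sum>j\<in>UNIV. x $ j * pd i (\<lambda>x. \<psi> x $ j) x + (if i = j then \<psi> x $ j else 0))"
      using d\<psi>[OF that] by (subst pd_sum) (auto intro!: sum.cong simp: pd_mult differentiable_mult)
    ultimately show ?thesis by (simp add: sum.distrib)
  qed
  define \<Psi> where "\<Psi> = ext_d1 \<psi>"
  have \<Psi>: "\<Psi> x $ i $ j = pd i (\<lambda>y. \<psi> y $ j) x - pd j (\<lambda>y. \<psi> y $ i) x" for x i j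
    by (simp add: \<Psi>_def ext_d1_def)
  have alt: "alternating (\<Psi> x)" for x
    by (rule alternatingI) (simp add: \<Psi>)
  have sphere: "\<Psi> u = 2 *\<^sub>R cone_form s \<eta> u" if n: "norm u = 1" for u
  proof -
    have u0: "u \<noteq> 0" using n by auto
    have three: "(4::3) = 1" "(5::3) = 2" "(0::3) = 3" by simp_all
    have \<psi>u: "\<psi> u = \<eta> u" "\<theta> u = \<eta> u" using \<psi>[OF u0] \<theta>[OF u0] n by (simp_all add: sgn_div_norm)
    have uu: "u \<bullet> u = 1" "u \<bullet> coframe m u = 0" "coframe m u \<bullet> u = 0" for m
      using n coframe_orthonormal(2)[OF n] by (simp_all add: norm_eq_1 inner_commute)
    have "\<Psi> u - 2 *\<^sub>R cone_form s \<eta> u = 0"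
    proof (rule alternating_frame_zero[OF n])
      have "alternating (cone_form s \<eta> u)"
        using cone_form_dual(1)[of u \<eta> s] n tang unit s by (simp add: dual_form_def)
      then show "alternating (\<Psi> u - 2 *\<^sub>R cone_form s \<eta> u)"
        using alternating_linear[OF alt, where w = "cone_form s \<eta> u" and c = "-2"] by simp
      fix m
      have sub: "eval2 (\<Psi> u - 2 *\<^sub>R w) a b = eval2 (\<Psi> u) a b - 2 * eval2 w a b" for w a b
        using eval2_linear(1)[of "\<Psi> u" "(-2) *\<^sub>R w" a b] eval2_linear(2)[of "-2" w a b] by simp
      have "eval2 (\<Psi> u) u v = 2 * (\<eta> u \<bullet> v)" for v
      proof -
        have "eval2 (\<Psi> u) u v = (\<Sum>j\<in>UNIV. \<Sum>i\<in>UNIV. \<Psi> u $ i $ j * u $ i * v $ j)"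
          unfolding eval2_def by (rule sum.swap)
        also have "\<dots> = (\<Sum>j\<in>UNIV. ((\<Sum>i\<in>UNIV. u $ i * pd i (\<lambda>y. \<psi> y $ j) u)
            - (\<Sum>i\<in>UNIV. u $ i * pd j (\<lambda>y. \<psi> y $ i) u)) * v $ j)"
          unfolding \<Psi> sum_subtractf[symmetric] sum_distrib_right
          by (intro sum.cong refl) (simp add: algebra_simps)
        also have "\<dots> = (\<Sum>j\<in>UNIV. 2 * \<eta> u $ j * v $ j)"
          using pd_homogeneous(2)[OF hom d\<psi> u0] rad[OF u0] by (simp add: \<psi>u)
        finally show ?thesis by (simp add: inner_vec_def sum_distrib_left mult.assoc)
      qed
      moreover have "eval2 (cone_form s \<eta> u) u (coframe m u) = \<eta> u \<bullet> coframe m u"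
        unfolding cone_form_def sphere_star1_def sum_3 eval2_linear eval2_wedge
        using tang[OF n] by (simp add: uu inner_commute)
      ultimately show "eval2 (\<Psi> u - 2 *\<^sub>R cone_form s \<eta> u) u (coframe m u) = 0"
        unfolding sub by simp
      \<comment> \<open>tangentially \<open>d\<psi>\<close> and \<open>d\<theta>\<close> agree, and the eigenvalue equation applies\<close>
      let ?a = "coframe (m + 1) u" and ?b = "coframe (m + 2) u"
      have "\<Psi> u = 2 *\<^sub>R wedge u (\<theta> u) + ext_d1 \<theta> u"
        using n by (simp add: vec_eq_iff \<Psi> pd\<psi>[OF u0] ext_d1_def wedge_def algebra_simps)
      then have "eval2 (\<Psi> u) ?a ?b = eval2 (ext_d1 \<theta> u) ?a ?b"
        by (simp add: eval2_linear eval2_wedge uu)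
      also have "\<dots> = sphere_star_d \<eta> u \<bullet> coframe m u"
        unfolding sphere_star_d_def sphere_star2_def \<theta>_def[symmetric] sum_3 inner_add_left
        using exhaust_3[of m] by (auto simp: coframe_orthonormal(1)[OF n] three)
      also have "\<dots> = 2 * s * (\<eta> u \<bullet> coframe m u)" using eigen[of u] n by simp
      also have "\<eta> u \<bullet> coframe m u = eval2 (sphere_star1 \<eta> u) ?a ?b"
        unfolding sphere_star1_def sum_3 eval2_linear eval2_wedge
        using exhaust_3[of m] by (auto simp: coframe_orthonormal(1)[OF n] three)
      finally have "eval2 (\<Psi> u) ?a ?b = 2 * (s * eval2 (sphere_star1 \<eta> u) ?a ?b)" by simp
      then show "eval2 (\<Psi> u - 2 *\<^sub>R cone_form s \<eta> u) ?a ?b = 0"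
        unfolding sub cone_form_def eval2_linear eval2_wedge by (simp add: uu)
    qed
    then show ?thesis by simp
  qed
  have \<Psi>_eq: "\<Psi> x = 2 *\<^sub>R cone_form s \<eta> (sgn x)" if "x \<noteq> 0" for x
  proof -
    have "\<Psi> x $ i $ j = \<Psi> (sgn x) $ i $ j" for i j
      using pd_homogeneous(1)[OF hom d\<psi> that, of "1 / norm x"] that
      by (simp add: \<Psi> sgn_div_norm inverse_eq_divide)
    then have "\<Psi> x = \<Psi> (sgn x)" by (simp add: vec_eq_iff)
    with sphere[of "sgn x"] that show ?thesis by (simp add: norm_sgn)
  qed
  have const: "\<Psi> x = \<Psi> y" if "x \<noteq> 0" "y \<noteq> 0" for x y
  proof (rule closed_dual_form_constant[OF open_punctured connected_punctured, of s \<Psi> 4])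
    show "s * s = 1" using s by auto
    show "smooth2_on punctured_R4 \<Psi>"
      unfolding smooth2_on_def \<Psi> by (intro allI smooth_fun_on_diff smooth_fun_on_pd sm open_punctured)
    fix z :: "real^4" assume "z \<in> punctured_R4"
    then have z: "z \<noteq> 0" "norm (sgn z) = 1" by (simp_all add: norm_sgn)
    have "norm (\<eta> (sgn z)) = 1" using unit z(2) by simp
    note dual = cone_form_dual[of "sgn z" \<eta> s, OF z(2) tang[OF z(2)] this s]
    show "dual_form s (\<Psi> z)" unfolding \<Psi>_eq[OF z(1)] using dual(1) z(2) by (simp add: dual_form_scale)
    show "(\<Psi> z $ 1 $ 2)\<^sup>2 + (\<Psi> z $ 1 $ 3)\<^sup>2 + (\<Psi> z $ 1 $ 4)\<^sup>2 = 4"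
      unfolding \<Psi>_eq[OF z(1)] using dual(2) z(2) by (simp add: power_mult_distrib)
    have diff: "pd i (\<lambda>x. \<psi> x $ j) differentiable (at z)" for i j
      using smooth_fun_on_differentiable[OF smooth_fun_on_pd[OF sm]] z(1) by simp
    have "pd i (\<lambda>x. \<Psi> x $ j $ k) z = pd i (pd j (\<lambda>x. \<psi> x $ k)) z - pd i (pd k (\<lambda>x. \<psi> x $ j)) z" for i j k
      unfolding \<Psi> by (rule pd_diff[OF diff diff])
    then show "ext_d2 \<Psi> z = 0"
      using pd_commute[OF open_punctured, of z, OF _ sm] z(1) by (simp add: ext_d2_def vec_eq_iff)
  qed (use that in auto)
  have "cone_form s \<eta> (sgn x) = (1/2) *\<^sub>R \<Psi> (axis 1 1)" if "x \<noteq> 0" for x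
    using \<Psi>_eq[OF that] const[OF that, of "axis 1 1"] by simp
  then show ?thesis by blast
qed

text \<open>The reflection in the hyperplane orthogonal to \<open>x\<close>, acting on 2-forms.  It is the differential of
  the inversion \<open>x / t\<^sup>2\<close>, up to scale, so that it relates the coordinates of the two ends.\<close>

definition contract :: "real^4 \<Rightarrow> real^4^4 \<Rightarrow> real^4" where
  "contract x w = (\<chi> k. \<Sum>l\<in>UNIV. x $ l * w $ l $ k)"

definition reflect :: "real^4 \<Rightarrow> real^4^4 \<Rightarrow> real^4^4" where
  "reflect x w = w - (2 / (norm x)\<^sup>2) *\<^sub>R wedge x (contract x w)"

lemma reflect_sgn: "x \<noteq> 0 \<Longrightarrow> reflect (sgn x) w = reflect x w"
  by (simp add: reflect_def contract_def wedge_def vec_eq_iff norm_sgn sgn_div_norm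
      sum_distrib_left[symmetric] power2_eq_square field_simps flip: sum_divide_distrib)

lemma reflect_scale: "reflect x (c *\<^sub>R w) = c *\<^sub>R reflect x w"
  by (simp add: reflect_def contract_def wedge_def vec_eq_iff sum_distrib_left algebra_simps)

lemma contract_eval2: "contract x w $ k = eval2 w x (axis k 1)"
proof -
  have "w $ i $ j * x $ i * axis k 1 $ j = (if j = k then x $ i * w $ i $ j else 0)" for i j
    by (simp add: axis_def)
  then show ?thesis by (simp add: eval2_def contract_def)
qed

text \<open>The reflection changes the sign of \<open>dt\<close> and fixes all directions tangent to the sphere, so that it
  exchanges self-dual and anti-self-dual forms.\<close>

lemma reflect_cone_form:
  assumes n: "norm u = 1" and tang: "\<eta> u \<bullet> u = 0"
  shows "reflect u (cone_form s \<eta> u) = - cone_form (- s) \<eta> u"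
proof -
  have uu: "u \<bullet> u = 1" "u \<bullet> coframe m u = 0" "coframe m u \<bullet> u = 0" "\<eta> u \<bullet> u = 0" for m
    using n tang coframe_orthonormal(2)[OF n] by (simp_all add: norm_eq_1 inner_commute)
  have "contract u (cone_form s \<eta> u) $ k = \<eta> u $ k" for k
    unfolding contract_eval2 cone_form_def sphere_star1_def sum_3 eval2_linear eval2_wedge
    by (simp add: uu inner_axis)
  then have c: "contract u (cone_form s \<eta> u) = \<eta> u" by (simp add: vec_eq_iff)
  show ?thesis unfolding reflect_def c using n by (simp add: cone_form_def vec_eq_iff)
qed

text \<open>The squared length of a 2-form for the flat metric; the products of distinct basis covectors have
  length \<open>1\<close>.\<close>

definition len_sq :: "real^4^4 \<Rightarrow> real" where
  "len_sq w = (\<Sum>i\<in>UNIV. \<Sum>j\<in>UNIV. w $ i $ j * w $ i $ j) / 2"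

lemma len_sq_dual_form:
  assumes "dual_form s w" and "s = 1 \<or> s = -1"
  shows "len_sq w = 2 * ((w$1$2)\<^sup>2 + (w$1$3)\<^sup>2 + (w$1$4)\<^sup>2)"
proof -
  have w: "alternating w" "w$3$4 = - s * w$1$2" "w$2$4 = s * w$1$3" "w$2$3 = - s * w$1$4"
    using assms(1) by (simp_all add: dual_form_def)
  show ?thesis
    using assms(2) unfolding len_sq_def sum_4 alternating_4[OF w(1)] w(2-4)
    by (auto simp: power2_eq_square)
qed

lemma unit_cone_form:
  assumes "norm u = 1" and "\<eta> u \<bullet> u = 0" and "norm (\<eta> u) = 1" and "s = 1 \<or> s = -1" and "c\<^sup>2 = 1 / 2"
  shows "dual_form s (c *\<^sub>R cone_form s \<eta> u)" and "len_sq (c *\<^sub>R cone_form s \<eta> u) = 1"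
proof -
  show 1: "dual_form s (c *\<^sub>R cone_form s \<eta> u)"
    by (rule dual_form_scale[OF cone_form_dual(1)[of u \<eta> s, OF assms(1-4)]])
  show "len_sq (c *\<^sub>R cone_form s \<eta> u) = 1"
    using cone_form_dual(2)[of u \<eta> s, OF assms(1-4)]
    by (simp add: len_sq_dual_form[OF 1 assms(4)] power_mult_distrib assms(5))
qed

text \<open>For the eigenvalue \<open>2\<close> the self-dual form is the closed one, hence constant.\<close>

lemma sd_form_plus:
  assumes form: "sphere_form1 \<eta>"
    and eigen: "\<And>x. x \<in> sphere 0 1 \<Longrightarrow> sphere_star_d \<eta> x = 2 *\<^sub>R \<eta> x"
    and unit: "\<And>x. x \<in> sphere 0 1 \<Longrightarrow> norm (\<eta> x) = 1"
  shows "\<exists>A. dual_form 1 A \<and> len_sq A = 1 \<and> (\<forall>x. x \<noteq> 0 \<longrightarrow> sd_form \<eta> x = A)"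
proof -
  obtain P where P: "\<And>x. x \<noteq> 0 \<Longrightarrow> cone_form 1 \<eta> (sgn x) = P"
    using eigenform_cone_form_constant[OF form, of 1] eigen unit by auto
  have tang: "\<eta> u \<bullet> u = 0" if "norm u = 1" for u
    using form that by (auto simp: sphere_form1_def)
  have sd: "sd_form \<eta> x = (1 / sqrt 2) *\<^sub>R P" if "x \<noteq> 0" for x
    using sd_form_eq_cone_form[of x \<eta>, OF that tang] P[OF that] that by (simp add: norm_sgn)
  let ?e = "axis 1 1 :: real^4"
  have "norm (sgn ?e) = 1" by (simp add: norm_sgn)
  then have "dual_form 1 ((1 / sqrt 2) *\<^sub>R cone_form 1 \<eta> (sgn ?e))" "len_sq ((1 / sqrt 2) *\<^sub>R cone_form 1 \<eta> (sgn ?e)) = 1"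
    using unit tang by (auto intro!: unit_cone_form simp: power_divide)
  then show ?thesis using P[of ?e] sd by (intro exI[of _ "(1 / sqrt 2) *\<^sub>R P"]) simp
qed

text \<open>For the eigenvalue \<open>-2\<close> it is the anti-self-dual form built from \<open>\<eta>\<close> that is closed and constant. The
  self-dual one is its reflection.\<close>

lemma sd_form_minus:
  assumes form: "sphere_form1 \<eta>"
    and eigen: "\<And>x. x \<in> sphere 0 1 \<Longrightarrow> sphere_star_d \<eta> x = (-2) *\<^sub>R \<eta> x"
    and unit: "\<And>x. x \<in> sphere 0 1 \<Longrightarrow> norm (\<eta> x) = 1"
  shows "\<exists>B. dual_form (-1) B \<and> len_sq B = 1 \<and>
    (\<forall>x. x \<noteq> 0 \<longrightarrow> sd_form \<eta> x = reflect x B \<and> dual_form 1 (reflect x B) \<and> len_sq (reflect x B) = 1)"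
proof -
  obtain P where P: "\<And>x. x \<noteq> 0 \<Longrightarrow> cone_form (-1) \<eta> (sgn x) = P"
    using eigenform_cone_form_constant[OF form, of "-1"] eigen unit by auto
  have tang: "\<eta> u \<bullet> u = 0" if "norm u = 1" for u
    using form that by (auto simp: sphere_form1_def)
  let ?B = "(- (1 / sqrt 2)) *\<^sub>R P"
  have sd: "sd_form \<eta> x = reflect x ?B" "reflect x ?B = (1 / sqrt 2) *\<^sub>R cone_form 1 \<eta> (sgn x)" if "x \<noteq> 0" for x
  proof -
    have "reflect (sgn x) P = - cone_form 1 \<eta> (sgn x)"
      using reflect_cone_form[of "sgn x" \<eta> "-1"] tang P[OF that] that by (simp add: norm_sgn)
    then show "reflect x ?B = (1 / sqrt 2) *\<^sub>R cone_form 1 \<eta> (sgn x)"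
      unfolding reflect_sgn[OF that, symmetric] reflect_scale by simp
    then show "sd_form \<eta> x = reflect x ?B"
      using sd_form_eq_cone_form[of x \<eta>, OF that tang] that by (simp add: norm_sgn)
  qed
  have R: "dual_form 1 (reflect x ?B)" "len_sq (reflect x ?B) = 1" if "x \<noteq> 0" for x
    unfolding sd(2)[OF that] using unit tang that by (auto intro!: unit_cone_form simp: power_divide norm_sgn)
  let ?e = "axis 1 1 :: real^4"
  have "norm (sgn ?e) = 1" by (simp add: norm_sgn)
  then have "dual_form (-1) ((- (1 / sqrt 2)) *\<^sub>R cone_form (-1) \<eta> (sgn ?e))"
    "len_sq ((- (1 / sqrt 2)) *\<^sub>R cone_form (-1) \<eta> (sgn ?e)) = 1"
    using unit tang by (auto intro!: unit_cone_form simp: power_divide simp del: scaleR_minus_left)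
  then show ?thesis using P[of ?e] sd R by (intro exI[of _ ?B]) simp
qed

section \<open>Closedness and covariant derivative\<close>

lemma contract_nth: "contract x w $ k = (\<Sum>l\<in>UNIV. x $ l * w $ l $ k)"
  by (simp add: contract_def)

lemma contract_orthogonal:
  assumes "alternating w"
  shows "(\<Sum>l\<in>UNIV. x $ l * contract x w $ l) = 0"
proof -
  have "eval2 w x x = 0" using eval2_swap[OF assms, of x x] by simp
  moreover have "eval2 w x x = (\<Sum>l\<in>UNIV. x $ l * contract x w $ l)"
    unfolding eval2_def contract_nth sum_distrib_left by (subst sum.swap) (simp add: mult_ac)
  ultimately show ?thesis by simp
qed

lemma reflect_nth:
  "reflect x w $ j $ k = w $ j $ k - 2 * inverse ((norm x)\<^sup>2) * (x $ j * contract x w $ k - x $ k * contract x w $ j)"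
  by (simp add: reflect_def wedge_def divide_inverse mult.commute)

lemma alternating_reflect: "alternating w \<Longrightarrow> alternating (reflect x w)"
proof (rule alternatingI)
  fix i j assume "alternating w"
  then show "reflect x w $ j $ i = - reflect x w $ i $ j"
    using alternating_nth[of w j i] by (simp add: reflect_nth algebra_simps)
qed

lemma sum_square_norm: "(\<Sum>l\<in>UNIV. x $ l * x $ l) = (norm (x::real^'n))\<^sup>2"
  by (simp add: power2_norm_eq_inner inner_vec_def)

lemma contract_reflect:
  assumes "alternating w" and "x \<noteq> 0"
  shows "contract x (reflect x w) = - contract x w"
proof -
  have "contract x (reflect x w) $ k = - contract x w $ k" for k
  proof -
    let ?b = "contract x w" and ?n = "inverse ((norm x)\<^sup>2)"
    have "contract x (reflect x w) $ k =
        (\<Sum>l\<in>UNIV. x $ l * w $ l $ k) - 2 * ?n * ((\<Sum>l\<in>UNIV. x $ l * x $ l) * ?b $ k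
         - x $ k * (\<Sum>l\<in>UNIV. x $ l * ?b $ l))"
      unfolding contract_nth[of x "reflect x w"] reflect_nth sum_distrib_left sum_distrib_right
        sum_subtractf[symmetric]
      by (intro sum.cong refl) (simp add: algebra_simps)
    also have "\<dots> = ?b $ k - 2 * ?b $ k"
      unfolding contract_orthogonal[OF assms(1)] contract_nth[symmetric] sum_square_norm
      using assms(2) by simp
    finally show ?thesis by simp
  qed
  then show ?thesis by (simp add: vec_eq_iff)
qed

lemma reflect_reflect:
  assumes "alternating w" and "x \<noteq> 0"
  shows "reflect x (reflect x w) = w"
  by (simp add: vec_eq_iff reflect_nth[of x "reflect x w"] contract_reflect[OF assms])
    (simp add: reflect_nth algebra_simps)

lemma reflect_scale_point:
  assumes "c \<noteq> 0"
  shows "reflect (c *\<^sub>R x) w = reflect x w"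
proof -
  have b: "contract (c *\<^sub>R x) w $ k = c * contract x w $ k" for k
    by (simp add: contract_nth sum_distrib_left mult_ac)
  have "2 * inverse ((norm (c *\<^sub>R x))\<^sup>2) *
      ((c *\<^sub>R x) $ j * contract (c *\<^sub>R x) w $ k - (c *\<^sub>R x) $ k * contract (c *\<^sub>R x) w $ j) =
    2 * (inverse (c\<^sup>2) * c\<^sup>2) * inverse ((norm x)\<^sup>2) * (x $ j * contract x w $ k - x $ k * contract x w $ j)" for j k
    unfolding b by (simp add: power_mult_distrib) (simp add: power2_eq_square algebra_simps)
  then show ?thesis using assms by (simp add: vec_eq_iff reflect_nth)
qed

text \<open>The pullback of a constant form under the inversion \<open>x / t\<^sup>2\<close>: its differential is the reflection
  scaled by \<open>t\<^sup>-\<^sup>2\<close>.\<close>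

definition inverted :: "real^4^4 \<Rightarrow> real^4 \<Rightarrow> real^4^4" where
  "inverted w x = (1 / norm x ^ 4) *\<^sub>R reflect x w"

text \<open>The connection of a conformally flat metric with radial conformal factor acts on a 2-form \<open>w\<close> by a scalar
  multiple of this expression (\<open>cov_deriv_conformal\<close>), and the derivative of an inverted form has the same shape
  (\<open>pd_inverted\<close>). That one expression serves for both is what makes \<open>\<nabla>\<omega>\<close> computable.\<close>

definition twist :: "real^4 \<Rightarrow> real^4^4 \<Rightarrow> 4 \<Rightarrow> 4 \<Rightarrow> 4 \<Rightarrow> real" where
  "twist x w i j k = 2 * x $ i * w $ j $ k + x $ j * w $ i $ k + x $ k * w $ j $ i
     - (if i = j then contract x w $ k else 0) + (if i = k then contract x w $ j else 0)"

lemma inverted_nth: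
  "inverted w x $ j $ k = inverse ((norm x)\<^sup>2) * inverse ((norm x)\<^sup>2) * w $ j $ k
    - 2 * (inverse ((norm x)\<^sup>2) * inverse ((norm x)\<^sup>2) * inverse ((norm x)\<^sup>2)
       * (x $ j * contract x w $ k - x $ k * contract x w $ j))"
proof -
  have "1 / norm x ^ 4 = inverse ((norm x)\<^sup>2) * inverse ((norm x)\<^sup>2)"
    by (simp add: divide_inverse power2_eq_square power4_eq_xxxx)
  then show ?thesis by (simp add: inverted_def reflect_nth algebra_simps)
qed

lemma smooth_inverse_norm_sq: "smooth_fun_on punctured_R4 (\<lambda>x. inverse ((norm x)\<^sup>2))"
  by (rule smooth_fun_on_inverse) (auto simp: smooth_fun_on_norm_sq)

lemma smooth_contract: "open U \<Longrightarrow> smooth_fun_on U (\<lambda>x. contract x w $ k)"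
  unfolding contract_nth by (intro smooth_intros)

lemma smooth_inverted: "smooth_fun_on punctured_R4 (\<lambda>x. inverted w x $ j $ k)"
  unfolding inverted_nth
  by (intro smooth_intros open_punctured smooth_contract smooth_fun_on_mult[OF _ smooth_inverse_norm_sq]
    smooth_inverse_norm_sq)

lemma pd_inverse_norm_sq:
  assumes "x \<noteq> 0"
  shows "pd i (\<lambda>x::real^'n. inverse ((norm x)\<^sup>2)) x = - 2 * x $ i * inverse ((norm x)\<^sup>2) * inverse ((norm x)\<^sup>2)"
    and "(\<lambda>x::real^'n. inverse ((norm x)\<^sup>2)) differentiable (at x)"
  using assms pd_inverse[OF pd_norm_sq(2), of x i] differentiable_inverse[OF pd_norm_sq(2)[of x]]
  by (simp_all add: pd_norm_sq)

lemma pd_contract: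
  "pd i (\<lambda>x. contract x w $ k) x = w $ i $ k" "(\<lambda>x. contract x w $ k) differentiable (at x)"
proof -
  have "pd i (\<lambda>x. contract x w $ k) x = (\<Sum>l\<in>UNIV. pd i (\<lambda>x. x $ l * w $ l $ k) x)"
    unfolding contract_nth by (rule pd_sum) (simp add: differentiable_mult)
  also have "\<dots> = (\<Sum>l\<in>UNIV. if i = l then w $ l $ k else 0)"
    by (intro sum.cong refl) (simp add: pd_mult)
  finally show "pd i (\<lambda>x. contract x w $ k) x = w $ i $ k" by simp
  show "(\<lambda>x. contract x w $ k) differentiable (at x)"
    unfolding contract_nth by (intro differentiable_sum) (auto simp: differentiable_mult)
qed

lemma pd_inverted:
  assumes w: "alternating w" and x: "x \<noteq> 0"
  shows "pd i (\<lambda>x. inverted w x $ j $ k) x = - 2 * inverse ((norm x)\<^sup>2) ^ 3 * twist x (reflect x w) i j k"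
proof -
  define n where "n = inverse ((norm x)\<^sup>2)"
  define b where "b k = contract x w $ k" for k
  have pd: "pd i (\<lambda>x. inverted w x $ j $ k) x =
      - 4 * n ^ 3 * x $ i * w $ j $ k + 12 * n ^ 4 * x $ i * (x $ j * b k - x $ k * b j)
      - 2 * n ^ 3 * ((if i = j then b k else 0) + x $ j * w $ i $ k - (if i = k then b j else 0) - x $ k * w $ i $ j)"
    unfolding inverted_nth using pd_inverse_norm_sq[OF x]
    by (simp add: pd_diff pd_mult pd_contract differentiable_mult differentiable_diff b_def[symmetric] n_def[symmetric])
      (simp add: algebra_simps power3_eq_cube power4_eq_xxxx)
  have wji: "w $ i $ j = - w $ j $ i" by (rule alternating_nth[OF w])
  show ?thesis
    unfolding pd twist_def contract_reflect[OF w x] reflect_nth n_def[symmetric] b_def[symmetric]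
      vector_uminus_component wji
    by (simp add: algebra_simps power3_eq_cube power4_eq_xxxx)
qed

text \<open>The form \<open>\<omega>\<close> once the two eigenforms are known to come from constant forms \<open>A\<close> and \<open>B\<close>.\<close>

definition model_form :: "real \<Rightarrow> real^4^4 \<Rightarrow> real \<Rightarrow> real^4^4 \<Rightarrow> real \<Rightarrow> real^4 \<Rightarrow> real^4^4" where
  "model_form \<alpha> A \<beta> B \<epsilon> x = (\<alpha> * \<epsilon>^4) *\<^sub>R A + \<beta> *\<^sub>R inverted B x"

lemma pd_model_form:
  assumes B: "alternating B" and x: "x \<noteq> 0"
  shows "pd i (\<lambda>x. model_form \<alpha> A \<beta> B \<epsilon> x $ j $ k) x =
    - 2 * \<beta> * inverse ((norm x)\<^sup>2) ^ 3 * twist x (reflect x B) i j k"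
proof -
  have d: "(\<lambda>x. inverted B x $ j $ k) differentiable (at x)"
    using smooth_fun_on_differentiable[OF smooth_inverted] x by simp
  show ?thesis
    unfolding model_form_def using pd_inverted[OF B x, of i j k]
    by (simp add: pd_add pd_cmult d differentiable_mult)
qed

text \<open>The cyclic sum is the exterior derivative, so this makes inverted forms closed.\<close>

lemma twist_cyclic:
  "alternating w \<Longrightarrow> twist x w i j k + twist x w j k i + twist x w k i j = 0"
  using alternating_nth[of w i j] alternating_nth[of w j k] alternating_nth[of w k i]
  by (auto simp: twist_def algebra_simps alternating_diag)

lemma model_form_closed:
  assumes A: "alternating A" and B: "alternating B"
  shows "closed_form2_on punctured_R4 (model_form \<alpha> A \<beta> B \<epsilon>)"
  unfolding closed_form2_on_def
proof (intro conjI ballI)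
  show "smooth2_on punctured_R4 (model_form \<alpha> A \<beta> B \<epsilon>)"
    unfolding smooth2_on_def model_form_def
    by (simp add: smooth_fun_on_add smooth_fun_on_mult smooth_inverted)
  fix x assume x: "x \<in> punctured_R4"
  show "alternating (model_form \<alpha> A \<beta> B \<epsilon> x)"
    using alternating_linear[OF alternating_linear[OF _ A] alternating_reflect[OF B],
        of 0 "\<alpha> * \<epsilon>^4" "\<beta> / norm x ^ 4" x]
    by (simp add: model_form_def inverted_def alternatingI)
  show "ext_d2 (model_form \<alpha> A \<beta> B \<epsilon>) x = 0"
  proof -
    define t where "t = twist x (reflect x B)"
    have "ext_d2 (model_form \<alpha> A \<beta> B \<epsilon>) x $ i $ j $ k =
        - 2 * \<beta> * inverse ((norm x)\<^sup>2) ^ 3 * (t i j k + t j k i + t k i j)" for i j k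
      using x unfolding ext_d2_def vec_lambda_beta t_def
      by (subst (1 2 3) pd_model_form[OF B]) (auto simp: algebra_simps)
    then show ?thesis
      unfolding t_def by (simp add: vec_eq_iff twist_cyclic[OF alternating_reflect[OF B]])
  qed
qed

lemma matrix_inv_scalar:
  assumes "c \<noteq> 0"
  shows "matrix_inv (c *\<^sub>R mat 1 :: real^'n^'n) = (1 / c) *\<^sub>R mat 1"
proof -
  let ?A = "c *\<^sub>R mat 1 :: real^'n^'n" and ?B = "(1 / c) *\<^sub>R mat 1 :: real^'n^'n"
  have AB: "?A ** ?B = mat 1" "?B ** ?A = mat 1"
    using assms by (simp_all add: scalar_matrix_assoc[symmetric] matrix_scalar_ac)
  have inv: "?A ** matrix_inv ?A = mat 1 \<and> matrix_inv ?A ** ?A = mat 1"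
    unfolding matrix_inv_def
    by (rule someI[where P = "\<lambda>M. ?A ** M = mat 1 \<and> M ** ?A = mat 1" and x = ?B]) (rule conjI[OF AB])
  have "matrix_inv ?A = matrix_inv ?A ** (?A ** ?B)"
    unfolding AB by (rule matrix_mul_rid[symmetric])
  also have "\<dots> = (matrix_inv ?A ** ?A) ** ?B" by (rule matrix_mul_assoc)
  also have "\<dots> = ?B" using inv by (simp only: matrix_mul_lid)
  finally show ?thesis .
qed

definition conf :: "real \<Rightarrow> real^4 \<Rightarrow> real" where
  "conf \<epsilon> x = \<epsilon>\<^sup>2 + inverse ((norm x)\<^sup>2)"

lemma conf_pos: "x \<noteq> 0 \<Longrightarrow> conf \<epsilon> x > 0"
  by (simp add: conf_def add_nonneg_pos)

lemma g_eps_conf: "g_eps \<epsilon> x = (conf \<epsilon> x)\<^sup>2 *\<^sub>R mat 1"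
  by (simp add: g_eps_def conf_def flat_metric_def divide_inverse)

lemma pd_g_eps:
  assumes "x \<noteq> 0"
  shows "pd l (\<lambda>y. g_eps \<epsilon> y $ i $ j) x =
    (if i = j then - 4 * conf \<epsilon> x * inverse ((norm x)\<^sup>2) ^ 2 * x $ l else 0)"
proof -
  have "pd l (\<lambda>y. (\<epsilon>\<^sup>2 + inverse ((norm y)\<^sup>2)) * (\<epsilon>\<^sup>2 + inverse ((norm y)\<^sup>2))) x =
      - 4 * conf \<epsilon> x * inverse ((norm x)\<^sup>2) ^ 2 * x $ l"
    using pd_inverse_norm_sq[OF assms]
    by (simp add: pd_mult pd_add differentiable_add) (simp add: conf_def power2_eq_square algebra_simps)
  then show ?thesis
    by (simp add: g_eps_conf mat_def conf_def power2_eq_square)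
qed

lemma christoffel_g_eps:
  assumes x: "x \<noteq> 0"
  shows "christoffel (g_eps \<epsilon>) x k i j = - 2 * (inverse ((norm x)\<^sup>2) ^ 2 / conf \<epsilon> x) *
    ((if j = k then x $ i else 0) + (if i = k then x $ j else 0) - (if i = j then x $ k else 0))"
proof -
  have c: "conf \<epsilon> x \<noteq> 0" using conf_pos[OF x] by (simp add: less_imp_neq[symmetric])
  define r where "r = - 4 * conf \<epsilon> x * inverse ((norm x)\<^sup>2) ^ 2"
  have "christoffel (g_eps \<epsilon>) x k i j = 1/2 * (\<Sum>l\<in>UNIV. if l = k then 1 / (conf \<epsilon> x)\<^sup>2 *
      ((if j = l then r * x $ i else 0) + (if i = l then r * x $ j else 0) - (if i = j then r * x $ l else 0)) else 0)"
    unfolding christoffel_def g_eps_conf[of \<epsilon> x] matrix_inv_scalar[of "(conf \<epsilon> x)\<^sup>2", simplified, OF c]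
      pd_g_eps[OF x] r_def
    by (intro arg_cong[where f = "(*) (1/2)"] sum.cong refl) (auto simp: mat_def)
  also have "\<dots> = 1 / 2 * (1 / (conf \<epsilon> x)\<^sup>2 *
      ((if j = k then r * x $ i else 0) + (if i = k then r * x $ j else 0) - (if i = j then r * x $ k else 0)))"
    by simp
  also have "\<dots> = - 2 * (inverse ((norm x)\<^sup>2) ^ 2 / conf \<epsilon> x) *
    ((if j = k then x $ i else 0) + (if i = k then x $ j else 0) - (if i = j then x $ k else 0))"
    unfolding r_def using c by (simp add: power2_eq_square field_simps)
  finally show ?thesis .
qed

lemma twist_linear: "twist x (a *\<^sub>R v + b *\<^sub>R w) i j k = a * twist x v i j k + b * twist x w i j k"
  by (auto simp: twist_def contract_nth sum.distrib sum_distrib_left algebra_simps)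

lemma cov_deriv_conformal:
  assumes x: "x \<noteq> 0" and alt: "alternating (\<omega> x)"
  shows "cov_deriv2 (g_eps \<epsilon>) \<omega> x $ i $ j $ k = pd i (\<lambda>y. \<omega> y $ j $ k) x
    + 2 * (inverse ((norm x)\<^sup>2) ^ 2 / conf \<epsilon> x) * twist x (\<omega> x) i j k"
proof -
  define r where "r = 2 * (inverse ((norm x)\<^sup>2) ^ 2 / conf \<epsilon> x)"
  have ch: "christoffel (g_eps \<epsilon>) x l i j =
      - r * ((if j = l then x $ i else 0) + (if i = l then x $ j else 0) - (if i = j then x $ l else 0))" for l i j
    unfolding christoffel_g_eps[OF x] r_def by simp
  have "(\<Sum>l\<in>UNIV. christoffel (g_eps \<epsilon>) x l i j * \<omega> x $ l $ k) =
      (\<Sum>l\<in>UNIV. (if j = l then - r * x $ i * \<omega> x $ l $ k else 0) + (if i = l then - r * x $ j * \<omega> x $ l $ k else 0)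
        + (if i = j then r else 0) * (x $ l * \<omega> x $ l $ k))"
    unfolding ch by (intro sum.cong refl) (simp add: algebra_simps)
  also have "\<dots> = - r * (x $ i * \<omega> x $ j $ k + x $ j * \<omega> x $ i $ k - (if i = j then contract x (\<omega> x) $ k else 0))"
    by (simp add: sum.distrib contract_nth algebra_simps flip: sum_distrib_left)
  finally have 1: "(\<Sum>l\<in>UNIV. christoffel (g_eps \<epsilon>) x l i j * \<omega> x $ l $ k) = \<dots>" .
  have "(\<Sum>l\<in>UNIV. christoffel (g_eps \<epsilon>) x l i k * \<omega> x $ j $ l) =
      (\<Sum>l\<in>UNIV. (if k = l then - r * x $ i * \<omega> x $ j $ l else 0) + (if i = l then - r * x $ k * \<omega> x $ j $ l else 0)
        + (if i = k then - r else 0) * (x $ l * \<omega> x $ l $ j))"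
  proof (intro sum.cong refl)
    fix l
    show "christoffel (g_eps \<epsilon>) x l i k * \<omega> x $ j $ l =
      (if k = l then - r * x $ i * \<omega> x $ j $ l else 0) + (if i = l then - r * x $ k * \<omega> x $ j $ l else 0)
        + (if i = k then - r else 0) * (x $ l * \<omega> x $ l $ j)"
      unfolding ch alternating_nth[OF alt, of j l] by (simp add: algebra_simps)
  qed
  also have "\<dots> = - r * (x $ i * \<omega> x $ j $ k + x $ k * \<omega> x $ j $ i + (if i = k then contract x (\<omega> x) $ j else 0))"
    by (simp add: sum.distrib contract_nth sum_negf sum_distrib_left algebra_simps)
  finally have 2: "(\<Sum>l\<in>UNIV. christoffel (g_eps \<epsilon>) x l i k * \<omega> x $ j $ l) = \<dots>" .
  show ?thesis
    unfolding cov_deriv2_def vec_lambda_beta 1 2 twist_def r_def[symmetric] by (simp add: algebra_simps)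
qed

text \<open>With \<open>n = t\<^sup>-\<^sup>2\<close> and conformal factor \<open>\<phi> = \<epsilon>\<^sup>2 + n\<close>, the ordinary derivative contributes \<open>-2n\<^sup>3\<close> and the
  connection \<open>2n\<^sup>4/\<phi>\<close> to the coefficient of the reflected \<open>B\<close>. Their sum is \<open>-2\<epsilon>\<^sup>2n\<^sup>3/\<phi>\<close>, which lets the two
  summands of \<open>\<omega>\<close> share the factor \<open>2n\<^sup>2/\<phi>\<close>.\<close>

lemma cov_deriv_model_form:
  assumes A: "alternating A" and B: "alternating B" and x: "x \<noteq> 0"
  shows "cov_deriv2 (g_eps \<epsilon>) (model_form \<alpha> A \<beta> B \<epsilon>) x $ i $ j $ k =
    2 * (inverse ((norm x)\<^sup>2) ^ 2 / conf \<epsilon> x) *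
    twist x ((\<alpha> * \<epsilon>^4) *\<^sub>R A + (- \<beta> * \<epsilon>\<^sup>2 * inverse ((norm x)\<^sup>2)) *\<^sub>R reflect x B) i j k"
proof -
  define n where "n = inverse ((norm x)\<^sup>2)"
  have c: "conf \<epsilon> x \<noteq> 0" using conf_pos[OF x] by (simp add: less_imp_neq[symmetric])
  have alt: "alternating (model_form \<alpha> A \<beta> B \<epsilon> x)"
    using model_form_closed[OF A B] x by (auto simp: closed_form2_on_def)
  have "1 / norm x ^ 4 = n ^ 2" by (simp add: n_def divide_inverse power2_eq_square power4_eq_xxxx)
  then have \<omega>: "model_form \<alpha> A \<beta> B \<epsilon> x = (\<alpha> * \<epsilon>^4) *\<^sub>R A + (\<beta> * n ^ 2) *\<^sub>R reflect x B"
    by (simp add: model_form_def inverted_def)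
  have \<epsilon>: "\<epsilon>\<^sup>2 = conf \<epsilon> x - n" by (simp add: conf_def n_def)
  show ?thesis
    unfolding cov_deriv_conformal[of x "model_form \<alpha> A \<beta> B \<epsilon>", OF x alt] pd_model_form[OF B x] \<omega> twist_linear n_def[symmetric] \<epsilon>
    using c by (simp add: field_simps power3_eq_cube power2_eq_square)
qed

text \<open>Self-duality matters through \<open>w\<^sup>T w\<close> being a multiple of the identity, so that the sum depends on \<open>x\<close> only
  through its length. In coordinates the claim is a polynomial identity in \<open>x\<close> and the three components of \<open>w\<close>.\<close>

lemma sum_twist_sq:
  assumes "dual_form 1 w"
  shows "(\<Sum>i\<in>UNIV. \<Sum>j\<in>UNIV. \<Sum>k\<in>UNIV. (twist x w i j k)\<^sup>2) = 12 * (norm x)\<^sup>2 * len_sq w"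
proof -
  have w: "alternating w" "w$3$4 = - w$1$2" "w$2$4 = w$1$3" "w$2$3 = - w$1$4"
    using assms(1) by (simp_all add: dual_form_def)
  show ?thesis
    unfolding len_sq_dual_form[OF assms, simplified] norm_sq_4 sum_4 twist_def contract_nth
      alternating_4[OF w(1)] w(2-4)
    by (simp add: power2_eq_square algebra_simps)
qed

lemma form2_deriv_norm_scalar:
  fixes T :: "real^'n^'n^'n"
  assumes "c > 0"
  shows "form2_deriv_norm (c\<^sup>2 *\<^sub>R mat 1) T =
    sqrt (1 / 2 * (1 / c ^ 6) * (\<Sum>i\<in>UNIV. \<Sum>j\<in>UNIV. \<Sum>k\<in>UNIV. (T $ i $ j $ k)\<^sup>2))"
proof -
  define H :: "real^'n^'n" where "H = (1 / c\<^sup>2) *\<^sub>R mat 1"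
  have inv: "matrix_inv (c\<^sup>2 *\<^sub>R mat 1) = H"
    using matrix_inv_scalar[of "c\<^sup>2"] assms by (simp add: H_def)
  have "(\<Sum>i'\<in>UNIV. \<Sum>j'\<in>UNIV. \<Sum>k'\<in>UNIV.
      H$i$i' * H$j$j' * H$k$k' * T$i$j$k * T$i'$j'$k') = 1 / c ^ 6 * (T $ i $ j $ k)\<^sup>2" for i j k
  proof -
    let ?d = "\<lambda>i'. if i' = i then 1 else (0::real)"
    have d: "H$i$i' * H$j$j' * H$k$k' * T$i$j$k * T$i'$j'$k' =
        (if i' = i then if j' = j then if k' = k then 1 / c ^ 6 * (T $ i $ j $ k)\<^sup>2 else 0 else 0 else 0)" for i' j' k'
      by (auto simp: H_def mat_def power2_eq_square numeral_eq_Suc)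
    have k: "(\<Sum>k'\<in>UNIV. if i' = i then if j' = j then if k' = k then r else 0 else 0 else 0) =
        (if i' = i then if j' = j then r else 0 else (0::real))" for i' j' r
      by (cases "i' = i"; cases "j' = j") simp_all
    have j: "(\<Sum>j'\<in>UNIV. if i' = i then if j' = j then r else 0 else 0) = (if i' = i then r else (0::real))" for i' r
      by (cases "i' = i") simp_all
    show ?thesis unfolding d k j by simp
  qed
  then show ?thesis
    unfolding form2_deriv_norm_def Let_def inv by (simp flip: sum_divide_distrib)
qed

lemma len_sq_scale: "len_sq (c *\<^sub>R w) = c\<^sup>2 * len_sq w"
  by (simp add: len_sq_def sum_distrib_left power2_eq_square algebra_simps sum_divide_distrib)

lemma grad_norm_model_form:
  assumes A: "dual_form 1 A" and B: "alternating B" and C: "dual_form 1 (reflect x B)"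
    and x: "x \<noteq> 0" and \<epsilon>: "\<epsilon> > 0"
  shows "form2_deriv_norm (g_eps \<epsilon> x) (cov_deriv2 (g_eps \<epsilon>) (model_form \<alpha> A \<beta> B \<epsilon>) x) =
    1 / \<epsilon> * sqrt (24 * (\<epsilon>\<^sup>2 * (norm x)\<^sup>2) ^ 5 / (1 + \<epsilon>\<^sup>2 * (norm x)\<^sup>2) ^ 8 *
      len_sq (\<alpha> *\<^sub>R A - (\<beta> / (\<epsilon>\<^sup>2 * (norm x)\<^sup>2)) *\<^sub>R reflect x B))"
proof -
  define N where "N = (norm x)\<^sup>2"
  have N: "N > 0" using x by (simp add: N_def)
  have conf: "conf \<epsilon> x = (1 + \<epsilon>\<^sup>2 * N) / N" using N by (simp add: conf_def N_def field_simps)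
  have pos: "1 + \<epsilon>\<^sup>2 * N > 0" using N by (simp add: add_pos_nonneg)
  let ?D = "\<alpha> *\<^sub>R A - (\<beta> / (\<epsilon>\<^sup>2 * N)) *\<^sub>R reflect x B"
  let ?E = "(\<alpha> * \<epsilon>^4) *\<^sub>R A + (- \<beta> * \<epsilon>\<^sup>2 * inverse N) *\<^sub>R reflect x B"
  have D: "dual_form 1 ?D"
    unfolding dual_form_def
    using A C alternating_linear[OF alternating_linear[OF _ A[unfolded dual_form_def, THEN conjunct1], of 0 \<alpha>]
        C[unfolded dual_form_def, THEN conjunct1], of "- (\<beta> / (\<epsilon>\<^sup>2 * N))"]
    by (simp add: dual_form_def alternatingI algebra_simps)
  have ED: "?E = \<epsilon>^4 *\<^sub>R ?D"
    using \<epsilon> N by (simp add: scaleR_diff_right vec_eq_iff field_simps power2_eq_square power4_eq_xxxx)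
  have cov: "cov_deriv2 (g_eps \<epsilon>) (model_form \<alpha> A \<beta> B \<epsilon>) x $ i $ j $ k =
      2 / (N * (1 + \<epsilon>\<^sup>2 * N)) * twist x ?E i j k" for i j k
    using A B cov_deriv_model_form[of A B x \<epsilon> \<alpha> \<beta> i j k] x N pos
    unfolding N_def[symmetric] conf by (simp add: dual_form_def power2_eq_square divide_inverse mult_ac)
  have "form2_deriv_norm (g_eps \<epsilon> x) (cov_deriv2 (g_eps \<epsilon>) (model_form \<alpha> A \<beta> B \<epsilon>) x) =
      sqrt (1 / 2 * (1 / conf \<epsilon> x ^ 6) * ((2 / (N * (1 + \<epsilon>\<^sup>2 * N)))\<^sup>2 * (12 * N * len_sq ?E)))"
    unfolding g_eps_conf form2_deriv_norm_scalar[OF conf_pos[OF x]] cov power_mult_distrib[of _ "twist _ _ _ _ _"]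
      sum_distrib_left[symmetric]
    unfolding ED by (subst sum_twist_sq[OF dual_form_scale[OF D]]) (simp add: N_def)
  also have "\<dots> = sqrt ((1 / \<epsilon>)\<^sup>2 * (24 * (\<epsilon>\<^sup>2 * N) ^ 5 / (1 + \<epsilon>\<^sup>2 * N) ^ 8 * len_sq ?D))"
  proof -
    have alg: "1 / 2 * (1 / conf \<epsilon> x ^ 6) * ((2 / (N * (1 + \<epsilon>\<^sup>2 * N)))\<^sup>2 * (12 * N * (\<epsilon>^8 * l))) =
        (1 / \<epsilon>)\<^sup>2 * (24 * (\<epsilon>\<^sup>2 * N) ^ 5 / (1 + \<epsilon>\<^sup>2 * N) ^ 8 * l)" for l
    proof -
      obtain q where q: "q = 1 + \<epsilon>\<^sup>2 * N" by blast
      then have "q > 0" using pos by simp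
      then show ?thesis unfolding conf q[symmetric] using \<epsilon> N
        by (simp add: field_simps power_mult_distrib flip: power_add power_mult) (simp add: eval_nat_numeral)
    qed
    have "(\<epsilon>^4)\<^sup>2 = \<epsilon>^8" by (simp flip: power_mult)
    then show ?thesis unfolding ED len_sq_scale by (simp only: alg)
  qed
  also have "\<dots> = 1 / \<epsilon> * sqrt (24 * (\<epsilon>\<^sup>2 * N) ^ 5 / (1 + \<epsilon>\<^sup>2 * N) ^ 8 * len_sq ?D)"
    using \<epsilon> by (simp only: real_sqrt_mult real_sqrt_abs) simp
  finally show ?thesis unfolding N_def .
qed

section \<open>Limits on the two ends\<close>

lemma pullback2_chart_infty:
  assumes "\<epsilon> \<noteq> 0"
  shows "pullback2 (chart_infty \<epsilon>) T y $ i $ j = (1 / \<epsilon>^4) * T (chart_infty \<epsilon> y) $ i $ j"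
proof -
  have pd: "pd i (\<lambda>y. chart_infty \<epsilon> y $ k) y = (if k = i then 1 / \<epsilon>\<^sup>2 else 0)" for i k
    unfolding chart_infty_def using pd_cmult[OF differentiable_component, of i "1 / \<epsilon>\<^sup>2" k y] by simp
  have "pullback2 (chart_infty \<epsilon>) T y $ i $ j =
      (\<Sum>k\<in>UNIV. \<Sum>l\<in>UNIV. if l = j then if k = i then (1 / \<epsilon>^4) * T (chart_infty \<epsilon> y) $ k $ l else 0 else 0)"
    unfolding pullback2_def vec_lambda_beta pd
    by (intro sum.cong refl) (simp add: power2_eq_square power4_eq_xxxx)
  then show ?thesis by simp
qed

lemma pd_chart_zero:
  assumes "y \<noteq> 0"
  shows "pd i (\<lambda>y. chart_zero y $ k) y = inverse ((norm y)\<^sup>2) *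
    ((if i = k then 1 else 0) - 2 * inverse ((norm y)\<^sup>2) * y $ i * y $ k)"
proof -
  have e: "(\<lambda>y. chart_zero y $ k) = (\<lambda>y. inverse ((norm y)\<^sup>2) * y $ k)"
    by (simp add: chart_zero_def divide_inverse)
  show ?thesis unfolding e pd_mult[OF pd_inverse_norm_sq(2)[OF assms] differentiable_component]
      pd_inverse_norm_sq(1)[OF assms] by (simp add: algebra_simps)
qed

lemma chart_zero_eq: "chart_zero y = inverse ((norm y)\<^sup>2) *\<^sub>R y"
  by (simp add: chart_zero_def divide_inverse)

lemma pullback2_chart_zero:
  assumes y: "y \<noteq> 0"
  shows "pullback2 chart_zero T y $ i $ j = inverse ((norm y)\<^sup>2) ^ 2 *
    (T (chart_zero y) $ i $ j
      - 2 * inverse ((norm y)\<^sup>2) * (y $ j * (\<Sum>l\<in>UNIV. T (chart_zero y) $ i $ l * y $ l)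
          + y $ i * contract y (T (chart_zero y)) $ j)
      + 4 * inverse ((norm y)\<^sup>2) ^ 2 * y $ i * y $ j * eval2 (T (chart_zero y)) y y)"
proof -
  define n where "n = inverse ((norm y)\<^sup>2)"
  define w where "w = T (chart_zero y)"
  have "pullback2 chart_zero T y $ i $ j =
      (\<Sum>k\<in>UNIV. \<Sum>l\<in>UNIV. n^2 * ((if l = j then if k = i then w $ k $ l else 0 else 0)
        - 2 * n * (y $ j * (if k = i then w $ k $ l * y $ l else 0))
        - 2 * n * (y $ i * (if l = j then y $ k * w $ k $ l else 0))
        + 4 * n ^ 2 * y $ i * y $ j * (w $ k $ l * y $ k * y $ l)))"
    unfolding pullback2_def vec_lambda_beta pd_chart_zero[OF y] n_def[symmetric] w_def[symmetric]
    by (intro sum.cong refl) (simp add: power2_eq_square algebra_simps)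
  also have "\<dots> = n^2 * ((\<Sum>k\<in>UNIV. \<Sum>l\<in>UNIV. if l = j then if k = i then w $ k $ l else 0 else 0)
      - 2 * n * (y $ j * (\<Sum>k\<in>UNIV. \<Sum>l\<in>UNIV. if k = i then w $ k $ l * y $ l else 0))
      - 2 * n * (y $ i * (\<Sum>k\<in>UNIV. \<Sum>l\<in>UNIV. if l = j then y $ k * w $ k $ l else 0))
      + 4 * n ^ 2 * y $ i * y $ j * eval2 w y y)"
    unfolding eval2_def by (simp only: sum_distrib_left[symmetric] sum.distrib sum_subtractf)
  also have "(\<Sum>k\<in>UNIV. \<Sum>l\<in>UNIV. if k = i then w $ k $ l * y $ l else 0) = (\<Sum>l\<in>UNIV. w $ i $ l * y $ l)"
    by (subst sum.swap) simp
  finally show ?thesis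
    unfolding n_def[symmetric] w_def[symmetric] contract_nth by (simp add: algebra_simps)
qed

text \<open>On a 2-form \<open>w\<close> the quadratic term of the general formula drops out, since \<open>w(y, y) = 0\<close>.\<close>

lemma pullback2_chart_zero_alternating:
  assumes y: "y \<noteq> 0" and alt: "alternating (T (chart_zero y))"
  shows "pullback2 chart_zero T y = inverse ((norm y)\<^sup>2) ^ 2 *\<^sub>R reflect y (T (chart_zero y))"
proof -
  let ?w = "T (chart_zero y)"
  have "(\<Sum>l\<in>UNIV. ?w $ i $ l * y $ l) = - contract y ?w $ i" for i
    unfolding contract_nth sum_negf[symmetric]
    by (intro sum.cong refl, subst alternating_nth[OF alt]) simp
  moreover have "eval2 ?w y y = 0" using eval2_swap[OF alt, of y y] by simp
  ultimately show ?thesis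
    by (simp add: vec_eq_iff pullback2_chart_zero[OF y] reflect_nth algebra_simps)
qed

lemma flat_metric_nth: "flat_metric y $ i $ j = (if i = j then 1 else 0)"
  by (simp add: flat_metric_def mat_def)

lemma pullback2_metric_infty:
  assumes "\<epsilon> \<noteq> 0" and "y \<noteq> 0"
  shows "pullback2 (chart_infty \<epsilon>) (g_eps \<epsilon>) y $ i $ j =
    flat_metric y $ i $ j + (2 * \<epsilon>\<^sup>2) * (inverse ((norm y)\<^sup>2) * flat_metric y $ i $ j)
     + \<epsilon>^4 * (inverse ((norm y)\<^sup>2) ^ 2 * flat_metric y $ i $ j)"
proof -
  define n where "n = inverse ((norm y)\<^sup>2)"
  have "conf \<epsilon> (chart_infty \<epsilon> y) = \<epsilon>\<^sup>2 * (1 + \<epsilon>\<^sup>2 * n)"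
    using assms by (simp add: conf_def chart_infty_def n_def power_mult_distrib power_divide field_simps power2_eq_square)
  then show ?thesis
    unfolding pullback2_chart_infty[OF assms(1)] g_eps_conf n_def[symmetric] using assms(1)
    by (simp add: flat_metric_def mat_def power2_eq_square power4_eq_xxxx field_simps)
qed

lemma pullback2_metric_zero:
  assumes "y \<noteq> 0"
  shows "pullback2 chart_zero (g_eps \<epsilon>) y $ i $ j =
    flat_metric y $ i $ j + (2 * \<epsilon>\<^sup>2) * (inverse ((norm y)\<^sup>2) * flat_metric y $ i $ j)
     + \<epsilon>^4 * (inverse ((norm y)\<^sup>2) ^ 2 * flat_metric y $ i $ j)"
proof -
  define n where "n = inverse ((norm y)\<^sup>2)"
  define N where "N = (norm y)\<^sup>2"
  have Nn: "n * N = 1" using assms by (simp add: n_def N_def)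
  have c: "conf \<epsilon> (chart_zero y) = \<epsilon>\<^sup>2 + N"
    using assms by (simp add: conf_def chart_zero_eq N_def power_mult_distrib power2_eq_square)
  define q where "q = (\<epsilon>\<^sup>2 + N)\<^sup>2"
  have T: "g_eps \<epsilon> (chart_zero y) $ i $ j = (if i = j then q else 0)" for i j
    by (simp add: g_eps_conf c mat_def q_def)
  have co: "contract y (g_eps \<epsilon> (chart_zero y)) $ j = q * y $ j" for j
    unfolding contract_nth T by (simp add: if_distrib[where f = "\<lambda>z. _ * z"] mult.commute cong: if_cong)
  have co': "(\<Sum>l\<in>UNIV. g_eps \<epsilon> (chart_zero y) $ i $ l * y $ l) = q * y $ i" for i
    unfolding T by (simp add: if_distribR if_distrib[where f = "\<lambda>z. z * _"] cong: if_cong)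
  have ev: "eval2 (g_eps \<epsilon> (chart_zero y)) y y = q * N"
  proof -
    have "eval2 (g_eps \<epsilon> (chart_zero y)) y y = (\<Sum>i\<in>UNIV. (\<Sum>l\<in>UNIV. g_eps \<epsilon> (chart_zero y) $ i $ l * y $ l) * y $ i)"
      unfolding eval2_def sum_distrib_right by (intro sum.cong refl) simp
    also have "\<dots> = q * (\<Sum>i\<in>UNIV. y $ i * y $ i)"
      unfolding co' sum_distrib_left by (simp add: mult.assoc)
    finally show ?thesis by (simp add: sum_square_norm N_def)
  qed
  have "pullback2 chart_zero (g_eps \<epsilon>) y $ i $ j = n\<^sup>2 * (q * (if i = j then 1 else 0)
      - 4 * n * q * y $ i * y $ j + 4 * n * (n * N) * q * y $ i * y $ j)"
    unfolding pullback2_chart_zero[OF assms] co co' ev n_def[symmetric]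
    unfolding T by (simp add: algebra_simps power2_eq_square)
  also have "\<dots> = n\<^sup>2 * q * (if i = j then 1 else 0)"
    unfolding Nn by (simp add: algebra_simps)
  also have "n\<^sup>2 * q = (\<epsilon>\<^sup>2 * n + n * N)\<^sup>2"
    by (simp add: q_def power2_eq_square algebra_simps)
  finally show ?thesis
    unfolding Nn n_def[symmetric] by (simp add: flat_metric_nth power2_eq_square power4_eq_xxxx algebra_simps)
qed

lemma pullback2_model_infty:
  assumes "\<epsilon> \<noteq> 0" and "y \<noteq> 0"
  shows "pullback2 (chart_infty \<epsilon>) (model_form \<alpha> A \<beta> B \<epsilon>) y = \<alpha> *\<^sub>R A + (\<beta> * \<epsilon>^4) *\<^sub>R inverted B y"
proof -
  have "inverted B (chart_infty \<epsilon> y) = \<epsilon>^8 *\<^sub>R inverted B y"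
    unfolding inverted_def chart_infty_def using assms reflect_scale_point[of "1 / \<epsilon>\<^sup>2" y B]
    by (simp add: power_mult_distrib power_divide divide_inverse power_inverse flip: power_mult)
  then show ?thesis
    using assms(1) by (simp add: vec_eq_iff pullback2_chart_infty model_form_def field_simps flip: power_add)
qed

lemma pullback2_model_zero:
  assumes "y \<noteq> 0" and A: "alternating A" and B: "alternating B"
  shows "pullback2 chart_zero (model_form \<alpha> A \<beta> B \<epsilon>) y = \<beta> *\<^sub>R B + (\<alpha> * \<epsilon>^4) *\<^sub>R inverted A y"
proof -
  define n where "n = inverse ((norm y)\<^sup>2)"
  have n: "n > 0" using assms(1) by (simp add: n_def)
  have y': "chart_zero y \<noteq> 0" using assms(1) by (simp add: chart_zero_def)
  have alt: "alternating (model_form \<alpha> A \<beta> B \<epsilon> (chart_zero y))"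
    using model_form_closed[OF A B] y' by (auto simp: closed_form2_on_def)
  have nz: "1 / norm (chart_zero y) ^ 4 = 1 / n ^ 2"
  proof -
    have "(norm (chart_zero y))\<^sup>2 = n"
      using assms(1) by (simp add: chart_zero_eq n_def power_mult_distrib power2_eq_square)
    then have "norm (chart_zero y) ^ 4 = n ^ 2" by (metis mult_2 numeral_Bit0 power_mult power2_eq_square power_add)
    then show ?thesis by simp
  qed
  have ref: "reflect (chart_zero y) B = reflect y B"
    unfolding chart_zero_eq n_def[symmetric] using n by (intro reflect_scale_point) simp
  have lin: "reflect y (a *\<^sub>R v + b *\<^sub>R w) = a *\<^sub>R reflect y v + b *\<^sub>R reflect y w" for a b v w
    by (simp add: vec_eq_iff reflect_nth contract_nth sum.distrib sum_distrib_left algebra_simps)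
  have "1 / norm y ^ 4 = n ^ 2" by (simp add: n_def divide_inverse power2_eq_square power4_eq_xxxx)
  then show ?thesis
    unfolding pullback2_chart_zero_alternating[OF assms(1), of "model_form \<alpha> A \<beta> B \<epsilon>", OF alt] n_def[symmetric]
      model_form_def inverted_def ref nz scaleR_scaleR lin reflect_reflect[OF B assms(1)]
    using n by (simp add: scaleR_add_right)
qed

text \<open>One statement for both ends: in the coordinates of either end the metric is
  \<open>(1 + \<epsilon>\<^sup>2/|y|\<^sup>2)\<^sup>2\<close> times the flat one.\<close>

lemma smooth2_tendsto_metric:
  assumes "\<And>\<epsilon> y i j. \<epsilon> > 0 \<Longrightarrow> y \<noteq> 0 \<Longrightarrow> G \<epsilon> y $ i $ j =
    flat_metric y $ i $ j + (2 * \<epsilon>\<^sup>2) * (inverse ((norm y)\<^sup>2) * flat_metric y $ i $ j)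
     + \<epsilon>^4 * (inverse ((norm y)\<^sup>2) ^ 2 * flat_metric y $ i $ j)"
  shows "smooth2_tendsto punctured_R4 G flat_metric (at_right 0)"
  unfolding smooth2_tendsto_def
proof (intro allI)
  fix i j
  have sm: "smooth_fun_on punctured_R4 (\<lambda>y. flat_metric y $ i $ j)" by (simp add: flat_metric_nth)
  note n = smooth_fun_on_mult[OF open_punctured smooth_inverse_norm_sq]
  show "smooth_fun_tendsto punctured_R4 (\<lambda>\<epsilon> x. G \<epsilon> x $ i $ j) (\<lambda>x. flat_metric x $ i $ j) (at_right 0)"
  proof (rule smooth_fun_tendsto_linear[OF open_punctured sm n[OF sm] n[OF n[OF sm]]])
    show "((\<lambda>\<epsilon>. 2 * \<epsilon>\<^sup>2) \<longlongrightarrow> (0::real)) (at_right 0)" "((\<lambda>\<epsilon>. \<epsilon>^4) \<longlongrightarrow> (0::real)) (at_right 0)"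
      by (auto intro!: tendsto_eq_intros)
    show "\<forall>\<^sub>F \<epsilon> in at_right 0. \<forall>x\<in>punctured_R4. G \<epsilon> x $ i $ j =
        flat_metric x $ i $ j + 2 * \<epsilon>\<^sup>2 * (inverse ((norm x)\<^sup>2) * flat_metric x $ i $ j) +
        \<epsilon> ^ 4 * (inverse ((norm x)\<^sup>2) * (inverse ((norm x)\<^sup>2) * flat_metric x $ i $ j))"
      by (rule eventually_mono[OF eventually_at_right_less[of 0]]) (simp add: assms power2_eq_square mult.assoc)
  qed
qed

lemma smooth2_tendsto_form:
  assumes "\<And>\<epsilon> y. \<epsilon> > 0 \<Longrightarrow> y \<noteq> 0 \<Longrightarrow> W \<epsilon> y = P + (c * \<epsilon>^4) *\<^sub>R inverted w y"
  shows "smooth2_tendsto punctured_R4 W (\<lambda>_. P) (at_right 0)"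
  unfolding smooth2_tendsto_def
proof (intro allI)
  fix i j
  show "smooth_fun_tendsto punctured_R4 (\<lambda>\<epsilon> x. W \<epsilon> x $ i $ j) (\<lambda>x. P $ i $ j) (at_right 0)"
  proof (rule smooth_fun_tendsto_linear[where g = "\<lambda>x. inverted w x $ i $ j" and h = "\<lambda>_. 0"])
    show "((\<lambda>\<epsilon>. c * \<epsilon>^4) \<longlongrightarrow> (0::real)) (at_right 0)"
      by (auto intro!: tendsto_eq_intros)
    show "((\<lambda>\<epsilon>. 0) \<longlongrightarrow> (0::real)) (at_right 0)" by simp
    show "\<forall>\<^sub>F \<epsilon> in at_right 0. \<forall>x\<in>punctured_R4. W \<epsilon> x $ i $ j =
        P $ i $ j + c * \<epsilon>^4 * inverted w x $ i $ j + 0 * 0"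
      by (rule eventually_mono[OF eventually_at_right_less[of 0]]) (simp add: assms)
  qed (simp_all add: smooth_inverted)
qed

lemma parallel_const: "parallel_on UNIV flat_metric (\<lambda>_. P)"
proof -
  have "christoffel flat_metric x l i j = 0" for x l i j
    by (simp add: christoffel_def flat_metric_def)
  then show ?thesis
    by (simp add: parallel_on_def smooth2_on_def cov_deriv2_def vec_eq_iff)
qed

lemma form2_norm_flat: "form2_norm (flat_metric y) w = sqrt (len_sq w)"
proof -
  have inv: "matrix_inv (mat 1 :: real^4^4) = mat 1"
    using matrix_inv_scalar[of 1, where 'n = 4] by simp
  have "(mat 1 :: real^4^4)$i$k * (mat 1 :: real^4^4)$j$l * w$i$j * w$k$l =
      (if l = j then if k = i then w$i$j * w$k$l else 0 else 0)" for i j k l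
    by (auto simp: mat_def)
  then show ?thesis
    by (simp add: form2_norm_def flat_metric_def inv len_sq_def)
qed

section \<open>The norms of the covariant derivative\<close>

lemma cov_deriv2_cong:
  assumes "open U" and "x \<in> U" and eq: "\<And>y. y \<in> U \<Longrightarrow> \<omega> y = \<omega>' y"
  shows "cov_deriv2 g \<omega> x = cov_deriv2 g \<omega>' x"
proof -
  have "pd i (\<lambda>y. \<omega> y $ j $ k) x = pd i (\<lambda>y. \<omega>' y $ j $ k) x" for i j k
    by (rule differentiable_cong_open(2)[OF assms(1,2)]) (simp add: eq)
  then show ?thesis unfolding cov_deriv2_def eq[OF assms(2)] by simp
qed

lemma dyadic_small:
  assumes "0 < t" and "t \<le> (1::real)"
  shows "\<exists>k. 1 / 2 ^ Suc k < t \<and> t \<le> 1 / 2 ^ k"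
proof -
  have ex: "\<exists>n. (1/2) ^ n < t" using assms(1) by (intro real_arch_pow_inv) auto
  define m where "m = (LEAST n. (1/2::real) ^ n < t)"
  have m: "(1/2) ^ m < t" unfolding m_def using ex by (rule LeastI_ex)
  then obtain k where k: "m = Suc k" using assms(2) by (cases m) auto
  then have "\<not> (1/2) ^ k < t" using not_less_Least[of k "\<lambda>n. (1/2::real) ^ n < t"] m_def by simp
  then show ?thesis using m k by (intro exI[of _ k]) (simp add: power_divide)
qed

lemma dyadic_large:
  assumes "1 < (t::real)"
  shows "\<exists>k. 2 ^ k < t \<and> t \<le> 2 ^ Suc k"
proof -
  have ex: "\<exists>n. t \<le> 2 ^ n" using real_arch_pow[of 2 t] by (auto intro: less_imp_le)
  define m where "m = (LEAST n. t \<le> 2 ^ n)"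
  have m: "t \<le> 2 ^ m" unfolding m_def using ex by (rule LeastI_ex)
  then obtain k where k: "m = Suc k" using assms by (cases m) auto
  then have "\<not> t \<le> 2 ^ k" using not_less_Least[of k "\<lambda>n. t \<le> 2 ^ n"] m_def by simp
  then show ?thesis using m k by (intro exI[of _ k]) simp
qed

text \<open>On the dyadic shell of radius \<open>r\<close> the function is at most a constant times \<open>r\<^sup>-\<^sup>2\<close> for small \<open>r\<close> and
  \<open>r\<^sup>-\<^sup>6\<close> for large \<open>r\<close>, while the volume is at most a constant times \<open>r\<^sup>4\<close>.\<close>

lemma integrable_radial_majorant:
  "integrable lborel (\<lambda>y::real^4. inverse ((norm y)\<^sup>2 * (1 + (norm y)\<^sup>2)\<^sup>2))"
proof (rule integrableI_nonneg)
  let ?h = "\<lambda>y::real^4. inverse ((norm y)\<^sup>2 * (1 + (norm y)\<^sup>2)\<^sup>2)"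
  let ?f = "\<lambda>k (y::real^4). ennreal (4 * 4 ^ k) * indicator (cball 0 (1 / 2 ^ k)) y"
  let ?g = "\<lambda>k (y::real^4). ennreal (1 / 64 ^ k) * indicator (cball 0 (2 ^ Suc k)) y"
  have bound: "ennreal (?h y) \<le> (\<Sum>k. ?f k y) + (\<Sum>k. ?g k y)" for y
  proof (cases "y = 0")
    case False
    define t where "t = norm y"
    have t: "t > 0" using False by (simp add: t_def)
    have le_suminf: "F k \<le> suminf F" for F :: "nat \<Rightarrow> ennreal" and k
      using sum_le_suminf[of F "{k}"] summableI by simp
    show ?thesis
    proof (cases "t \<le> 1")
      case True
      then obtain k where k: "1 / 2 ^ Suc k < t" "t \<le> 1 / 2 ^ k" using dyadic_small t by blast
      have "(1 / 2 ^ Suc k)\<^sup>2 \<le> t\<^sup>2 * 1" using k t by (simp add: power_mono)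
      also have "\<dots> \<le> t\<^sup>2 * (1 + t\<^sup>2)\<^sup>2" by (intro mult_left_mono one_le_power) auto
      finally have "?h y \<le> inverse ((1 / 2 ^ Suc k)\<^sup>2)" unfolding t_def by (rule le_imp_inverse_le) simp
      also have "\<dots> = 4 * 4 ^ k"
        by (simp add: power2_eq_square flip: power_mult_distrib)
      finally have "ennreal (?h y) \<le> ?f k y" using k by (simp add: t_def ennreal_leI)
      also have "\<dots> \<le> (\<Sum>k. ?f k y)" by (rule le_suminf)
      finally show ?thesis by (meson order_trans le_iff_add add_increasing2 zero_le)
    next
      case False
      then obtain k where k: "2 ^ k < t" "t \<le> 2 ^ Suc k" using dyadic_large[of t] by auto
      have "(2 ^ k)\<^sup>2 * ((2 ^ k)\<^sup>2)\<^sup>2 \<le> t\<^sup>2 * (1 + t\<^sup>2)\<^sup>2"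
      proof (intro mult_mono power_mono)
        have "(2 ^ k)\<^sup>2 \<le> t\<^sup>2" using k by (intro power_mono) auto
        then show "(2 ^ k)\<^sup>2 \<le> 1 + t\<^sup>2" by simp
      qed (use k in auto)
      moreover have "(2 ^ k)\<^sup>2 * ((2 ^ k)\<^sup>2)\<^sup>2 = (64::real) ^ k"
        by (simp add: power2_eq_square flip: power_mult_distrib)
      ultimately have "inverse (t\<^sup>2 * (1 + t\<^sup>2)\<^sup>2) \<le> inverse (64 ^ k)"
        by (intro le_imp_inverse_le) auto
      then have "ennreal (?h y) \<le> ?g k y" using k by (simp add: t_def ennreal_leI divide_inverse)
      also have "\<dots> \<le> (\<Sum>k. ?g k y)" by (rule le_suminf)
      finally show ?thesis by (meson order_trans le_iff_add add_increasing zero_le)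
    qed
  qed simp
  define V where "V = unit_ball_vol 4"
  have V: "V \<ge> 0" by (simp add: V_def)
  have "(\<integral>\<^sup>+ y. ennreal (?h y) \<partial>lborel) \<le> (\<integral>\<^sup>+ y. (\<Sum>k. ?f k y) + (\<Sum>k. ?g k y) \<partial>lborel)"
    by (rule nn_integral_mono) (rule bound)
  also have "\<dots> = (\<Sum>k. \<integral>\<^sup>+ y. ?f k y \<partial>lborel) + (\<Sum>k. \<integral>\<^sup>+ y. ?g k y \<partial>lborel)"
  proof -
    have m: "?f k \<in> borel_measurable lborel" "?g k \<in> borel_measurable lborel" for k
      by (intro borel_measurable_times_ennreal borel_measurable_const borel_measurable_indicator; simp)+
    then have "(\<lambda>y. \<Sum>k. ?f k y) \<in> borel_measurable lborel" "(\<lambda>y. \<Sum>k. ?g k y) \<in> borel_measurable lborel"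
      by (intro borel_measurable_suminf_order; simp)+
    then show ?thesis by (simp only: nn_integral_add nn_integral_suminf[OF m(1)] nn_integral_suminf[OF m(2)])
  qed
  also have "(\<lambda>k. \<integral>\<^sup>+ y. ?f k y \<partial>lborel) = (\<lambda>k. ennreal (4 * V * (1 / 4) ^ k))"
  proof
    fix k
    have "(4 * 4 ^ k) * (V * (1 / 2 ^ k) ^ 4) = 4 * V * (1 / 4) ^ k"
    proof -
      have "((2::real) ^ k) ^ 4 = 4 ^ k * 4 ^ k"
        by (simp add: power4_eq_xxxx flip: power_mult_distrib)
      then show ?thesis by (simp add: power_divide)
    qed
    then show "(\<integral>\<^sup>+ y. ?f k y \<partial>lborel) = ennreal (4 * V * (1 / 4) ^ k)"
      by (simp add: nn_integral_cmult_indicator emeasure_cball V_def flip: ennreal_mult)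
  qed
  also have "(\<lambda>k. \<integral>\<^sup>+ y. ?g k y \<partial>lborel) = (\<lambda>k. ennreal (16 * V * (1 / 4) ^ k))"
  proof
    fix k
    have "(1 / 64 ^ k) * (V * (2 ^ Suc k) ^ 4) = 16 * V * (1 / 4) ^ k"
    proof -
      have "((2::real) ^ k) ^ 4 * 4 ^ k = 64 ^ k"
        by (simp add: power4_eq_xxxx flip: power_mult_distrib)
      then show ?thesis by (simp add: power_divide power_mult_distrib field_simps)
    qed
    then show "(\<integral>\<^sup>+ y. ?g k y \<partial>lborel) = ennreal (16 * V * (1 / 4) ^ k)"
      by (simp add: nn_integral_cmult_indicator emeasure_cball V_def flip: ennreal_mult)
  qed
  also have "(\<Sum>k. ennreal (4 * V * (1 / 4) ^ k)) + (\<Sum>k. ennreal (16 * V * (1 / 4) ^ k)) < \<infinity>"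
  proof -
    have s: "summable (\<lambda>k. c * (1 / 4 :: real) ^ k)" for c
      by (intro summable_mult summable_geometric) simp
    show ?thesis using V by (simp add: suminf_ennreal2[OF _ s])
  qed
  finally show "(\<integral>\<^sup>+ y. ennreal (?h y) \<partial>lborel) < \<infinity>" .
qed auto

lemma sqrt_det_g_eps: "sqrt (det (g_eps \<epsilon> x)) = conf \<epsilon> x ^ 4"
proof -
  have "det (g_eps \<epsilon> x) = (\<Prod>i\<in>(UNIV::4 set). g_eps \<epsilon> x $ i $ i)"
    by (rule det_diagonal) (simp add: g_eps_conf mat_def)
  also have "\<dots> = (conf \<epsilon> x ^ 4)\<^sup>2"
    by (simp add: g_eps_conf mat_def flip: power_mult)
  finally show ?thesis by (simp only: real_sqrt_abs) simp
qed

lemma measurable_on_punctured: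
  assumes "continuous_on punctured_R4 f"
  shows "f \<in> borel_measurable (restrict_space lborel punctured_R4)"
  using borel_measurable_continuous_on_restrict[OF assms]
  by (simp cong: measurable_cong_sets add: sets_restrict_space)

lemma continuous_on_conf: "continuous_on punctured_R4 (conf \<epsilon>)"
  unfolding conf_def by (intro continuous_intros) auto

lemma lborel_scale:
  fixes Q :: "'a::euclidean_space \<Rightarrow> real"
  assumes "c > 0" and Q: "integrable lborel Q"
  shows "integrable lborel (\<lambda>x. Q (c *\<^sub>R x))"
    and "(\<integral>x. Q (c *\<^sub>R x) \<partial>lborel) = (\<integral>x. Q x \<partial>lborel) / c ^ DIM('a)"
proof -
  have M: "(lborel :: 'a measure) = density (distr lborel borel (\<lambda>x. c *\<^sub>R x)) (\<lambda>_. ennreal (c ^ DIM('a)))"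
    using lborel_affine[of c "0::'a"] assms(1) by (simp add: ennreal_power)
  have m: "Q \<in> borel_measurable (distr lborel borel (\<lambda>x. c *\<^sub>R x))"
    using borel_measurable_integrable[OF Q] by simp
  have c: "c ^ DIM('a) > 0" using assms(1) by simp
  have "integrable (distr lborel borel (\<lambda>x::'a. c *\<^sub>R x)) (\<lambda>x. c ^ DIM('a) *\<^sub>R Q x)"
    using Q by (subst (asm) M) (use c m in \<open>simp add: integrable_density\<close>)
  then have "integrable (distr lborel borel (\<lambda>x::'a. c *\<^sub>R x)) Q"
    using assms(1) by simp
  then show "integrable lborel (\<lambda>x. Q (c *\<^sub>R x))"
    using m by (subst (asm) integrable_distr_eq) auto
  have "(\<integral>x. Q x \<partial>lborel) = (\<integral>x. c ^ DIM('a) *\<^sub>R Q x \<partial>distr lborel borel (\<lambda>x::'a. c *\<^sub>R x))"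
    by (subst M, rule integral_density) (use m c in auto)
  also have "\<dots> = c ^ DIM('a) * (\<integral>x. Q (c *\<^sub>R x) \<partial>lborel)"
    using m by (subst integral_distr) auto
  finally show "(\<integral>x. Q (c *\<^sub>R x) \<partial>lborel) = (\<integral>x. Q x \<partial>lborel) / c ^ DIM('a)"
    using assms(1) by simp
qed

text \<open>Under \<open>x = y / \<epsilon>\<close> the metric \<open>g\<^sub>\<epsilon>\<close> becomes \<open>\<epsilon>\<^sup>2 g\<^sub>1\<close>. Here \<open>h \<epsilon>\<close> stands for \<open>|\<nabla>\<omega>|\<close> and \<open>G\<close> for its profile; the bound
  on \<open>G\<close> decays fast enough at both ends for \<open>G\<close> to be square integrable with respect to the volume of \<open>g\<^sub>1\<close>.\<close>

locale scaled_profile =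
  fixes h :: "real \<Rightarrow> real^4 \<Rightarrow> real" and G :: "real^4 \<Rightarrow> real" and K :: real
  assumes h: "\<And>\<epsilon> x. \<epsilon> > 0 \<Longrightarrow> x \<noteq> 0 \<Longrightarrow> h \<epsilon> x = 1 / \<epsilon> * G (\<epsilon> *\<^sub>R x)"
    and cont: "continuous_on punctured_R4 G"
    and nonneg: "\<And>y. G y \<ge> 0"
    and bound: "\<And>y. y \<noteq> 0 \<Longrightarrow> (G y)\<^sup>2 \<le> K * ((norm y)\<^sup>2 ^ 3 / (1 + (norm y)\<^sup>2) ^ 6)"
begin

definition energy_density :: "real^4 \<Rightarrow> real" where
  "energy_density y = indicator punctured_R4 y *\<^sub>R (conf 1 y ^ 4 * (G y)\<^sup>2)"

lemma integrable_energy_density: "integrable lborel energy_density"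
proof (rule Bochner_Integration.integrable_bound)
  show "integrable lborel (\<lambda>y::real^4. K * inverse ((norm y)\<^sup>2 * (1 + (norm y)\<^sup>2)\<^sup>2))"
    using integrable_radial_majorant by simp
  have "continuous_on punctured_R4 (\<lambda>y. conf 1 y ^ 4 * (G y)\<^sup>2)"
    by (intro continuous_intros continuous_on_conf cont)
  from measurable_on_punctured[OF this] show "energy_density \<in> borel_measurable lborel"
    unfolding energy_density_def[abs_def] by (subst (asm) borel_measurable_restrict_space_iff) auto
  have "norm (energy_density y) \<le> norm (K * inverse ((norm y)\<^sup>2 * (1 + (norm y)\<^sup>2)\<^sup>2))" for y
  proof (cases "y = 0")
    case False
    define N where "N = (norm y)\<^sup>2"
    have N: "N > 0" using False by (simp add: N_def)
    obtain q where q: "q = 1 + N" by blast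
    then have q0: "q > 0" using N by simp
    have "conf 1 y = q / N" using N by (simp add: conf_def N_def[symmetric] q field_simps)
    then have "energy_density y = (q / N) ^ 4 * (G y)\<^sup>2" using False by (simp add: energy_density_def)
    also have "\<dots> \<le> (q / N) ^ 4 * (K * (N ^ 3 / q ^ 6))"
      using bound[OF False] by (intro mult_left_mono) (auto simp: N_def q)
    also have "\<dots> = K * inverse (N * q\<^sup>2)"
      using N q0 by (simp add: field_simps flip: power_add) (simp add: eval_nat_numeral)
    finally show ?thesis
      using False by (simp add: N_def q energy_density_def)
  qed (simp add: energy_density_def)
  then show "AE y in lborel. norm (energy_density y) \<le> norm (K * inverse ((norm y)\<^sup>2 * (1 + (norm y)\<^sup>2)\<^sup>2))" by simp
qed

text \<open>The volume density contributes \<open>\<epsilon>\<^sup>8\<close> and the squared gradient \<open>\<epsilon>\<^sup>-\<^sup>2\<close>; the substitution \<open>y = \<epsilon>x\<close> then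
  costs \<open>\<epsilon>\<^sup>-\<^sup>4\<close>, which leaves the factor \<open>\<epsilon>\<^sup>2\<close> of \<open>L2_h\<close>.\<close>

lemma weighted_square:
  assumes "\<epsilon> > 0"
  shows "indicator punctured_R4 x *\<^sub>R (conf \<epsilon> x ^ 4 *\<^sub>R (h \<epsilon> x)\<^sup>2) = \<epsilon> ^ 6 * energy_density (\<epsilon> *\<^sub>R x)"
proof (cases "x = 0")
  case False
  have "conf \<epsilon> x = \<epsilon>\<^sup>2 * conf 1 (\<epsilon> *\<^sub>R x)"
    using assms False by (simp add: conf_def power_mult_distrib field_simps)
  then show ?thesis
    using assms False
    by (simp add: energy_density_def h power_mult_distrib power_divide flip: power_mult)
      (simp add: power2_eq_square eval_nat_numeral)
qed (simp add: energy_density_def)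

lemma measurable_h: "\<epsilon> > 0 \<Longrightarrow> (\<lambda>x. (h \<epsilon> x)\<^sup>2) \<in> borel_measurable (restrict_space lborel punctured_R4)"
proof (rule measurable_on_punctured)
  assume "\<epsilon> > 0"
  have "continuous_on punctured_R4 (\<lambda>x. (1 / \<epsilon> * G (\<epsilon> *\<^sub>R x))\<^sup>2)"
    by (intro continuous_intros continuous_on_compose2[OF cont]) (use \<open>\<epsilon> > 0\<close> in auto)
  then show "continuous_on punctured_R4 (\<lambda>x. (h \<epsilon> x)\<^sup>2)"
    by (rule continuous_on_eq) (use \<open>\<epsilon> > 0\<close> in \<open>simp add: h\<close>)
qed

lemma volume_eq:
  "riem_volume punctured_R4 (g_eps \<epsilon>) = density (restrict_space lborel punctured_R4) (\<lambda>x. ennreal (conf \<epsilon> x ^ 4))"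
  by (simp add: riem_volume_def sqrt_det_g_eps)

lemma integrable_h:
  assumes "\<epsilon> > 0"
  shows "integrable (riem_volume punctured_R4 (g_eps \<epsilon>)) (\<lambda>x. (h \<epsilon> x)\<^sup>2)"
proof -
  have m: "(\<lambda>x. conf \<epsilon> x ^ 4) \<in> borel_measurable (restrict_space lborel punctured_R4)"
    by (intro measurable_on_punctured continuous_intros continuous_on_conf)
  have "integrable lborel (\<lambda>x. indicator punctured_R4 x *\<^sub>R (conf \<epsilon> x ^ 4 *\<^sub>R (h \<epsilon> x)\<^sup>2))"
    unfolding weighted_square[OF assms] using lborel_scale(1)[OF assms integrable_energy_density] by simp
  then have "integrable (restrict_space lborel punctured_R4) (\<lambda>x. conf \<epsilon> x ^ 4 *\<^sub>R (h \<epsilon> x)\<^sup>2)"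
    by (subst integrable_restrict_space) auto
  then show ?thesis
    unfolding volume_eq by (subst integrable_density[OF measurable_h[OF assms] m]) auto
qed

definition energy_norm :: real where "energy_norm = sqrt (\<integral>y. energy_density y \<partial>lborel)"

lemma L2_h:
  assumes "\<epsilon> > 0"
  shows "L2_norm (riem_volume punctured_R4 (g_eps \<epsilon>)) (h \<epsilon>) = \<epsilon> * energy_norm"
proof -
  have "(\<integral>x. (h \<epsilon> x)\<^sup>2 \<partial>riem_volume punctured_R4 (g_eps \<epsilon>)) =
      (\<integral>x. conf \<epsilon> x ^ 4 *\<^sub>R (h \<epsilon> x)\<^sup>2 \<partial>restrict_space lborel punctured_R4)"
    unfolding volume_eq
    by (intro integral_density measurable_h[OF assms] measurable_on_punctured[OF continuous_on_power[OF continuous_on_conf]])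
      auto
  also have "\<dots> = (\<integral>x. \<epsilon> ^ 6 * energy_density (\<epsilon> *\<^sub>R x) \<partial>lborel)"
    unfolding weighted_square[OF assms, symmetric] by (rule integral_restrict_space) simp
  also have "\<dots> = \<epsilon>\<^sup>2 * (\<integral>y. energy_density y \<partial>lborel)"
  proof -
    have "\<epsilon> ^ 6 * (I / \<epsilon> ^ 4) = \<epsilon>\<^sup>2 * I" for I using assms by (simp add: field_simps flip: power_add)
    then show ?thesis using lborel_scale(2)[OF assms integrable_energy_density] by simp
  qed
  finally show ?thesis using assms by (simp add: L2_norm_def energy_norm_def real_sqrt_mult)
qed

lemma bounded_G: "y \<noteq> 0 \<Longrightarrow> G y \<le> sqrt \<bar>K\<bar>"
proof (rule real_le_rsqrt)
  assume y: "y \<noteq> 0"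
  define N where "N = (norm y)\<^sup>2"
  have N: "N \<ge> 0" by (simp add: N_def)
  have "N ^ 3 \<le> (1 + N) ^ 3" using N by (intro power_mono) auto
  also have "\<dots> \<le> (1 + N) ^ 6" using N by (intro power_increasing) auto
  finally have r: "0 \<le> N ^ 3 / (1 + N) ^ 6" "N ^ 3 / (1 + N) ^ 6 \<le> 1" using N by (simp_all add: divide_le_eq_1)
  have "(G y)\<^sup>2 \<le> K * (N ^ 3 / (1 + N) ^ 6)" using bound[OF y] by (simp add: N_def)
  also have "\<dots> \<le> \<bar>K\<bar> * 1" using r by (intro mult_mono) auto
  finally show "(G y)\<^sup>2 \<le> \<bar>K\<bar>" by simp
qed

lemma bdd_h: "\<epsilon> > 0 \<Longrightarrow> bdd_above (h \<epsilon> ` punctured_R4)"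
  by (rule bdd_aboveI[of _ "1 / \<epsilon> * sqrt \<bar>K\<bar>"]) (auto simp: h intro!: divide_right_mono bounded_G)

definition profile_sup :: real where "profile_sup = (SUP y\<in>punctured_R4. G y)"

lemma bdd_G: "bdd_above (G ` punctured_R4)"
  by (rule bdd_aboveI[of _ "sqrt \<bar>K\<bar>"]) (auto intro: bounded_G)

lemma punctured_nonempty: "punctured_R4 \<noteq> {}"
  by (metis empty_iff in_punctured axis_eq_0_iff zero_neq_one)

lemma SUP_h:
  assumes "\<epsilon> > 0"
  shows "(SUP x\<in>punctured_R4. h \<epsilon> x) = profile_sup / \<epsilon>"
proof (rule cSup_eq_non_empty)
  show "h \<epsilon> ` punctured_R4 \<noteq> {}" using punctured_nonempty by simp
  fix v assume "v \<in> h \<epsilon> ` punctured_R4"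
  then obtain x where x: "x \<noteq> 0" "v = G (\<epsilon> *\<^sub>R x) / \<epsilon>" using assms by (auto simp: h)
  have "G (\<epsilon> *\<^sub>R x) \<le> profile_sup" unfolding profile_sup_def using x assms by (intro cSUP_upper bdd_G) auto
  then show "v \<le> profile_sup / \<epsilon>" using x assms by (simp add: divide_right_mono)
next
  fix b assume b: "\<And>v. v \<in> h \<epsilon> ` punctured_R4 \<Longrightarrow> v \<le> b"
  have "profile_sup \<le> \<epsilon> * b" unfolding profile_sup_def
  proof (rule cSUP_least[OF punctured_nonempty])
    fix y assume "y \<in> punctured_R4"
    then have "h \<epsilon> ((1 / \<epsilon>) *\<^sub>R y) \<le> b" "h \<epsilon> ((1 / \<epsilon>) *\<^sub>R y) = G y / \<epsilon>"
      using b[OF imageI, of "(1 / \<epsilon>) *\<^sub>R y"] assms by (simp_all add: h)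
    then show "G y \<le> \<epsilon> * b" using assms by (simp add: field_simps)
  qed
  then show "profile_sup / \<epsilon> \<le> b" using assms by (simp add: field_simps)
qed

lemma mono_L2: "mono_on {0<..} (\<lambda>\<epsilon>. L2_norm (riem_volume punctured_R4 (g_eps \<epsilon>)) (h \<epsilon>))"
proof -
  have "energy_norm \<ge> 0" unfolding energy_norm_def by (intro real_sqrt_ge_zero Bochner_Integration.integral_nonneg) (simp add: energy_density_def)
  then show ?thesis by (auto simp: mono_on_def L2_h mult_right_mono)
qed

lemma lim_L2: "((\<lambda>\<epsilon>. L2_norm (riem_volume punctured_R4 (g_eps \<epsilon>)) (h \<epsilon>)) \<longlongrightarrow> 0) (at_right 0)"
proof -
  have "((\<lambda>\<epsilon>. \<epsilon> * energy_norm) \<longlongrightarrow> 0) (at_right 0)" by (auto intro!: tendsto_eq_intros)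
  then show ?thesis
    by (rule Lim_transform_eventually)
      (rule eventually_mono[OF eventually_at_right_less[of 0]], simp add: L2_h)
qed

text \<open>Outside a ball there is a unit ball, of positive measure, on which the energy density is positive.\<close>

lemma positive_profile:
  assumes pos: "\<And>y. norm y > R \<Longrightarrow> G y > 0"
  shows "energy_norm > 0" and "profile_sup > 0"
proof -
  let ?y = "(\<bar>R\<bar> + 2) *\<^sub>R axis 1 1 :: real^4"
  have y: "norm ?y = \<bar>R\<bar> + 2" by simp
  then have "?y \<noteq> 0" by (metis abs_ge_zero add_nonneg_pos less_irrefl norm_zero zero_less_numeral)
  then have "G ?y \<le> profile_sup" unfolding profile_sup_def by (intro cSUP_upper bdd_G) simp
  moreover have "R < norm ?y" unfolding y by linarith
  ultimately show "profile_sup > 0" using pos[of ?y] by linarith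
  have nn: "energy_density z \<ge> 0" for z by (simp add: energy_density_def)
  have "(\<integral>y. energy_density y \<partial>lborel) \<noteq> 0"
  proof
    assume "(\<integral>y. energy_density y \<partial>lborel) = 0"
    then have AE: "AE z in lborel. energy_density z = 0"
      using integral_nonneg_eq_0_iff_AE[OF integrable_energy_density] nn by simp
    have Qpos: "energy_density z \<noteq> 0" if "z \<in> ball ?y 1" for z
    proof -
      have "norm ?y - norm z \<le> dist ?y z" by (simp only: dist_norm norm_triangle_ineq2)
      then have z: "norm z > \<bar>R\<bar> + 1" using that y by simp
      then have "z \<noteq> 0" "G z > 0" using pos[of z] by auto
      then show ?thesis using conf_pos[of z 1] by (simp add: energy_density_def)
    qed
    have "AE z in lborel. z \<notin> ball ?y 1" using AE by (rule eventually_mono) (use Qpos in blast)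
    then have "emeasure lborel (ball ?y 1) = 0"
      by (subst (asm) AE_iff_measurable[of "ball ?y 1"]) auto
    then show False using unit_ball_vol_pos[of 4] by (simp add: emeasure_ball)
  qed
  moreover have "(\<integral>y. energy_density y \<partial>lborel) \<ge> 0" using nn by (intro Bochner_Integration.integral_nonneg)
  ultimately show "energy_norm > 0" by (simp add: energy_norm_def)
qed

lemma strict_L2:
  "energy_norm > 0 \<Longrightarrow> strict_mono_on {0<..} (\<lambda>\<epsilon>. L2_norm (riem_volume punctured_R4 (g_eps \<epsilon>)) (h \<epsilon>))"
  by (auto simp: strict_mono_on_def L2_h)

lemma strict_SUP: "profile_sup > 0 \<Longrightarrow> strict_antimono_on {0<..} (\<lambda>\<epsilon>. SUP x\<in>punctured_R4. h \<epsilon> x)"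
  by (rule monotone_onI) (simp add: SUP_h divide_strict_left_mono)

lemma lim_SUP:
  assumes "profile_sup > 0"
  shows "filterlim (\<lambda>\<epsilon>. SUP x\<in>punctured_R4. h \<epsilon> x) at_top (at_right 0)"
proof -
  have "LIM \<epsilon> at_right 0. profile_sup * inverse \<epsilon> :> at_top"
    using assms by (intro filterlim_tendsto_pos_mult_at_top[of "\<lambda>_. profile_sup" profile_sup] filterlim_inverse_at_top_right) auto
  then show ?thesis
    by (rule filterlim_mono_eventually)
      (auto intro!: eventually_mono[OF eventually_at_right_less[of 0]] simp: SUP_h divide_inverse)
qed

end

lemma len_sq_norm: "len_sq w = (norm w)\<^sup>2 / 2"
  by (simp add: len_sq_def power2_norm_eq_inner inner_vec_def)

text \<open>The value of \<open>|\<nabla>\<omega>|\<close> for \<open>\<epsilon> = 1\<close>.\<close>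

definition profile :: "real \<Rightarrow> real^4^4 \<Rightarrow> real \<Rightarrow> real^4^4 \<Rightarrow> real^4 \<Rightarrow> real" where
  "profile \<alpha> A \<beta> B y = sqrt (24 * ((norm y)\<^sup>2) ^ 5 / (1 + (norm y)\<^sup>2) ^ 8 *
      len_sq (\<alpha> *\<^sub>R A - (\<beta> / (norm y)\<^sup>2) *\<^sub>R reflect y B))"

text \<open>The two summands of \<open>\<alpha>A - (\<beta>/N) B'\<close> have squared lengths \<open>\<alpha>\<^sup>2\<close> and \<open>\<beta>\<^sup>2/N\<^sup>2\<close>, and the triangle
  inequality gives the bound.\<close>

lemma profile_scaled:
  assumes A: "dual_form 1 A" and B: "alternating B"
    and C: "\<And>y. y \<noteq> 0 \<Longrightarrow> dual_form 1 (reflect y B)"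
    and h: "\<And>\<epsilon> x. \<epsilon> > 0 \<Longrightarrow> x \<noteq> 0 \<Longrightarrow>
      h \<epsilon> x = form2_deriv_norm (g_eps \<epsilon> x) (cov_deriv2 (g_eps \<epsilon>) (model_form \<alpha> A \<beta> B \<epsilon>) x)"
    and len: "len_sq A = 1" "\<And>y. y \<noteq> 0 \<Longrightarrow> len_sq (reflect y B) = 1"
  shows "scaled_profile h (profile \<alpha> A \<beta> B) (48 * (\<alpha>\<^sup>2 + \<beta>\<^sup>2))"
proof
  show "h \<epsilon> x = 1 / \<epsilon> * profile \<alpha> A \<beta> B (\<epsilon> *\<^sub>R x)" if "\<epsilon> > 0" "x \<noteq> 0" for \<epsilon> x
    using h[OF that] grad_norm_model_form[OF A B C[OF that(2)] that(2,1)] that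
    by (simp add: profile_def power_mult_distrib reflect_scale_point)
  show "continuous_on punctured_R4 (profile \<alpha> A \<beta> B)"
  proof -
    have "continuous_on punctured_R4 (\<lambda>y. reflect y B)"
      unfolding reflect_def contract_def wedge_def vec_lambda_beta
      by (intro continuous_intros continuous_on_vec_lambda) auto
    then show ?thesis
      unfolding profile_def[abs_def] len_sq_norm
      by (intro continuous_intros) (auto simp: add_nonneg_eq_0_iff)
  qed
  show "0 \<le> profile \<alpha> A \<beta> B y" for y by (simp add: profile_def len_sq_norm)
  fix y :: "real^4" assume y: "y \<noteq> 0"
  define N where "N = (norm y)\<^sup>2"
  have N: "N > 0" using y by (simp add: N_def)
  let ?D = "\<alpha> *\<^sub>R A - (\<beta> / N) *\<^sub>R reflect y B"
  have nA: "(norm A)\<^sup>2 = 2" "(norm (reflect y B))\<^sup>2 = 2" using len y by (simp_all add: len_sq_norm)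
  have "norm ?D \<le> norm (\<alpha> *\<^sub>R A) + norm ((\<beta> / N) *\<^sub>R reflect y B)" by (rule norm_triangle_ineq4)
  then have "(norm ?D)\<^sup>2 \<le> (norm (\<alpha> *\<^sub>R A) + norm ((\<beta> / N) *\<^sub>R reflect y B))\<^sup>2"
    by (intro power_mono) auto
  also have "\<dots> \<le> 2 * (norm (\<alpha> *\<^sub>R A))\<^sup>2 + 2 * (norm ((\<beta> / N) *\<^sub>R reflect y B))\<^sup>2"
    using sum_squares_bound[of "norm (\<alpha> *\<^sub>R A)" "norm ((\<beta> / N) *\<^sub>R reflect y B)"]
    by (simp add: power2_sum)
  also have "\<dots> = 4 * \<alpha>\<^sup>2 + 4 * (\<beta>\<^sup>2 / N\<^sup>2)"
    by (simp add: power_mult_distrib nA power_divide)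
  finally have D: "len_sq ?D \<le> 2 * \<alpha>\<^sup>2 + 2 * (\<beta>\<^sup>2 / N\<^sup>2)" by (simp add: len_sq_norm)
  obtain q where q: "q = 1 + N" by blast
  then have q0: "q > 0" using N by simp
  have "(profile \<alpha> A \<beta> B y)\<^sup>2 = 24 * N ^ 5 / q ^ 8 * len_sq ?D"
    using q0 N by (simp add: profile_def N_def[symmetric] q len_sq_norm)
  also have "\<dots> \<le> 24 * N ^ 5 / q ^ 8 * (2 * \<alpha>\<^sup>2 + 2 * (\<beta>\<^sup>2 / N\<^sup>2))"
    using D q0 N by (intro mult_left_mono) auto
  also have "\<dots> = 48 * (N ^ 3 / q ^ 8) * (\<alpha>\<^sup>2 * N\<^sup>2 + \<beta>\<^sup>2)"
  proof -
    have "N ^ 5 = N ^ 3 * N\<^sup>2" by (simp flip: power_add)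
    then have "N ^ 5 * (2 * \<alpha>\<^sup>2 + 2 * (\<beta>\<^sup>2 / N\<^sup>2)) = 2 * N ^ 3 * (\<alpha>\<^sup>2 * N\<^sup>2 + \<beta>\<^sup>2)"
      using N by (simp add: field_simps)
    then show ?thesis by (simp add: mult.assoc)
  qed
  also have "\<dots> \<le> 48 * (N ^ 3 / q ^ 8) * ((\<alpha>\<^sup>2 + \<beta>\<^sup>2) * q\<^sup>2)"
  proof (intro mult_left_mono)
    have "N\<^sup>2 \<le> q\<^sup>2" "1 \<le> q\<^sup>2" using N q by (auto intro: power_mono)
    then have "\<alpha>\<^sup>2 * N\<^sup>2 \<le> \<alpha>\<^sup>2 * q\<^sup>2" "\<beta>\<^sup>2 * 1 \<le> \<beta>\<^sup>2 * q\<^sup>2" by (intro mult_left_mono; simp)+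
    then show "\<alpha>\<^sup>2 * N\<^sup>2 + \<beta>\<^sup>2 \<le> (\<alpha>\<^sup>2 + \<beta>\<^sup>2) * q\<^sup>2" by (simp add: distrib_right)
  qed (use N q0 in auto)
  also have "\<dots> = 48 * (\<alpha>\<^sup>2 + \<beta>\<^sup>2) * (N ^ 3 / q ^ 6)"
  proof -
    have "q ^ 8 = q ^ 6 * q\<^sup>2" by (simp flip: power_add)
    then show ?thesis using q0 by (simp only:) (simp add: field_simps)
  qed
  finally show "(profile \<alpha> A \<beta> B y)\<^sup>2 \<le> 48 * (\<alpha>\<^sup>2 + \<beta>\<^sup>2) * ((norm y)\<^sup>2 ^ 3 / (1 + (norm y)\<^sup>2) ^ 6)"
    by (simp add: N_def q)
qed

text \<open>The lengths \<open>|\<alpha>|\<close> and \<open>|\<beta>|/N\<close> of the two summands differ once \<open>N\<close> is large, unless both vanish.\<close>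

lemma profile_positive:
  assumes "(\<alpha>, \<beta>) \<noteq> (0, 0)" and len: "len_sq A = 1" "\<And>y. y \<noteq> 0 \<Longrightarrow> len_sq (reflect y B) = 1"
  shows "\<exists>R. \<forall>y. norm y > R \<longrightarrow> profile \<alpha> A \<beta> B y > 0"
proof (intro exI allI impI)
  fix y :: "real^4"
  define R where "R = 1 + (if \<alpha> = 0 then 0 else \<bar>\<beta>\<bar> / \<bar>\<alpha>\<bar>)"
  assume "norm y > 1 + (if \<alpha> = 0 then 0 else \<bar>\<beta>\<bar> / \<bar>\<alpha>\<bar>)"
  then have yR: "norm y > R" by (simp add: R_def)
  have R1: "R \<ge> 1" by (simp add: R_def)
  define N where "N = (norm y)\<^sup>2"
  have y: "y \<noteq> 0" using yR R1 by auto
  have "norm y * 1 \<le> norm y * norm y" using yR R1 by (intro mult_left_mono) auto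
  then have NR: "N > R" using yR by (simp add: N_def power2_eq_square)
  have N: "N > 0" using NR R1 by simp
  have nA: "norm A = sqrt 2" "norm (reflect y B) = sqrt 2"
    using len(1) len(2)[OF y] by (simp_all add: len_sq_norm real_sqrt_unique[symmetric])
  have "\<alpha> *\<^sub>R A \<noteq> (\<beta> / N) *\<^sub>R reflect y B"
  proof
    assume "\<alpha> *\<^sub>R A = (\<beta> / N) *\<^sub>R reflect y B"
    then have "norm (\<alpha> *\<^sub>R A) = norm ((\<beta> / N) *\<^sub>R reflect y B)" by simp
    then have e: "\<bar>\<alpha>\<bar> * N = \<bar>\<beta>\<bar>" using N by (simp add: nA field_simps)
    show False
    proof (cases "\<alpha> = 0")
      case True then show ?thesis using e assms(1) by simp
    next
      case False
      then have "N = \<bar>\<beta>\<bar> / \<bar>\<alpha>\<bar>" using e by (simp add: field_simps)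
      then show ?thesis using NR False by (simp add: R_def)
    qed
  qed
  then have "len_sq (\<alpha> *\<^sub>R A - (\<beta> / N) *\<^sub>R reflect y B) > 0" by (simp add: len_sq_norm)
  then show "profile \<alpha> A \<beta> B y > 0"
    using N by (simp add: profile_def N_def[symmetric])
qed

section \<open>Path lengths\<close>

text \<open>Paths with their length. As the length is the value of a \<open>has_integral\<close> statement, the integrability of the speed is
  included.\<close>

definition conf_path :: "real \<Rightarrow> real^4 \<Rightarrow> real^4 \<Rightarrow> real \<Rightarrow> bool" where
  "conf_path \<epsilon> x y len \<longleftrightarrow> (\<exists>\<gamma>. valid_path \<gamma> \<and> path_image \<gamma> \<subseteq> punctured_R4 \<and> pathstart \<gamma> = x \<and> pathfinish \<gamma> = y \<and>
     ((\<lambda>s. conf \<epsilon> (\<gamma> s) * norm (vector_derivative \<gamma> (at s))) has_integral len) {0..1})"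

lemma conf_nonneg: "conf \<epsilon> x \<ge> 0"
  by (simp add: conf_def)

lemma riem_speed_g_eps: "riem_speed (g_eps \<epsilon>) \<gamma> = (\<lambda>s. conf \<epsilon> (\<gamma> s) * norm (vector_derivative \<gamma> (at s)))"
proof
  fix s
  have "eval2 (c *\<^sub>R mat 1) v v = c * (norm v)\<^sup>2" for c and v :: "real^4"
  proof -
    have "eval2 (c *\<^sub>R mat 1) v v = (\<Sum>i\<in>UNIV. \<Sum>j\<in>UNIV. if j = i then c * (v $ i * v $ i) else 0)"
      unfolding eval2_def by (intro sum.cong refl) (simp add: mat_def)
    also have "\<dots> = c * (\<Sum>i\<in>UNIV. v $ i * v $ i)" by (simp add: sum_distrib_left)
    finally show ?thesis by (simp add: sum_square_norm)
  qed
  then show "riem_speed (g_eps \<epsilon>) \<gamma> s = conf \<epsilon> (\<gamma> s) * norm (vector_derivative \<gamma> (at s))"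
    unfolding riem_speed_def g_eps_conf by (simp add: real_sqrt_mult conf_nonneg)
qed

lemma riem_dist_g_eps:
  assumes "x \<noteq> 0" and "y \<noteq> 0"
  shows "riem_dist punctured_R4 (g_eps \<epsilon>) x y = Inf {len. conf_path \<epsilon> x y len}"
proof -
  have "{integral {0..1} (riem_speed (g_eps \<epsilon>) \<gamma>) | \<gamma>.
            valid_path \<gamma> \<and> path_image \<gamma> \<subseteq> punctured_R4 \<and> pathstart \<gamma> = x \<and> pathfinish \<gamma> = y \<and>
            riem_speed (g_eps \<epsilon>) \<gamma> integrable_on {0..1}} = {len. conf_path \<epsilon> x y len}"
    unfolding conf_path_def riem_speed_g_eps has_integral_iff by blast
  then show ?thesis using assms by (simp add: riem_dist_def)
qed

lemma conf_path_nonneg: "conf_path \<epsilon> x y len \<Longrightarrow> len \<ge> 0"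
  unfolding conf_path_def by (elim exE conjE, erule has_integral_nonneg) (simp add: conf_nonneg)

lemma riem_dist_le: "conf_path \<epsilon> x y len \<Longrightarrow> x \<noteq> 0 \<Longrightarrow> y \<noteq> 0 \<Longrightarrow> riem_dist punctured_R4 (g_eps \<epsilon>) x y \<le> len"
  unfolding riem_dist_g_eps using conf_path_nonneg by (intro cInf_lower bdd_belowI[of _ 0]) simp_all

lemma valid_path_derivative:
  assumes "valid_path \<gamma>"
  obtains S D where "finite S" "continuous_on {0..1} \<gamma>" "continuous_on ({0..1} - S) D"
    "\<And>s. s \<in> {0..1} - S \<Longrightarrow> (\<gamma> has_vector_derivative D s) (at s)"
    "\<And>s. s \<in> {0..1} - S \<Longrightarrow> vector_derivative \<gamma> (at s) = D s"
proof -
  obtain S D where "continuous_on {0..1} \<gamma>" "finite S" "continuous_on ({0..1} - S) D"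
    and D: "\<And>s. s \<in> {0..1} - S \<Longrightarrow> (\<gamma> has_vector_derivative D s) (at s)"
    using assms unfolding valid_path_def piecewise_C1_differentiable_on_def C1_differentiable_on_def by blast
  then show thesis using vector_derivative_at[OF D] by (intro that[of S D])
qed

text \<open>A map whose differential does not increase lengths bounds the distance from below.\<close>

lemma conf_path_lower:
  fixes H :: "real^4 \<Rightarrow> 'b::banach"
  assumes p: "conf_path \<epsilon> x y len"
    and H: "\<And>z. z \<noteq> 0 \<Longrightarrow> (H has_derivative H' z) (at z)"
    and le: "\<And>z v. z \<noteq> 0 \<Longrightarrow> norm (H' z v) \<le> conf \<epsilon> z * norm v"
  shows "norm (H y - H x) \<le> len"
proof -
  obtain \<gamma> where \<gamma>: "valid_path \<gamma>" "path_image \<gamma> \<subseteq> punctured_R4" "pathstart \<gamma> = x" "pathfinish \<gamma> = y"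
    "((\<lambda>s. conf \<epsilon> (\<gamma> s) * norm (vector_derivative \<gamma> (at s))) has_integral len) {0..1}"
    using p unfolding conf_path_def by blast
  obtain S D where S: "finite S" "continuous_on {0..1} \<gamma>"
    "\<And>s. s \<in> {0..1} - S \<Longrightarrow> (\<gamma> has_vector_derivative D s) (at s)"
    "\<And>s. s \<in> {0..1} - S \<Longrightarrow> vector_derivative \<gamma> (at s) = D s"
    using valid_path_derivative[OF \<gamma>(1)] by metis
  have nz: "\<gamma> s \<noteq> 0" if "s \<in> {0..1}" for s
    using subsetD[OF \<gamma>(2), of "\<gamma> s"] that by (simp add: path_image_def)
  define f where "f s = (if s \<in> S then 0 else H' (\<gamma> s) (D s))" for s
  have "(f has_integral (H (\<gamma> 1) - H (\<gamma> 0))) {0..1}"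
  proof (rule fundamental_theorem_of_calculus_interior_strong[OF S(1)])
    fix s :: real assume s: "s \<in> {0<..<1} - S"
    then have "(\<gamma> has_derivative (\<lambda>h. h *\<^sub>R D s)) (at s)"
      using S(3)[of s] by (simp add: has_vector_derivative_def)
    from has_derivative_compose[OF this H[OF nz]] s
    have d: "((\<lambda>s. H (\<gamma> s)) has_derivative (\<lambda>h. H' (\<gamma> s) (h *\<^sub>R D s))) (at s)" by simp
    have "H' (\<gamma> s) (h *\<^sub>R D s) = h *\<^sub>R H' (\<gamma> s) (D s)" for h
      using linear_scale[OF has_derivative_linear[OF H[OF nz]]] s by simp
    then show "((\<lambda>s. H (\<gamma> s)) has_vector_derivative f s) (at s)"
      using d s by (simp add: has_vector_derivative_def f_def)
  next
    have "continuous_on (\<gamma> ` {0..1}) H"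
      using has_derivative_continuous[OF H] nz by (intro continuous_at_imp_continuous_on) auto
    then show "continuous_on {0..1} (\<lambda>s. H (\<gamma> s))"
      using continuous_on_compose2[OF _ S(2)] by blast
  qed simp
  then have f: "f integrable_on {0..1}" "integral {0..1} f = H y - H x"
    using \<gamma>(3,4) by (auto simp: has_integral_iff pathstart_def pathfinish_def)
  have "norm (integral {0..1} f) \<le> integral {0..1} (\<lambda>s. conf \<epsilon> (\<gamma> s) * norm (vector_derivative \<gamma> (at s)))"
  proof (rule integral_norm_bound_integral[OF f(1)])
    show "(\<lambda>s. conf \<epsilon> (\<gamma> s) * norm (vector_derivative \<gamma> (at s))) integrable_on {0..1}"
      using \<gamma>(5) by blast
    fix s :: real assume s: "s \<in> {0..1}"
    show "norm (f s) \<le> conf \<epsilon> (\<gamma> s) * norm (vector_derivative \<gamma> (at s))"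
      using le[OF nz[OF s], of "D s"] S(4)[of s] s by (auto simp: f_def conf_nonneg)
  qed
  then show ?thesis using f(2) \<gamma>(5) by (simp add: integral_unique)
qed

text \<open>Affine reparametrization preserves length. This gives both halves of a joined path and the reversed path;
  the endpoints of the interval are exempt because a joined path may have a corner there.\<close>

lemma speed_affine:
  assumes v: "valid_path \<gamma>"
    and int: "((\<lambda>s. conf \<epsilon> (\<gamma> s) * norm (vector_derivative \<gamma> (at s))) has_integral len) {0..1}"
    and m: "m \<noteq> 0" and ab: "(\<lambda>s. (1 / m) * s + - ((1 / m) * c)) ` {0..1} = {a..b}"
    and p: "\<And>s. s \<in> {a<..<b} \<Longrightarrow> p s = \<gamma> (m * s + c)"
  shows "((\<lambda>s. conf \<epsilon> (p s) * norm (vector_derivative p (at s))) has_integral len) {a..b}"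
proof -
  let ?F = "\<lambda>s. conf \<epsilon> (\<gamma> s) * norm (vector_derivative \<gamma> (at s))"
  obtain S D where S: "finite S"
    "\<And>s. s \<in> {0..1} - S \<Longrightarrow> (\<gamma> has_vector_derivative D s) (at s)"
    "\<And>s. s \<in> {0..1} - S \<Longrightarrow> vector_derivative \<gamma> (at s) = D s"
    using valid_path_derivative[OF v] by metis
  have "((\<lambda>s. ?F (m * s + c)) has_integral (1 / \<bar>m\<bar>) * len) {a..b}"
    using has_integral_affinity[of ?F len 0 1 m c] int m ab by simp
  from has_integral_mult_right[OF this, of "\<bar>m\<bar>"]
  have int': "((\<lambda>s. \<bar>m\<bar> * ?F (m * s + c)) has_integral len) {a..b}" using m by simp
  show ?thesis
  proof (rule has_integral_spike_finite[OF _ _ int'])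
    show "finite (insert a (insert b ((\<lambda>t. (t - c) / m) ` S)))" using S(1) by simp
    fix s assume s: "s \<in> {a..b} - insert a (insert b ((\<lambda>t. (t - c) / m) ` S))"
    then have sab: "s \<in> {a<..<b}" by auto
    have "s \<in> (\<lambda>s. (1 / m) * s + - ((1 / m) * c)) ` {0..1}" using s ab by simp
    then have t: "m * s + c \<in> {0..1}" using m by (auto simp: field_simps)
    have tS: "m * s + c \<notin> S"
    proof
      assume "m * s + c \<in> S"
      then have "(m * s + c - c) / m \<in> (\<lambda>t. (t - c) / m) ` S" by (rule imageI)
      then show False using s m by simp
    qed
    have "((\<lambda>s. m * s + c) has_vector_derivative m) (at s)"
      by (auto intro!: derivative_eq_intros simp: has_vector_derivative_def)
    from vector_diff_chain_at[OF this S(2)] t tS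
    have "((\<lambda>s. \<gamma> (m * s + c)) has_vector_derivative m *\<^sub>R D (m * s + c)) (at s)"
      by (simp add: o_def)
    then have "(p has_vector_derivative m *\<^sub>R D (m * s + c)) (at s)"
      by (rule has_vector_derivative_transform_within_open[of _ _ _ "{a<..<b}"]) (use sab p in auto)
    then show "conf \<epsilon> (p s) * norm (vector_derivative p (at s)) = \<bar>m\<bar> * ?F (m * s + c)"
      using p[OF sab] S(3)[of "m * s + c"] t tS by (simp add: vector_derivative_at)
  qed
qed

lemma conf_path_join:
  assumes "conf_path \<epsilon> x y l1" and "conf_path \<epsilon> y z l2"
  shows "conf_path \<epsilon> x z (l1 + l2)"
proof -
  let ?F = "\<lambda>\<gamma> s. conf \<epsilon> (\<gamma> s) * norm (vector_derivative \<gamma> (at s))"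
  obtain g where g: "valid_path g" "path_image g \<subseteq> punctured_R4" "pathstart g = x" "pathfinish g = y"
    "(?F g has_integral l1) {0..1}"
    using assms(1) unfolding conf_path_def by blast
  obtain h where h: "valid_path h" "path_image h \<subseteq> punctured_R4" "pathstart h = y" "pathfinish h = z"
    "(?F h has_integral l2) {0..1}"
    using assms(2) unfolding conf_path_def by blast
  have "(?F (g +++ h) has_integral l1) {0..1/2}"
    by (rule speed_affine[OF g(1,5), of 2 0]) (auto simp: image_affinity_atLeastAtMost joinpaths_def)
  moreover have "(?F (g +++ h) has_integral l2) {1/2..1}"
    by (rule speed_affine[OF h(1,5), of 2 "-1"])
      (auto simp: image_affinity_atLeastAtMost[of "1/2" "1/2" 0 1, simplified] joinpaths_def)
  ultimately have "(?F (g +++ h) has_integral (l1 + l2)) {0..1}"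
    by (intro has_integral_combine[of 0 "1/2" 1]) auto
  moreover have "valid_path (g +++ h)" using g h by (intro valid_path_join) auto
  ultimately show ?thesis
    unfolding conf_path_def using g h
    by (intro exI[of _ "g +++ h"]) (auto simp: path_image_join)
qed

lemma conf_path_reverse:
  assumes "conf_path \<epsilon> x y len"
  shows "conf_path \<epsilon> y x len"
proof -
  obtain g where g: "valid_path g" "path_image g \<subseteq> punctured_R4" "pathstart g = x" "pathfinish g = y"
    "((\<lambda>s. conf \<epsilon> (g s) * norm (vector_derivative g (at s))) has_integral len) {0..1}"
    using assms(1) unfolding conf_path_def by blast
  have "((\<lambda>s. conf \<epsilon> (reversepath g s) * norm (vector_derivative (reversepath g) (at s))) has_integral len) {0..1}"
    by (rule speed_affine[OF g(1,5), of "-1" 1])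
      (auto simp: image_affinity_atLeastAtMost[of "-1" 1 0 1, simplified] reversepath_def)
  then show ?thesis
    unfolding conf_path_def using g valid_path_imp_reverse
    by (intro exI[of _ "reversepath g"]) auto
qed

lemma conf_path_segment:
  assumes "0 \<notin> closed_segment x y"
  shows "\<exists>len. conf_path \<epsilon> x y len"
    and "(\<And>z. z \<in> closed_segment x y \<Longrightarrow> conf \<epsilon> z \<le> c) \<Longrightarrow> \<exists>len\<le>c * norm (y - x). conf_path \<epsilon> x y len"
proof -
  let ?f = "\<lambda>s. conf \<epsilon> (linepath x y s) * norm (y - x)"
  have on: "linepath x y s \<in> closed_segment x y" if "s \<in> {0..1}" for s
    using that linepath_image_01 by blast
  have "continuous_on {0..1} ?f"
    unfolding conf_def using assms on by (intro continuous_intros) (auto, metis)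
  then have int: "?f integrable_on {0..1}" by (rule integrable_continuous_real)
  then have path: "conf_path \<epsilon> x y (integral {0..1} ?f)"
    unfolding conf_path_def using assms integrable_integral[OF int]
    by (intro exI[of _ "linepath x y"]) (simp add: subset_eq, metis)
  then show "\<exists>len. conf_path \<epsilon> x y len" by blast
  assume c: "\<And>z. z \<in> closed_segment x y \<Longrightarrow> conf \<epsilon> z \<le> c"
  have "integral {0..1} ?f \<le> integral {0..1} (\<lambda>s::real. c * norm (y - x))"
    by (rule integral_le[OF int]) (auto intro!: mult_right_mono c on)
  then show "\<exists>len\<le>c * norm (y - x). conf_path \<epsilon> x y len" using path by auto
qed

lemma riem_dist_segment:
  assumes "0 \<notin> closed_segment x y" and "\<And>z. z \<in> closed_segment x y \<Longrightarrow> conf \<epsilon> z \<le> c"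
  shows "riem_dist punctured_R4 (g_eps \<epsilon>) x y \<le> c * norm (y - x)"
proof -
  obtain len where len: "len \<le> c * norm (y - x)" "conf_path \<epsilon> x y len"
    using conf_path_segment(2)[OF assms] by blast
  have "x \<noteq> 0" "y \<noteq> 0" using assms(1) by auto
  from riem_dist_le[OF len(2) this] len(1) show ?thesis by simp
qed

lemma exists_orthogonal_unit: "\<exists>w::real^4. norm w = 1 \<and> w \<bullet> x = 0 \<and> w \<bullet> y = 0"
proof -
  have "dim {x, y} \<le> card {x, y}" by (intro dim_le_card span_superset) simp
  also have "\<dots> \<le> 2" by (simp add: card_insert_if)
  finally have "dim {x, y} < DIM(real^4)" by simp
  then obtain w where w: "w \<noteq> 0" "\<And>z. z \<in> span {x, y} \<Longrightarrow> orthogonal w z"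
    using orthogonal_to_subspace_exists by blast
  then have "w \<bullet> x = 0" "w \<bullet> y = 0" by (simp_all add: orthogonal_def span_base)
  then show ?thesis using w(1) by (intro exI[of _ "sgn w"]) (simp add: norm_sgn sgn_div_norm)
qed

lemma segment_orthogonal_nonzero:
  assumes "a \<noteq> 0" and "b \<noteq> 0" and "a \<bullet> b = 0"
  shows "0 \<notin> closed_segment a (b::'a::real_inner)"
proof
  assume "0 \<in> closed_segment a b"
  then obtain u where u: "0 = (1 - u) *\<^sub>R a + u *\<^sub>R b" by (auto simp: in_segment)
  have "(1 - u) * (a \<bullet> a) = ((1 - u) *\<^sub>R a + u *\<^sub>R b) \<bullet> a" "u * (b \<bullet> b) = ((1 - u) *\<^sub>R a + u *\<^sub>R b) \<bullet> b"
    using assms(3) by (simp_all add: inner_add_left inner_commute[of b a])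
  then show False using assms(1,2) unfolding u[symmetric] by auto
qed

text \<open>The segment between the two points may contain the origin. In dimension four there is a point orthogonal to
  both of them, and the segments to that point avoid the origin.\<close>

lemma conf_path_exists:
  assumes "x \<noteq> 0" and "y \<noteq> 0"
  shows "\<exists>len. conf_path \<epsilon> x y len"
proof -
  obtain w :: "real^4" where w: "norm w = 1" "w \<bullet> x = 0" "w \<bullet> y = 0" using exists_orthogonal_unit by blast
  then have "w \<noteq> 0" by auto
  then have "0 \<notin> closed_segment x w" "0 \<notin> closed_segment w y"
    using assms w inner_commute[of x w] segment_orthogonal_nonzero[of x w] segment_orthogonal_nonzero[of w y] by auto
  then show ?thesis using conf_path_segment(1) conf_path_join by meson
qed

lemma riem_dist_lower:
  fixes H :: "real^4 \<Rightarrow> 'b::banach"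
  assumes "x \<noteq> 0" and "y \<noteq> 0"
    and "\<And>z. z \<noteq> 0 \<Longrightarrow> (H has_derivative H' z) (at z)"
    and "\<And>z v. z \<noteq> 0 \<Longrightarrow> norm (H' z v) \<le> conf \<epsilon> z * norm v"
  shows "norm (H y - H x) \<le> riem_dist punctured_R4 (g_eps \<epsilon>) x y"
  unfolding riem_dist_g_eps[OF assms(1,2)]
  using conf_path_exists[OF assms(1,2)] conf_path_lower[OF _ assms(3,4)]
  by (intro cInf_greatest) auto

lemma riem_dist_triangle:
  assumes "x \<noteq> 0" and "y \<noteq> 0" and "z \<noteq> 0"
  shows "riem_dist punctured_R4 (g_eps \<epsilon>) x z \<le>
    riem_dist punctured_R4 (g_eps \<epsilon>) x y + riem_dist punctured_R4 (g_eps \<epsilon>) y z"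
proof -
  let ?d = "riem_dist punctured_R4 (g_eps \<epsilon>)"
  have "?d x z - l1 \<le> l2" if "conf_path \<epsilon> x y l1" "conf_path \<epsilon> y z l2" for l1 l2
    using riem_dist_le[OF conf_path_join[OF that] assms(1,3)] by simp
  then have "?d x z - l1 \<le> ?d y z" if "conf_path \<epsilon> x y l1" for l1
    unfolding riem_dist_g_eps[OF assms(2,3)] using that conf_path_exists[OF assms(2,3)]
    by (intro cInf_greatest) auto
  then have "?d x z - ?d y z \<le> l1" if "conf_path \<epsilon> x y l1" for l1
    using that by (simp add: algebra_simps)
  then have "?d x z - ?d y z \<le> ?d x y"
    unfolding riem_dist_g_eps[OF assms(1,2)] using conf_path_exists[OF assms(1,2)]
    by (intro cInf_greatest) auto
  then show ?thesis by simp
qed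

lemma riem_dist_commute: "riem_dist punctured_R4 (g_eps \<epsilon>) x y = riem_dist punctured_R4 (g_eps \<epsilon>) y x"
proof (cases "x = 0 \<or> y = 0")
  case False
  have "{len. conf_path \<epsilon> x y len} = {len. conf_path \<epsilon> y x len}" using conf_path_reverse by blast
  then show ?thesis using False by (simp add: riem_dist_g_eps)
qed (auto simp: riem_dist_def)

text \<open>Distinct points have positive distance because \<open>g\<^sub>\<epsilon>\<close> is at least \<open>\<epsilon>\<^sup>4\<close> times the flat metric.\<close>

lemma Metric_space_g_eps:
  assumes "\<epsilon> > 0"
  shows "Metric_space punctured_R4 (riem_dist punctured_R4 (g_eps \<epsilon>))"
proof
  let ?d = "riem_dist punctured_R4 (g_eps \<epsilon>)"
  show nn: "0 \<le> ?d x y" for x y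
  proof (cases "x = 0 \<or> y = 0")
    case False
    then show ?thesis
      using conf_path_exists[of x y \<epsilon>]
      by (subst riem_dist_g_eps) (auto intro!: cInf_greatest intro: conf_path_nonneg)
  qed (auto simp: riem_dist_def)
  show "?d x y = ?d y x" for x y by (rule riem_dist_commute)
  fix x y :: "real^4" assume xy: "x \<in> punctured_R4" "y \<in> punctured_R4"
  have "norm (\<epsilon>\<^sup>2 *\<^sub>R y - \<epsilon>\<^sup>2 *\<^sub>R x) \<le> ?d x y"
  proof (rule riem_dist_lower)
    show "((\<lambda>x. \<epsilon>\<^sup>2 *\<^sub>R x) has_derivative (\<lambda>v. \<epsilon>\<^sup>2 *\<^sub>R v)) (at z)" for z :: "real^4"
      by (auto intro!: derivative_eq_intros)
    show "norm (\<epsilon>\<^sup>2 *\<^sub>R v) \<le> conf \<epsilon> z * norm v" for z v :: "real^4"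
      by (simp add: conf_def mult_right_mono)
  qed (use xy in auto)
  then have sep: "\<epsilon>\<^sup>2 * norm (y - x) \<le> ?d x y" by (simp flip: scaleR_diff_right)
  have "?d x x \<le> conf \<epsilon> x * norm (x - x)" using xy by (intro riem_dist_segment) auto
  then have "?d x x = 0" using nn[of x x] by simp
  moreover have "x = y" if "?d x y = 0"
  proof -
    have "\<epsilon>\<^sup>2 * norm (y - x) \<le> 0" using sep that by simp
    then show ?thesis using assms by (simp add: mult_le_0_iff)
  qed
  ultimately show "?d x y = 0 \<longleftrightarrow> x = y" by blast
next
  fix x y z :: "real^4" assume "x \<in> punctured_R4" "y \<in> punctured_R4" "z \<in> punctured_R4"
  then show "riem_dist punctured_R4 (g_eps \<epsilon>) x z \<le>
    riem_dist punctured_R4 (g_eps \<epsilon>) x y + riem_dist punctured_R4 (g_eps \<epsilon>) y z"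
    by (intro riem_dist_triangle) auto
qed

section \<open>The inversion isometry\<close>

text \<open>The isometry of \<open>g\<^sub>\<epsilon>\<close> that fixes the neck and exchanges the two ends, so that estimates are needed for one
  end only.\<close>

definition inversion :: "real \<Rightarrow> real^4 \<Rightarrow> real^4" where
  "inversion \<epsilon> x = (inverse (x \<bullet> x) / \<epsilon>\<^sup>2) *\<^sub>R x"

lemma has_derivative_inversion:
  assumes "x \<noteq> 0"
  shows "(inversion \<epsilon> has_derivative (\<lambda>v. (inverse (x \<bullet> x) / \<epsilon>\<^sup>2) *\<^sub>R (v - (2 * inverse (x \<bullet> x) * (x \<bullet> v)) *\<^sub>R x))) (at x)"
proof -
  have "((\<lambda>x. inverse (x \<bullet> x) *\<^sub>R x) has_derivative
     (\<lambda>v. inverse (x \<bullet> x) *\<^sub>R v + (- (inverse (x \<bullet> x) * (x \<bullet> v + v \<bullet> x) * inverse (x \<bullet> x))) *\<^sub>R x)) (at x)"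
    using assms by (auto intro!: derivative_eq_intros)
  from has_derivative_scaleR_right[OF this, of "inverse (\<epsilon>\<^sup>2)"] show ?thesis
    unfolding inversion_def[abs_def]
    by (auto elim!: has_derivative_eq_rhs simp: fun_eq_iff inner_commute divide_inverse algebra_simps)
qed

lemma norm_reflection:
  fixes x v :: "'a::real_inner"
  assumes "x \<noteq> 0"
  shows "norm (v - (2 * inverse (x \<bullet> x) * (x \<bullet> v)) *\<^sub>R x) = norm v"
proof -
  have "(v - (2 * inverse (x \<bullet> x) * (x \<bullet> v)) *\<^sub>R x) \<bullet> (v - (2 * inverse (x \<bullet> x) * (x \<bullet> v)) *\<^sub>R x) = v \<bullet> v"
    using assms by (simp add: inner_diff_left inner_diff_right inner_commute field_simps)
  then show ?thesis by (simp add: norm_eq_sqrt_inner)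
qed

lemma conf_inversion:
  assumes "x \<noteq> 0" and "\<epsilon> > 0"
  shows "conf \<epsilon> (inversion \<epsilon> x) * (inverse (x \<bullet> x) / \<epsilon>\<^sup>2) = conf \<epsilon> x"
  using assms by (simp add: conf_def inversion_def power_mult_distrib power2_norm_eq_inner[symmetric] power_divide field_simps)

lemma inversion_inversion:
  assumes "x \<noteq> 0" and "\<epsilon> > 0"
  shows "inversion \<epsilon> (inversion \<epsilon> x) = x" and "inversion \<epsilon> x \<noteq> 0"
  using assms by (simp_all add: inversion_def field_simps)

lemma conf_path_inversion:
  assumes p: "conf_path \<epsilon> x y len" and \<epsilon>: "\<epsilon> > 0"
  shows "conf_path \<epsilon> (inversion \<epsilon> x) (inversion \<epsilon> y) len"
proof -
  obtain \<gamma> where \<gamma>: "valid_path \<gamma>" "path_image \<gamma> \<subseteq> punctured_R4" "pathstart \<gamma> = x" "pathfinish \<gamma> = y"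
    "((\<lambda>s. conf \<epsilon> (\<gamma> s) * norm (vector_derivative \<gamma> (at s))) has_integral len) {0..1}"
    using p unfolding conf_path_def by blast
  obtain S D where S: "finite S" "continuous_on {0..1} \<gamma>" "continuous_on ({0..1} - S) D"
    "\<And>s. s \<in> {0..1} - S \<Longrightarrow> (\<gamma> has_vector_derivative D s) (at s)"
    "\<And>s. s \<in> {0..1} - S \<Longrightarrow> vector_derivative \<gamma> (at s) = D s"
    using valid_path_derivative[OF \<gamma>(1)] by metis
  have nz: "\<gamma> s \<noteq> 0" if "s \<in> {0..1}" for s
    using subsetD[OF \<gamma>(2), of "\<gamma> s"] that by (simp add: path_image_def)
  let ?I = "inversion \<epsilon> \<circ> \<gamma>"
  define E where "E s = (inverse (\<gamma> s \<bullet> \<gamma> s) / \<epsilon>\<^sup>2) *\<^sub>R (D s - (2 * inverse (\<gamma> s \<bullet> \<gamma> s) * (\<gamma> s \<bullet> D s)) *\<^sub>R \<gamma> s)" for s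
  have E: "(?I has_vector_derivative E s) (at s)" if s: "s \<in> {0..1} - S" for s
  proof -
    have "(\<gamma> has_derivative (\<lambda>h. h *\<^sub>R D s)) (at s)"
      using S(4)[OF s] by (simp add: has_vector_derivative_def)
    from has_derivative_compose[OF this has_derivative_inversion[OF nz]] s
    have "((\<lambda>s. inversion \<epsilon> (\<gamma> s)) has_derivative (\<lambda>h. (inverse (\<gamma> s \<bullet> \<gamma> s) / \<epsilon>\<^sup>2) *\<^sub>R
        (h *\<^sub>R D s - (2 * inverse (\<gamma> s \<bullet> \<gamma> s) * (\<gamma> s \<bullet> h *\<^sub>R D s)) *\<^sub>R \<gamma> s))) (at s)" by simp
    then show ?thesis
      unfolding has_vector_derivative_def E_def o_def
      by (rule has_derivative_eq_rhs) (simp add: fun_eq_iff algebra_simps)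
  qed
  have "continuous_on ({0..1} - S) \<gamma>" using S(2) continuous_on_subset by blast
  then have "continuous_on ({0..1} - S) E"
    unfolding E_def using nz \<epsilon> by (intro continuous_intros S(3)) auto
  moreover have "continuous_on {0..1} ?I"
    unfolding inversion_def o_def using nz \<epsilon> by (intro continuous_intros S(2)) auto
  ultimately have "valid_path ?I"
    unfolding valid_path_def piecewise_C1_differentiable_on_def C1_differentiable_on_def
    using E S(1) by blast
  moreover have "path_image ?I \<subseteq> punctured_R4"
    using inversion_inversion(2)[OF nz \<epsilon>] by (auto simp: path_image_def)
  moreover have "((\<lambda>s. conf \<epsilon> (?I s) * norm (vector_derivative ?I (at s))) has_integral len) {0..1}"
  proof (rule has_integral_spike_finite[OF S(1) _ \<gamma>(5)])
    fix s assume s: "s \<in> {0..1} - S"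
    have "conf \<epsilon> (?I s) * norm (E s) = conf \<epsilon> (\<gamma> s) * norm (D s)"
      using conf_inversion[OF nz \<epsilon>, of s, symmetric] norm_reflection[OF nz, of s "D s"] s
      by (simp add: E_def mult.assoc)
    then show "conf \<epsilon> (?I s) * norm (vector_derivative ?I (at s)) = conf \<epsilon> (\<gamma> s) * norm (vector_derivative \<gamma> (at s))"
      using S(5)[OF s] vector_derivative_at[OF E[OF s]] by simp
  qed
  ultimately show ?thesis
    unfolding conf_path_def using \<gamma>(3,4)
    by (intro exI[of _ ?I]) (simp add: pathstart_def pathfinish_def)
qed

lemma riem_dist_inversion:
  assumes "x \<noteq> 0" and "y \<noteq> 0" and "\<epsilon> > 0"
  shows "riem_dist punctured_R4 (g_eps \<epsilon>) (inversion \<epsilon> x) (inversion \<epsilon> y) = riem_dist punctured_R4 (g_eps \<epsilon>) x y"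
proof -
  have "conf_path \<epsilon> (inversion \<epsilon> x) (inversion \<epsilon> y) len \<longleftrightarrow> conf_path \<epsilon> x y len" for len
    using conf_path_inversion[of \<epsilon> x y len] conf_path_inversion[of \<epsilon> "inversion \<epsilon> x" "inversion \<epsilon> y" len]
      inversion_inversion[OF assms(1,3)] inversion_inversion[OF assms(2,3)] assms(3) by metis
  then show ?thesis
    using assms inversion_inversion(2) by (simp add: riem_dist_g_eps)
qed

section \<open>Comparison with the one-point union\<close>

text \<open>The primitive of the conformal factor \<open>\<epsilon>\<^sup>2 + t\<^sup>-\<^sup>2\<close> that vanishes on the neck \<open>t = 1/\<epsilon>\<close>, hence the signed
  distance from the neck.\<close>

definition radial :: "real \<Rightarrow> real \<Rightarrow> real" where
  "radial \<epsilon> t = \<epsilon>\<^sup>2 * t - inverse t"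

text \<open>The point with polar coordinates \<open>(radial \<epsilon> t, x / t)\<close>.\<close>

definition unroll :: "real \<Rightarrow> real^4 \<Rightarrow> real^4" where
  "unroll \<epsilon> x = (\<epsilon>\<^sup>2 - inverse (x \<bullet> x)) *\<^sub>R x"

abbreviation eps_dist :: "real \<Rightarrow> real^4 \<Rightarrow> real^4 \<Rightarrow> real" where
  "eps_dist \<epsilon> \<equiv> riem_dist punctured_R4 (g_eps \<epsilon>)"

lemma norm_unroll: "x \<noteq> 0 \<Longrightarrow> norm (unroll \<epsilon> x) = \<bar>radial \<epsilon> (norm x)\<bar>"
proof -
  assume "x \<noteq> 0"
  then have "radial \<epsilon> (norm x) = (\<epsilon>\<^sup>2 - inverse (x \<bullet> x)) * norm x"
    by (simp add: radial_def power2_norm_eq_inner[symmetric] power2_eq_square field_simps)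
  then show ?thesis by (simp add: unroll_def abs_mult)
qed

text \<open>The differential stretches radial directions by exactly the conformal factor \<open>\<epsilon>\<^sup>2 + n\<close>, where \<open>n = t\<^sup>-\<^sup>2\<close>, and
  tangential ones only by \<open>|\<epsilon>\<^sup>2 - n|\<close>.\<close>

lemma unroll_lower:
  assumes "x \<noteq> 0" and "y \<noteq> 0"
  shows "norm (unroll \<epsilon> x - unroll \<epsilon> y) \<le> eps_dist \<epsilon> x y"
proof -
  have "norm (unroll \<epsilon> y - unroll \<epsilon> x) \<le> eps_dist \<epsilon> x y"
  proof (rule riem_dist_lower[OF assms])
    fix z v :: "real^4" assume z: "z \<noteq> 0"
    show "(unroll \<epsilon> has_derivative
        (\<lambda>v. (\<epsilon>\<^sup>2 - inverse (z \<bullet> z)) *\<^sub>R v + (2 * (inverse (z \<bullet> z))\<^sup>2 * (z \<bullet> v)) *\<^sub>R z)) (at z)"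
    proof -
      have "((\<lambda>x. (\<epsilon>\<^sup>2 - inverse (x \<bullet> x)) *\<^sub>R x) has_derivative
         (\<lambda>v. (\<epsilon>\<^sup>2 - inverse (z \<bullet> z)) *\<^sub>R v + (0 - - (inverse (z \<bullet> z) * (z \<bullet> v + v \<bullet> z) * inverse (z \<bullet> z))) *\<^sub>R z)) (at z)"
        using z by (auto intro!: derivative_eq_intros)
      then show ?thesis
        unfolding unroll_def[abs_def]
        by (auto elim!: has_derivative_eq_rhs simp: fun_eq_iff inner_commute power2_eq_square algebra_simps)
    qed
    define N where "N = z \<bullet> z"
    define n where "n = inverse N"
    have N: "N > 0" "n > 0" "n * N = 1" using z by (simp_all add: N_def n_def)
    let ?w = "(\<epsilon>\<^sup>2 - n) *\<^sub>R v + (2 * n\<^sup>2 * (z \<bullet> v)) *\<^sub>R z"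
    have "(z \<bullet> v)\<^sup>2 \<le> N * (v \<bullet> v)" unfolding N_def by (rule Cauchy_Schwarz_ineq)
    then have "n * (z \<bullet> v)\<^sup>2 \<le> n * (N * (v \<bullet> v))" using N by (intro mult_left_mono) auto
    also have "\<dots> = v \<bullet> v" using N by (simp add: mult.assoc[symmetric])
    finally have cs: "n * (z \<bullet> v)\<^sup>2 \<le> v \<bullet> v" .
    have "?w \<bullet> ?w = (\<epsilon>\<^sup>2 - n)\<^sup>2 * (v \<bullet> v) + 4 * (\<epsilon>\<^sup>2 - n) * n\<^sup>2 * (z \<bullet> v)\<^sup>2 + 4 * n ^ 3 * (n * N) * (z \<bullet> v)\<^sup>2"
      by (simp add: inner_add_left inner_add_right inner_commute N_def[symmetric] power2_eq_square power3_eq_cube algebra_simps)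
    also have "\<dots> = (\<epsilon>\<^sup>2 - n)\<^sup>2 * (v \<bullet> v) + 4 * n * \<epsilon>\<^sup>2 * (n * (z \<bullet> v)\<^sup>2)"
      unfolding N(3) by (simp add: power2_eq_square power3_eq_cube algebra_simps)
    also have "\<dots> \<le> (\<epsilon>\<^sup>2 - n)\<^sup>2 * (v \<bullet> v) + 4 * n * \<epsilon>\<^sup>2 * (v \<bullet> v)"
      using cs N by (intro add_left_mono mult_left_mono) auto
    also have "\<dots> = ((\<epsilon>\<^sup>2 + n) * norm v)\<^sup>2"
      by (simp add: power_mult_distrib power2_norm_eq_inner) (simp add: power2_eq_square algebra_simps)
    finally have "(norm ?w)\<^sup>2 \<le> ((\<epsilon>\<^sup>2 + n) * norm v)\<^sup>2" by (simp add: power2_norm_eq_inner)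
    then have "norm ?w \<le> (\<epsilon>\<^sup>2 + n) * norm v"
      by (rule power2_le_imp_le) (use N in auto)
    then show "norm ((\<epsilon>\<^sup>2 - inverse (z \<bullet> z)) *\<^sub>R v + (2 * (inverse (z \<bullet> z))\<^sup>2 * (z \<bullet> v)) *\<^sub>R z) \<le> conf \<epsilon> z * norm v"
      by (simp add: conf_def n_def N_def power2_norm_eq_inner)
  qed
  then show ?thesis by (simp add: norm_minus_commute)
qed

lemma radial_lower:
  assumes "x \<noteq> 0" and "y \<noteq> 0"
  shows "\<bar>radial \<epsilon> (norm x) - radial \<epsilon> (norm y)\<bar> \<le> eps_dist \<epsilon> x y"
proof -
  have "norm (radial \<epsilon> (norm y) - radial \<epsilon> (norm x)) \<le> eps_dist \<epsilon> x y"
  proof (rule riem_dist_lower[OF assms])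
    fix z v :: "real^4" assume z: "z \<noteq> 0"
    show "((\<lambda>x. radial \<epsilon> (norm x)) has_derivative (\<lambda>v. conf \<epsilon> z * (v \<bullet> sgn z))) (at z)"
      unfolding radial_def using z has_derivative_norm[OF z]
      by (auto intro!: derivative_eq_intros simp: fun_eq_iff conf_def power2_eq_square algebra_simps)
    have "\<bar>v \<bullet> sgn z\<bar> \<le> norm v"
      using Cauchy_Schwarz_ineq2[of v "sgn z"] z by (simp add: norm_sgn)
    then show "norm (conf \<epsilon> z * (v \<bullet> sgn z)) \<le> conf \<epsilon> z * norm v"
      by (simp add: abs_mult conf_nonneg mult_left_mono)
  qed
  then show ?thesis by (simp add: abs_minus_commute)
qed

lemma radial_upper:
  assumes x: "x \<noteq> 0" and c: "c \<ge> 1"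
  shows "eps_dist \<epsilon> x (c *\<^sub>R x) \<le> radial \<epsilon> (c * norm x) - radial \<epsilon> (norm x)"
proof -
  let ?\<gamma> = "linepath x (c *\<^sub>R x)"
  define \<tau> where "\<tau> s = (1 + s * (c - 1)) * norm x" for s
  have \<gamma>: "?\<gamma> s = (1 + s * (c - 1)) *\<^sub>R x" for s
    by (simp add: linepath_def algebra_simps)
  have pos: "1 + s * (c - 1) > 0" if "0 \<le> s" for s using that c by (simp add: add_pos_nonneg)
  have \<tau>: "\<tau> s > 0" "norm (?\<gamma> s) = \<tau> s" if "0 \<le> s" for s
    using pos[OF that] x by (simp_all add: \<tau>_def \<gamma>)
  have nc: "norm (c *\<^sub>R x - x) = (c - 1) * norm x"
    using c by (simp flip: scaleR_left_diff_distrib[of c 1, simplified])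
  have "((\<lambda>s. conf \<epsilon> (?\<gamma> s) * norm (c *\<^sub>R x - x)) has_integral (radial \<epsilon> (\<tau> 1) - radial \<epsilon> (\<tau> 0))) {0..1}"
  proof (rule fundamental_theorem_of_calculus)
    fix s :: real assume s: "s \<in> {0..1}"
    have "((\<lambda>s. radial \<epsilon> (\<tau> s)) has_field_derivative (\<epsilon>\<^sup>2 + inverse (\<tau> s) * inverse (\<tau> s)) * ((c - 1) * norm x)) (at s within {0..1})"
    proof -
      have "(\<tau> has_field_derivative (c - 1) * norm x) (at s within {0..1})"
        unfolding \<tau>_def by (auto intro!: derivative_eq_intros)
      then show ?thesis
        unfolding radial_def using \<tau>(1)[of s] s
        by (auto intro!: derivative_eq_intros simp: algebra_simps)
    qed
    then show "((\<lambda>s. radial \<epsilon> (\<tau> s)) has_vector_derivative conf \<epsilon> (?\<gamma> s) * norm (c *\<^sub>R x - x)) (at s within {0..1})"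
      using \<tau>(2)[of s] s unfolding nc
      by (simp add: has_real_derivative_iff_has_vector_derivative conf_def power2_eq_square)
  qed simp
  moreover have "path_image ?\<gamma> \<subseteq> punctured_R4"
    using \<tau> by (auto simp: path_image_def simp del: linepath_image_01) (metis less_irrefl norm_zero)
  ultimately have "conf_path \<epsilon> x (c *\<^sub>R x) (radial \<epsilon> (\<tau> 1) - radial \<epsilon> (\<tau> 0))"
    unfolding conf_path_def by (intro exI[of _ ?\<gamma>]) simp
  from riem_dist_le[OF this x] show ?thesis using x c by (simp add: \<tau>_def)
qed

lemma segment_far_from_origin:
  fixes x w :: "'a::real_inner"
  assumes "norm x = r" and "norm w = r" and "x \<bullet> w = 0" and z: "z \<in> closed_segment x w"
  shows "r\<^sup>2 / 2 \<le> z \<bullet> z"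
proof -
  obtain u where u: "z = (1 - u) *\<^sub>R x + u *\<^sub>R w" using z by (auto simp: in_segment)
  have "z \<bullet> z = ((1 - u)\<^sup>2 + u\<^sup>2) * r\<^sup>2"
  proof -
    have "x \<bullet> x = r\<^sup>2" "w \<bullet> w = r\<^sup>2" using assms(1,2) by (simp_all flip: power2_norm_eq_inner)
    then have "(p *\<^sub>R x + u *\<^sub>R w) \<bullet> (p *\<^sub>R x + u *\<^sub>R w) = (p\<^sup>2 + u\<^sup>2) * r\<^sup>2" for p
      using assms(3) by (simp add: inner_add_left inner_add_right inner_commute[of w x] power2_eq_square algebra_simps)
    then show ?thesis unfolding u by simp
  qed
  moreover have "1 / 2 \<le> (1 - u)\<^sup>2 + u\<^sup>2"
    using zero_le_power2[of "2 * u - 1"] by (simp add: power2_eq_square algebra_simps)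
  then have "1 / 2 * r\<^sup>2 \<le> ((1 - u)\<^sup>2 + u\<^sup>2) * r\<^sup>2" by (intro mult_right_mono) auto
  ultimately show ?thesis by simp
qed

text \<open>Passing through a point orthogonal to both, the path keeps at distance at least \<open>1/(\<epsilon>\<surd>2)\<close> from the origin,
  where the conformal factor is at most \<open>3\<epsilon>\<^sup>2\<close>, and it consists of two segments of Euclidean length at most \<open>2/\<epsilon>\<close>.\<close>

lemma neck_diameter:
  assumes \<epsilon>: "\<epsilon> > 0" and x: "norm x = 1 / \<epsilon>" and y: "norm y = 1 / \<epsilon>"
  shows "eps_dist \<epsilon> x y \<le> 12 * \<epsilon>"
proof -
  have half: "eps_dist \<epsilon> a b \<le> 6 * \<epsilon>" if "norm a = 1 / \<epsilon>" "norm b = 1 / \<epsilon>" "a \<bullet> b = 0" for a b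
  proof -
    have far: "1 / (2 * \<epsilon>\<^sup>2) \<le> (norm z)\<^sup>2" if "z \<in> closed_segment a b" for z
      using segment_far_from_origin[OF \<open>norm a = 1 / \<epsilon>\<close> \<open>norm b = 1 / \<epsilon>\<close> \<open>a \<bullet> b = 0\<close> that] \<epsilon>
      by (simp add: power2_norm_eq_inner power_divide)
    have "eps_dist \<epsilon> a b \<le> (3 * \<epsilon>\<^sup>2) * norm (b - a)"
    proof (rule riem_dist_segment)
      show "0 \<notin> closed_segment a b" using far[of 0] \<epsilon> by auto
      fix z assume z: "z \<in> closed_segment a b"
      have "inverse ((norm z)\<^sup>2) \<le> inverse (1 / (2 * \<epsilon>\<^sup>2))"
        using far[OF z] \<epsilon> by (intro le_imp_inverse_le) auto
      then show "conf \<epsilon> z \<le> 3 * \<epsilon>\<^sup>2" by (simp add: conf_def)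
    qed
    also have "\<dots> \<le> (3 * \<epsilon>\<^sup>2) * (1 / \<epsilon> + 1 / \<epsilon>)"
      using norm_triangle_ineq4[of b a] that by (intro mult_left_mono) auto
    finally show ?thesis using \<epsilon> by (simp add: power2_eq_square)
  qed
  obtain w :: "real^4" where w: "norm w = 1" "w \<bullet> x = 0" "w \<bullet> y = 0" using exists_orthogonal_unit by blast
  let ?w = "(1 / \<epsilon>) *\<^sub>R w"
  have "eps_dist \<epsilon> x y \<le> eps_dist \<epsilon> x ?w + eps_dist \<epsilon> ?w y"
    using x y w(1) \<epsilon> by (intro riem_dist_triangle) auto
  also have "\<dots> \<le> 6 * \<epsilon> + 6 * \<epsilon>"
    using x y w \<epsilon> by (intro add_mono half) (auto simp: inner_commute)
  finally show ?thesis by simp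
qed

lemma radial_neck: "\<epsilon> > 0 \<Longrightarrow> radial \<epsilon> (1 / \<epsilon>) = 0"
  by (simp add: radial_def power2_eq_square)

lemma dist_to_neck:
  assumes \<epsilon>: "\<epsilon> > 0" and x: "x \<noteq> 0"
  shows "\<exists>q. norm q = 1 / \<epsilon> \<and> eps_dist \<epsilon> x q \<le> norm (unroll \<epsilon> x)"
proof (cases "norm x \<ge> 1 / \<epsilon>")
  case True
  define q where "q = (1 / (\<epsilon> * norm x)) *\<^sub>R x"
  have q: "norm q = 1 / \<epsilon>" using \<epsilon> x by (simp add: q_def)
  have e: "x = (\<epsilon> * norm x) *\<^sub>R q" using \<epsilon> x by (simp add: q_def)
  have c: "\<epsilon> * norm x \<ge> 1" using True \<epsilon> by (simp add: field_simps)
  have "eps_dist \<epsilon> q ((\<epsilon> * norm x) *\<^sub>R q) \<le> radial \<epsilon> (\<epsilon> * norm x * norm q) - radial \<epsilon> (norm q)"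
    using \<epsilon> q by (intro radial_upper c) auto
  then have "eps_dist \<epsilon> x q \<le> radial \<epsilon> (norm x)"
    unfolding e[symmetric] using \<epsilon> by (simp add: q radial_neck riem_dist_commute)
  then show ?thesis using q norm_unroll[OF x, of \<epsilon>] by (intro exI[of _ q]) auto
next
  case False
  define c where "c = 1 / (\<epsilon> * norm x)"
  have c: "c \<ge> 1" using False \<epsilon> x by (simp add: c_def field_simps)
  have q: "norm (c *\<^sub>R x) = 1 / \<epsilon>" using \<epsilon> x by (simp add: c_def)
  have "eps_dist \<epsilon> x (c *\<^sub>R x) \<le> radial \<epsilon> (c * norm x) - radial \<epsilon> (norm x)"
    by (rule radial_upper[OF x c])
  then have "eps_dist \<epsilon> x (c *\<^sub>R x) \<le> - radial \<epsilon> (norm x)"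
    using q \<epsilon> c radial_neck[OF \<epsilon>] by simp
  then show ?thesis using q norm_unroll[OF x, of \<epsilon>] by (intro exI[of _ "c *\<^sub>R x"]) auto
qed

lemma dist_via_neck:
  assumes \<epsilon>: "\<epsilon> > 0" and x: "x \<noteq> 0" and y: "y \<noteq> 0"
  shows "eps_dist \<epsilon> x y \<le> norm (unroll \<epsilon> x) + norm (unroll \<epsilon> y) + 12 * \<epsilon>"
proof -
  obtain a where a: "norm a = 1 / \<epsilon>" "eps_dist \<epsilon> x a \<le> norm (unroll \<epsilon> x)" using dist_to_neck[OF \<epsilon> x] by blast
  obtain b where b: "norm b = 1 / \<epsilon>" "eps_dist \<epsilon> y b \<le> norm (unroll \<epsilon> y)" using dist_to_neck[OF \<epsilon> y] by blast
  have nz: "a \<noteq> 0" "b \<noteq> 0" using a(1) b(1) \<epsilon> by auto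
  have "eps_dist \<epsilon> x y \<le> eps_dist \<epsilon> x a + eps_dist \<epsilon> a y" by (rule riem_dist_triangle[OF x nz(1) y])
  also have "eps_dist \<epsilon> a y \<le> eps_dist \<epsilon> a b + eps_dist \<epsilon> b y" by (rule riem_dist_triangle[OF nz y])
  finally show ?thesis
    using a(2) b(2) neck_diameter[OF \<epsilon> a(1) b(1)] riem_dist_commute[of \<epsilon> b y] by simp
qed

text \<open>In the coordinate \<open>\<epsilon>\<^sup>2x\<close>, lengths are at most \<open>1 + \<epsilon>\<^sup>2/\<rho>\<^sup>2\<close> times the flat ones outside the ball of radius
  \<open>\<rho>\<close>. If the segment from \<open>x\<close> to \<open>y\<close> enters that ball, its length is within \<open>2\<rho>\<close> of the sum of the distances
  of its ends from the origin, and the path through the neck is nearly as short.\<close>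

lemma outer_upper:
  assumes \<epsilon>: "\<epsilon> > 0" and \<rho>: "\<rho> > 0" and x: "norm x \<ge> 1 / \<epsilon>" and y: "norm y \<ge> 1 / \<epsilon>"
    and r: "norm (unroll \<epsilon> x) \<le> r" "norm (unroll \<epsilon> y) \<le> r"
  shows "eps_dist \<epsilon> x y \<le> norm (unroll \<epsilon> x - unroll \<epsilon> y) + 2 * \<rho> + 14 * \<epsilon> + (\<epsilon>\<^sup>2 / \<rho>\<^sup>2) * (2 * r + 2 * \<epsilon>)"
proof -
  have pos: "1 / \<epsilon> > 0" using \<epsilon> by simp
  have nz: "x \<noteq> 0" "y \<noteq> 0" using x y pos by auto
  have near: "norm (unroll \<epsilon> z - \<epsilon>\<^sup>2 *\<^sub>R z) \<le> \<epsilon>" if "norm z \<ge> 1 / \<epsilon>" for z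
  proof -
    have z: "norm z > 0" using that pos by linarith
    have "unroll \<epsilon> z - \<epsilon>\<^sup>2 *\<^sub>R z = - (inverse (z \<bullet> z) *\<^sub>R z)"
      by (simp add: unroll_def algebra_simps)
    then have "norm (unroll \<epsilon> z - \<epsilon>\<^sup>2 *\<^sub>R z) = inverse (norm z)"
      using z by (simp add: power2_norm_eq_inner[symmetric] power2_eq_square)
    also have "\<dots> \<le> inverse (1 / \<epsilon>)" using that pos by (rule le_imp_inverse_le)
    finally show ?thesis by simp
  qed
  have diff: "norm (\<epsilon>\<^sup>2 *\<^sub>R x - \<epsilon>\<^sup>2 *\<^sub>R y) \<le> norm (unroll \<epsilon> x - unroll \<epsilon> y) + 2 * \<epsilon>"
  proof -
    have tri: "norm (a - b + c) \<le> norm a + norm b + norm c" for a b c :: "real^4"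
      using norm_triangle_ineq[of "a - b" c] norm_triangle_ineq4[of a b] by linarith
    have eq: "(unroll \<epsilon> x - unroll \<epsilon> y) - (unroll \<epsilon> x - \<epsilon>\<^sup>2 *\<^sub>R x) + (unroll \<epsilon> y - \<epsilon>\<^sup>2 *\<^sub>R y) =
        \<epsilon>\<^sup>2 *\<^sub>R x - \<epsilon>\<^sup>2 *\<^sub>R y" by simp
    have "norm (\<epsilon>\<^sup>2 *\<^sub>R x - \<epsilon>\<^sup>2 *\<^sub>R y) \<le> norm (unroll \<epsilon> x - unroll \<epsilon> y) + norm (unroll \<epsilon> x - \<epsilon>\<^sup>2 *\<^sub>R x)
        + norm (unroll \<epsilon> y - \<epsilon>\<^sup>2 *\<^sub>R y)"
      using tri[of "unroll \<epsilon> x - unroll \<epsilon> y" "unroll \<epsilon> x - \<epsilon>\<^sup>2 *\<^sub>R x" "unroll \<epsilon> y - \<epsilon>\<^sup>2 *\<^sub>R y"]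
      unfolding eq .
    then show ?thesis using near[OF x] near[OF y] by simp
  qed
  show ?thesis
  proof (cases "\<forall>z\<in>closed_segment x y. \<rho> / \<epsilon>\<^sup>2 \<le> norm z")
    case True
    have "eps_dist \<epsilon> x y \<le> (\<epsilon>\<^sup>2 + \<epsilon>^4 / \<rho>\<^sup>2) * norm (y - x)"
    proof (rule riem_dist_segment)
      show "0 \<notin> closed_segment x y" using True \<epsilon> \<rho> by (auto simp: divide_le_0_iff dest!: bspec[of _ _ 0])
      fix z assume "z \<in> closed_segment x y"
      then have "(\<rho> / \<epsilon>\<^sup>2)\<^sup>2 \<le> (norm z)\<^sup>2" using True \<epsilon> \<rho> by (intro power_mono) auto
      then have "inverse ((norm z)\<^sup>2) \<le> inverse ((\<rho> / \<epsilon>\<^sup>2)\<^sup>2)" using \<epsilon> \<rho> by (intro le_imp_inverse_le) auto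
      also have "\<dots> = \<epsilon>^4 / \<rho>\<^sup>2" by (simp add: power_divide flip: power_mult)
      finally show "conf \<epsilon> z \<le> \<epsilon>\<^sup>2 + \<epsilon>^4 / \<rho>\<^sup>2" by (simp add: conf_def)
    qed
    also have "\<dots> = (1 + \<epsilon>\<^sup>2 / \<rho>\<^sup>2) * norm (\<epsilon>\<^sup>2 *\<^sub>R x - \<epsilon>\<^sup>2 *\<^sub>R y)"
    proof -
      have "norm (\<epsilon>\<^sup>2 *\<^sub>R x - \<epsilon>\<^sup>2 *\<^sub>R y) = \<epsilon>\<^sup>2 * norm (y - x)"
        by (simp add: norm_minus_commute flip: scaleR_diff_right)
      then show ?thesis by (simp add: algebra_simps power2_eq_square power4_eq_xxxx)
    qed
    also have "\<dots> \<le> norm (unroll \<epsilon> x - unroll \<epsilon> y) + 2 * \<epsilon> + (\<epsilon>\<^sup>2 / \<rho>\<^sup>2) * (2 * r + 2 * \<epsilon>)"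
    proof -
      have "norm (unroll \<epsilon> x - unroll \<epsilon> y) \<le> 2 * r" using norm_triangle_ineq4[of "unroll \<epsilon> x" "unroll \<epsilon> y"] r by simp
      then have "norm (\<epsilon>\<^sup>2 *\<^sub>R x - \<epsilon>\<^sup>2 *\<^sub>R y) \<le> 2 * r + 2 * \<epsilon>" using diff by simp
      then have "(\<epsilon>\<^sup>2 / \<rho>\<^sup>2) * norm (\<epsilon>\<^sup>2 *\<^sub>R x - \<epsilon>\<^sup>2 *\<^sub>R y) \<le> (\<epsilon>\<^sup>2 / \<rho>\<^sup>2) * (2 * r + 2 * \<epsilon>)"
        by (intro mult_left_mono) auto
      then show ?thesis using diff by (simp only: distrib_right mult_1)
    qed
    finally show ?thesis using \<epsilon> \<rho> by simp
  next
    case False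
    then obtain z where z: "z \<in> closed_segment x y" "norm z < \<rho> / \<epsilon>\<^sup>2" by force
    have "dist x y = dist x z + dist z y" using z(1) between_mem_segment between by metis
    then have "norm (x - y) = norm (x - z) + norm (y - z)" by (simp add: dist_norm norm_minus_commute)
    then have "norm (x - y) \<ge> norm x + norm y - 2 * norm z"
      using norm_triangle_ineq2[of x z] norm_triangle_ineq2[of y z] by simp
    then have "\<epsilon>\<^sup>2 * (norm x + norm y - 2 * norm z) \<le> \<epsilon>\<^sup>2 * norm (x - y)"
      by (intro mult_left_mono) auto
    moreover have "\<epsilon>\<^sup>2 * norm z \<le> \<rho>" using z(2) \<epsilon> by (simp add: field_simps)
    moreover have "norm (\<epsilon>\<^sup>2 *\<^sub>R x - \<epsilon>\<^sup>2 *\<^sub>R y) = \<epsilon>\<^sup>2 * norm (x - y)" by (simp flip: scaleR_diff_right)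
    moreover have un: "norm (unroll \<epsilon> v) \<le> \<epsilon>\<^sup>2 * norm v" if "norm v \<ge> 1 / \<epsilon>" for v
    proof -
      have v: "norm v > 0" using that pos by linarith
      have "inverse (norm v) \<le> inverse (1 / \<epsilon>)" using that pos by (rule le_imp_inverse_le)
      moreover have "\<epsilon>\<^sup>2 * (1 / \<epsilon>) \<le> \<epsilon>\<^sup>2 * norm v" using that by (intro mult_left_mono) auto
      moreover have "\<epsilon>\<^sup>2 * (1 / \<epsilon>) = inverse (1 / \<epsilon>)" using \<epsilon> by (simp add: power2_eq_square)
      ultimately have "radial \<epsilon> (norm v) \<ge> 0" unfolding radial_def by linarith
      then show ?thesis using v norm_unroll[of v \<epsilon>] by (simp add: radial_def)
    qed
    ultimately have "norm (unroll \<epsilon> x) + norm (unroll \<epsilon> y) \<le> norm (unroll \<epsilon> x - unroll \<epsilon> y) + 2 * \<epsilon> + 2 * \<rho>"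
      using diff un[OF x] un[OF y] by (simp add: algebra_simps)
    then have "eps_dist \<epsilon> x y \<le> norm (unroll \<epsilon> x - unroll \<epsilon> y) + 2 * \<rho> + 14 * \<epsilon>"
      using dist_via_neck[OF \<epsilon> nz] by simp
    moreover have "0 \<le> (\<epsilon>\<^sup>2 / \<rho>\<^sup>2) * (2 * r + 2 * \<epsilon>)"
    proof -
      have "r \<ge> 0" using r(1) norm_ge_zero order_trans by blast
      then show ?thesis using \<epsilon> by simp
    qed
    ultimately show ?thesis by simp
  qed
qed

text \<open>On the inner side \<open>unroll\<close> reverses the direction of \<open>x\<close>; the sign undoes this, so that the map agrees in the limit
  with the coordinate \<open>x / t\<^sup>2\<close>.\<close>

definition wedge_map :: "real \<Rightarrow> real^4 \<Rightarrow> (real^4) \<times> (real^4)" where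
  "wedge_map \<epsilon> x = (if 1 / \<epsilon> \<le> norm x then (unroll \<epsilon> x, 0) else (0, - unroll \<epsilon> x))"

lemma wedge_map_in: "wedge_map \<epsilon> x \<in> wedge_R4"
  by (simp add: wedge_map_def wedge_R4_def)

lemma norm_wedge_map: "wedge_R4_dist (0, 0) (wedge_map \<epsilon> x) = norm (unroll \<epsilon> x)"
  by (simp add: wedge_map_def wedge_R4_dist_def)

lemma radial_sign:
  assumes "\<epsilon> > 0" and "t > 0"
  shows "1 / \<epsilon> \<le> t \<Longrightarrow> radial \<epsilon> t \<ge> 0" and "t \<le> 1 / \<epsilon> \<Longrightarrow> radial \<epsilon> t \<le> 0"
proof -
  have e: "radial \<epsilon> t = (\<epsilon> * t - 1) * ((\<epsilon> * t + 1) / t)"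
    using assms by (simp add: radial_def field_simps power2_eq_square)
  have p: "(\<epsilon> * t + 1) / t > 0" using assms by (simp add: add_pos_pos)
  show "1 / \<epsilon> \<le> t \<Longrightarrow> radial \<epsilon> t \<ge> 0" unfolding e using p assms by (intro mult_nonneg_nonneg) (auto simp: field_simps)
  show "t \<le> 1 / \<epsilon> \<Longrightarrow> radial \<epsilon> t \<le> 0" unfolding e using p assms by (intro mult_nonpos_nonneg) (auto simp: field_simps)
qed

text \<open>On one side this is \<open>unroll_lower\<close>. Between the two sides the distances from the neck add up, and \<open>radial\<close>
  changes sign.\<close>

lemma wedge_map_lower:
  assumes \<epsilon>: "\<epsilon> > 0" and "x \<noteq> 0" and "y \<noteq> 0"
  shows "wedge_R4_dist (wedge_map \<epsilon> x) (wedge_map \<epsilon> y) \<le> eps_dist \<epsilon> x y"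
proof -
  have opp: "norm (unroll \<epsilon> a) + norm (unroll \<epsilon> b) \<le> eps_dist \<epsilon> a b"
    if "1 / \<epsilon> \<le> norm a" "norm b < 1 / \<epsilon>" "a \<noteq> 0" "b \<noteq> 0" for a b
    using radial_lower[OF that(3,4), of \<epsilon>] radial_sign(1)[OF \<epsilon>, of "norm a"] radial_sign(2)[OF \<epsilon>, of "norm b"]
      norm_unroll[OF that(3), of \<epsilon>] norm_unroll[OF that(4), of \<epsilon>] that by simp
  show ?thesis
    using unroll_lower[OF assms(2,3), of \<epsilon>] opp[of x y] opp[of y x] assms(2,3)
    by (auto simp: wedge_map_def wedge_R4_dist_def dist_norm norm_minus_commute riem_dist_commute[of \<epsilon> y x] add.commute)
qed

lemma inversion_unroll:
  assumes "x \<noteq> 0" and "\<epsilon> > 0"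
  shows "unroll \<epsilon> (inversion \<epsilon> x) = - unroll \<epsilon> x" and "norm (inversion \<epsilon> x) = 1 / (\<epsilon>\<^sup>2 * norm x)"
proof -
  show n: "norm (inversion \<epsilon> x) = 1 / (\<epsilon>\<^sup>2 * norm x)"
    using assms by (simp add: inversion_def power2_norm_eq_inner[symmetric] power2_eq_square field_simps)
  have "inversion \<epsilon> x \<bullet> inversion \<epsilon> x = 1 / (\<epsilon>^4 * (x \<bullet> x))"
    using assms by (simp add: inversion_def power2_eq_square power4_eq_xxxx field_simps)
  then show "unroll \<epsilon> (inversion \<epsilon> x) = - unroll \<epsilon> x"
    using assms by (simp add: unroll_def inversion_def vec_eq_iff field_simps power2_eq_square power4_eq_xxxx)
qed

text \<open>Two points on the inner side are moved to the outer side by the inversion.\<close>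

lemma wedge_map_upper:
  assumes \<epsilon>: "\<epsilon> > 0" and \<rho>: "\<rho> > 0" and nz: "x \<noteq> 0" "y \<noteq> 0"
    and r: "norm (unroll \<epsilon> x) \<le> r" "norm (unroll \<epsilon> y) \<le> r"
  shows "eps_dist \<epsilon> x y \<le> wedge_R4_dist (wedge_map \<epsilon> x) (wedge_map \<epsilon> y)
    + 2 * \<rho> + 14 * \<epsilon> + (\<epsilon>\<^sup>2 / \<rho>\<^sup>2) * (2 * r + 2 * \<epsilon>)"
proof -
  have "r \<ge> 0" using r(1) norm_ge_zero order_trans by blast
  then have err: "0 \<le> (\<epsilon>\<^sup>2 / \<rho>\<^sup>2) * (2 * r + 2 * \<epsilon>)" using \<epsilon> by simp
  consider "1 / \<epsilon> \<le> norm x" "1 / \<epsilon> \<le> norm y" | "norm x < 1 / \<epsilon>" "norm y < 1 / \<epsilon>"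
    | "(1 / \<epsilon> \<le> norm x) \<noteq> (1 / \<epsilon> \<le> norm y)" by linarith
  then show ?thesis
  proof cases
    case 1
    then show ?thesis using outer_upper[OF \<epsilon> \<rho> 1 r] by (simp add: wedge_map_def wedge_R4_dist_def dist_norm)
  next
    case 2
    have out: "1 / \<epsilon> \<le> norm (inversion \<epsilon> z)" if "norm z < 1 / \<epsilon>" "z \<noteq> 0" for z
      unfolding inversion_unroll(2)[OF that(2) \<epsilon>] using that \<epsilon> by (simp add: field_simps power2_eq_square)
    note u = inversion_unroll(1)[OF nz(1) \<epsilon>] inversion_unroll(1)[OF nz(2) \<epsilon>]
    have "eps_dist \<epsilon> x y \<le> norm (unroll \<epsilon> x - unroll \<epsilon> y) + 2 * \<rho> + 14 * \<epsilon> + (\<epsilon>\<^sup>2 / \<rho>\<^sup>2) * (2 * r + 2 * \<epsilon>)"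
      using outer_upper[OF \<epsilon> \<rho> out[OF 2(1) nz(1)] out[OF 2(2) nz(2)], of r] r
      unfolding riem_dist_inversion[OF nz \<epsilon>] u by (simp add: norm_minus_commute)
    then show ?thesis using 2 by (simp add: wedge_map_def wedge_R4_dist_def dist_norm norm_minus_commute)
  next
    case 3
    then have "wedge_R4_dist (wedge_map \<epsilon> x) (wedge_map \<epsilon> y) = norm (unroll \<epsilon> x) + norm (unroll \<epsilon> y)"
      by (auto simp: wedge_map_def wedge_R4_dist_def)
    then show ?thesis using dist_via_neck[OF \<epsilon> nz] err \<epsilon> \<rho> by simp
  qed
qed

text \<open>For a vector of length \<open>s\<close> the radius \<open>t\<close> is the positive root of \<open>\<epsilon>\<^sup>2t\<^sup>2 - st - 1 = 0\<close>.\<close>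

lemma wedge_map_onto:
  assumes \<epsilon>: "\<epsilon> > 0" and b: "b \<in> wedge_R4"
  shows "\<exists>x. x \<noteq> 0 \<and> wedge_map \<epsilon> x = b"
proof -
  have out: "\<exists>x. 1 / \<epsilon> \<le> norm x \<and> unroll \<epsilon> x = a \<and> (a \<noteq> 0 \<longrightarrow> 1 / \<epsilon> < norm x)" for a :: "real^4"
  proof (cases "a = 0")
    case True
    have "norm ((1 / \<epsilon>) *\<^sub>R axis 1 1 :: real^4) = 1 / \<epsilon>" using \<epsilon> by simp
    moreover have "unroll \<epsilon> ((1 / \<epsilon>) *\<^sub>R axis 1 1) = 0" using \<epsilon> by (simp add: unroll_def inner_axis power2_eq_square)
    ultimately show ?thesis using True by (metis order_refl)
  next
    case False
    define s where "s = norm a"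
    have s: "s > 0" using False by (simp add: s_def)
    define q where "q = sqrt (s\<^sup>2 + 4 * \<epsilon>\<^sup>2)"
    have q: "q\<^sup>2 = s\<^sup>2 + 4 * \<epsilon>\<^sup>2" by (simp add: q_def)
    have "2 * \<epsilon> = sqrt ((2 * \<epsilon>)\<^sup>2)" by (rule real_sqrt_unique[symmetric]) (use \<epsilon> in auto)
    also have "\<dots> \<le> q" unfolding q_def by (intro real_sqrt_le_mono) (simp add: power_mult_distrib)
    finally have q2: "2 * \<epsilon> \<le> q" .
    define t where "t = (s + q) / (2 * \<epsilon>\<^sup>2)"
    have t: "t > 1 / \<epsilon>" using s q2 \<epsilon> by (simp add: t_def field_simps power2_eq_square)
    then have t0: "t > 0" using \<epsilon> by (meson less_trans zero_less_divide_1_iff)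
    have "\<epsilon>\<^sup>2 * t * t - 1 = s * t"
    proof -
      have "(s + q)\<^sup>2 - 4 * \<epsilon>\<^sup>2 = 2 * s * (s + q)" using q by (simp add: power2_eq_square algebra_simps)
      then show ?thesis using \<epsilon> by (simp add: t_def field_simps power2_eq_square)
    qed
    then have rad: "(\<epsilon>\<^sup>2 - inverse (t * t)) * t = s" using t0 by (simp add: field_simps)
    have "norm (t *\<^sub>R sgn a) = t" using t0 False by (simp add: norm_sgn)
    moreover have "unroll \<epsilon> (t *\<^sub>R sgn a) = a"
    proof -
      have "sgn a \<bullet> sgn a = 1" using False by (simp add: norm_sgn flip: norm_eq_1)
      then have "unroll \<epsilon> (t *\<^sub>R sgn a) = ((\<epsilon>\<^sup>2 - inverse (t * t)) * t) *\<^sub>R sgn a" by (simp add: unroll_def)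
      also have "\<dots> = a" unfolding rad s_def using False by (simp add: sgn_div_norm)
      finally show ?thesis .
    qed
    ultimately show ?thesis using t by (metis less_imp_le)
  qed
  have pos: "1 / \<epsilon> > 0" using \<epsilon> by simp
  from b consider a where "b = (a, 0)" | a where "b = (0, a)" "a \<noteq> 0"
    unfolding wedge_R4_def by fastforce
  then show ?thesis
  proof cases
    case 1
    obtain x where "1 / \<epsilon> \<le> norm x" "unroll \<epsilon> x = a" using out by blast
    then show ?thesis using 1 pos by (intro exI[of _ x]) (auto simp: wedge_map_def)
  next
    case 2
    obtain x where x: "1 / \<epsilon> < norm x" "unroll \<epsilon> x = a" using out[of a] 2(2) by blast
    have nz: "x \<noteq> 0" using x(1) pos by auto
    have "norm (inversion \<epsilon> x) < 1 / \<epsilon>"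
      unfolding inversion_unroll(2)[OF nz \<epsilon>] using x(1) \<epsilon> by (simp add: field_simps power2_eq_square)
    then show ?thesis
      using inversion_inversion(2)[OF nz \<epsilon>] inversion_unroll(1)[OF nz \<epsilon>] x(2) 2
      by (intro exI[of _ "inversion \<epsilon> x"]) (simp add: wedge_map_def)
  qed
qed

text \<open>The distortion is controlled with \<open>\<rho> = \<delta>/4\<close>. As the map is onto, density only requires that preimages lie in the
  \<open>r\<close>-ball about the base point, which holds once \<open>12\<epsilon> < \<delta>\<close>.\<close>

lemma GH_approx_wedge_map:
  assumes r: "r > 0" and \<delta>: "\<delta> > 0" and p: "\<And>\<epsilon>. 0 < \<epsilon> \<Longrightarrow> norm (p \<epsilon>) = 1 / \<epsilon>"
  shows "\<forall>\<^sub>F \<epsilon> in at_right 0. GH_approx r \<delta> punctured_R4 (eps_dist \<epsilon>) (p \<epsilon>) wedge_R4 wedge_R4_dist (0, 0) (wedge_map \<epsilon>)"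
proof -
  let ?err = "\<lambda>\<epsilon>. 14 * \<epsilon> + (\<epsilon>\<^sup>2 / (\<delta> / 4)\<^sup>2) * (2 * r + 2 * \<epsilon>)"
  have "((\<lambda>\<epsilon>. ?err \<epsilon>) \<longlongrightarrow> 14 * 0 + (0\<^sup>2 / (\<delta> / 4)\<^sup>2) * (2 * r + 2 * 0)) (at_right 0)"
    using \<delta> by (intro tendsto_intros) auto
  then have "\<forall>\<^sub>F \<epsilon> in at_right 0. ?err \<epsilon> < \<delta> / 2" using \<delta> by (intro order_tendstoD(2)) auto
  moreover have "\<forall>\<^sub>F \<epsilon> in at_right 0. (0::real) < \<epsilon>" by (rule eventually_at_right_less)
  ultimately show ?thesis
  proof eventually_elim
    case (elim \<epsilon>)
    then have \<epsilon>: "\<epsilon> > 0" by simp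
    have err: "2 * (\<delta> / 4) + ?err \<epsilon> < \<delta>" using elim(1) by linarith
    have pz: "p \<epsilon> \<noteq> 0" using p[OF \<epsilon>] \<epsilon> by auto
    have up: "norm (unroll \<epsilon> (p \<epsilon>)) = 0"
      using norm_unroll[OF pz, of \<epsilon>] p[OF \<epsilon>] radial_neck[OF \<epsilon>] by simp
    have near: "norm (unroll \<epsilon> x) \<le> eps_dist \<epsilon> (p \<epsilon>) x" if "x \<noteq> 0" for x
      using unroll_lower[OF pz that, of \<epsilon>] up by simp
    have dist_base: "eps_dist \<epsilon> (p \<epsilon>) x \<le> norm (unroll \<epsilon> x) + 12 * \<epsilon>" if "x \<noteq> 0" for x
      using dist_via_neck[OF \<epsilon> pz that] up by simp
    have small: "12 * \<epsilon> < \<delta>"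
    proof -
      have "0 \<le> (\<epsilon>\<^sup>2 / (\<delta> / 4)\<^sup>2) * (2 * r + 2 * \<epsilon>)" using r \<epsilon> by simp
      then show ?thesis using err \<epsilon> \<delta> by linarith
    qed
    show ?case
      unfolding GH_approx_def
    proof (intro conjI ballI impI)
      show "wedge_map \<epsilon> (p \<epsilon>) = (0, 0)" using p[OF \<epsilon>] up by (simp add: wedge_map_def)
      fix x assume "x \<in> punctured_R4" "eps_dist \<epsilon> (p \<epsilon>) x < r"
      show "wedge_map \<epsilon> x \<in> wedge_R4" by (rule wedge_map_in)
    next
      fix x y assume "x \<in> punctured_R4" "y \<in> punctured_R4"
        and r': "eps_dist \<epsilon> (p \<epsilon>) x < r \<and> eps_dist \<epsilon> (p \<epsilon>) y < r"
      then have nz: "x \<noteq> 0" "y \<noteq> 0" by auto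
      have "norm (unroll \<epsilon> x) \<le> r" "norm (unroll \<epsilon> y) \<le> r" using near[OF nz(1)] near[OF nz(2)] r' by auto
      from wedge_map_upper[OF \<epsilon> _ nz this, of "\<delta> / 4"] wedge_map_lower[OF \<epsilon> nz]
      show "\<bar>wedge_R4_dist (wedge_map \<epsilon> x) (wedge_map \<epsilon> y) - eps_dist \<epsilon> x y\<bar> < \<delta>"
        using err \<delta> by linarith
    next
      fix b assume b: "b \<in> wedge_R4" "wedge_R4_dist (0, 0) b < r - \<delta>"
      obtain x where x: "x \<noteq> 0" "wedge_map \<epsilon> x = b" using wedge_map_onto[OF \<epsilon> b(1)] by blast
      have "norm (unroll \<epsilon> x) < r - \<delta>" using b(2) norm_wedge_map[of \<epsilon> x] x(2) by simp
      then have "eps_dist \<epsilon> (p \<epsilon>) x < r" using dist_base[OF x(1)] small by simp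
      then show "\<exists>x\<in>punctured_R4. eps_dist \<epsilon> (p \<epsilon>) x < r \<and> wedge_R4_dist (wedge_map \<epsilon> x) b < \<delta>"
        using x \<delta> by (intro bexI[of _ x]) (auto simp: wedge_R4_dist_def)
    qed
  qed
qed

lemma Metric_space_wedge: "Metric_space wedge_R4 wedge_R4_dist"
proof
  fix x y z :: "(real^4) \<times> (real^4)"
  show "0 \<le> wedge_R4_dist x y" by (simp add: wedge_R4_dist_def)
  show "wedge_R4_dist x y = wedge_R4_dist y x" by (simp add: wedge_R4_dist_def dist_commute)
  show "wedge_R4_dist x y = 0 \<longleftrightarrow> x = y" by (simp add: wedge_R4_dist_def add_nonneg_eq_0_iff prod_eq_iff)
  show "wedge_R4_dist x z \<le> wedge_R4_dist x y + wedge_R4_dist y z"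
    using dist_triangle[of "fst x" "fst z" "fst y"] dist_triangle[of "snd x" "snd z" "snd y"]
    by (simp add: wedge_R4_dist_def)
qed

lemma pointed_GH_wedge:
  assumes p: "\<And>\<epsilon>. 0 < \<epsilon> \<Longrightarrow> norm (p \<epsilon>) = 1 / \<epsilon>"
  shows "pointed_GH_tendsto (\<lambda>_. punctured_R4) eps_dist p wedge_R4 wedge_R4_dist (0, 0) (at_right 0)"
  unfolding pointed_GH_tendsto_def
proof (intro conjI allI impI)
  show "\<forall>\<^sub>F \<epsilon> in at_right 0. Metric_space punctured_R4 (eps_dist \<epsilon>) \<and> p \<epsilon> \<in> punctured_R4"
  proof (rule eventually_mono[OF eventually_at_right_less[of 0]])
    fix \<epsilon> :: real assume \<epsilon>: "0 < \<epsilon>"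
    then have "norm (p \<epsilon>) \<noteq> 0" using p by simp
    then show "Metric_space punctured_R4 (eps_dist \<epsilon>) \<and> p \<epsilon> \<in> punctured_R4"
      using Metric_space_g_eps[OF \<epsilon>] by simp
  qed
  show "Metric_space wedge_R4 wedge_R4_dist" by (rule Metric_space_wedge)
  show "(0, 0) \<in> wedge_R4" by (simp add: wedge_R4_def)
  fix r \<delta> :: real assume "0 < r" "0 < \<delta>"
  then have "\<forall>\<^sub>F \<epsilon> in at_right 0.
      GH_approx r \<delta> punctured_R4 (eps_dist \<epsilon>) (p \<epsilon>) wedge_R4 wedge_R4_dist (0, 0) (wedge_map \<epsilon>)"
    by (rule GH_approx_wedge_map) (rule p)
  then show "\<forall>\<^sub>F \<epsilon> in at_right 0. \<exists>f. GH_approx r \<delta> punctured_R4 (eps_dist \<epsilon>) (p \<epsilon>) wedge_R4 wedge_R4_dist (0, 0) f"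
    by (rule eventually_mono) (rule exI)
qed

lemma wedge_map_charts:
  assumes y: "y \<noteq> 0"
  shows "((\<lambda>\<epsilon>. wedge_map \<epsilon> (chart_infty \<epsilon> y)) \<longlongrightarrow> (y, 0)) (at_right 0)"
    and "((\<lambda>\<epsilon>. wedge_map \<epsilon> (chart_zero y)) \<longlongrightarrow> (0, y)) (at_right 0)"
proof -
  have lim: "((\<lambda>\<epsilon>. (1 - \<epsilon>\<^sup>2 * inverse (y \<bullet> y)) *\<^sub>R y) \<longlongrightarrow> y) (at_right 0)"
    by (auto intro!: tendsto_eq_intros)
  have ev: "\<forall>\<^sub>F \<epsilon> in at_right 0. 0 < \<epsilon> \<and> \<epsilon> < norm y"
    using y by (intro eventually_conj eventually_at_right_less eventually_at_rightI[of 0 "norm y"]) auto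
  show "((\<lambda>\<epsilon>. wedge_map \<epsilon> (chart_infty \<epsilon> y)) \<longlongrightarrow> (y, 0)) (at_right 0)"
  proof (rule Lim_transform_eventually[OF tendsto_Pair[OF lim tendsto_const]], rule eventually_mono[OF ev])
    fix \<epsilon> :: real assume \<epsilon>: "0 < \<epsilon> \<and> \<epsilon> < norm y"
    have "1 / \<epsilon> \<le> norm (chart_infty \<epsilon> y)" using \<epsilon> by (simp add: chart_infty_def field_simps power2_eq_square)
    moreover have "unroll \<epsilon> (chart_infty \<epsilon> y) = (1 - \<epsilon>\<^sup>2 * inverse (y \<bullet> y)) *\<^sub>R y"
    proof -
      have "(\<epsilon>\<^sup>2 - inverse ((1 / \<epsilon>\<^sup>2) * ((1 / \<epsilon>\<^sup>2) * (y \<bullet> y)))) * (1 / \<epsilon>\<^sup>2) = 1 - \<epsilon>\<^sup>2 * inverse (y \<bullet> y)"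
        using \<epsilon> y by (simp add: field_simps)
      then show ?thesis by (simp only: unroll_def chart_infty_def inner_scaleR_left inner_scaleR_right scaleR_scaleR)
    qed
    ultimately show "((1 - \<epsilon>\<^sup>2 * inverse (y \<bullet> y)) *\<^sub>R y, 0) = wedge_map \<epsilon> (chart_infty \<epsilon> y)"
      by (simp add: wedge_map_def)
  qed
  show "((\<lambda>\<epsilon>. wedge_map \<epsilon> (chart_zero y)) \<longlongrightarrow> (0, y)) (at_right 0)"
  proof (rule Lim_transform_eventually[OF tendsto_Pair[OF tendsto_const lim]], rule eventually_mono[OF ev])
    fix \<epsilon> :: real assume \<epsilon>: "0 < \<epsilon> \<and> \<epsilon> < norm y"
    have n: "norm (chart_zero y) = 1 / norm y" using y by (simp add: chart_zero_def power2_eq_square)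
    then have "norm (chart_zero y) < 1 / \<epsilon>" using \<epsilon> by (simp add: frac_less2)
    moreover have "chart_zero y \<bullet> chart_zero y = inverse (y \<bullet> y)"
      unfolding power2_norm_eq_inner[symmetric] n by (simp add: power_divide inverse_eq_divide)
    then have "- unroll \<epsilon> (chart_zero y) = (1 - \<epsilon>\<^sup>2 * inverse (y \<bullet> y)) *\<^sub>R y"
      using y by (simp add: unroll_def chart_zero_def power2_norm_eq_inner algebra_simps inverse_eq_divide)
    ultimately show "(0, (1 - \<epsilon>\<^sup>2 * inverse (y \<bullet> y)) *\<^sub>R y) = wedge_map \<epsilon> (chart_zero y)"
      by (simp add: wedge_map_def)
  qed
qed

section \<open>The one-point union as a limit\<close>

lemma closed_form2_on_cong:
  assumes "open U" and eq: "\<And>x. x \<in> U \<Longrightarrow> \<omega> x = \<omega>' x" and "closed_form2_on U \<omega>'"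
  shows "closed_form2_on U \<omega>"
proof -
  have "smooth_fun_on U (\<lambda>x. \<omega> x $ i $ j) \<longleftrightarrow> smooth_fun_on U (\<lambda>x. \<omega>' x $ i $ j)" for i j
    by (rule smooth_fun_on_cong[OF assms(1)]) (simp add: eq)
  moreover have "pd i (\<lambda>y. \<omega> y $ j $ k) x = pd i (\<lambda>y. \<omega>' y $ j $ k) x" if "x \<in> U" for i j k x
    by (rule differentiable_cong_open(2)[OF assms(1) that]) (simp add: eq)
  then have "ext_d2 \<omega> x = ext_d2 \<omega>' x" if "x \<in> U" for x
    using that by (simp add: ext_d2_def)
  ultimately show ?thesis
    using assms(3) eq by (simp add: closed_form2_on_def smooth2_on_def)
qed

text \<open>Self-dual forms at \<open>x\<close> are the combinations of \<open>sd_frame\<close>, and these are stable under the linear combination that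
  defines \<open>\<omega>\<close>.\<close>

lemma sd_form_frame:
  assumes x: "x \<noteq> 0" and tang: "\<eta> (sgn x) \<bullet> sgn x = 0"
  shows "\<exists>c. sd_form \<eta> x = (\<Sum>m\<in>UNIV. c m *\<^sub>R sd_frame (sgn x) m)"
proof -
  let ?u = "sgn x"
  define c where "c m = \<eta> ?u \<bullet> coframe m ?u" for m
  have eta: "\<eta> ?u = (\<Sum>m\<in>UNIV. c m *\<^sub>R coframe m ?u)"
    using coframe_expansion[OF _ tang] x by (simp add: c_def norm_sgn)
  have "wedge ?u (\<Sum>m\<in>UNIV. c m *\<^sub>R coframe m ?u) = (\<Sum>m\<in>UNIV. c m *\<^sub>R wedge ?u (coframe m ?u))"
    by (simp add: wedge_def vec_eq_iff sum_3 algebra_simps)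
  then have "cone_form 1 \<eta> ?u = (\<Sum>m\<in>UNIV. c m *\<^sub>R sd_frame ?u m)"
    unfolding cone_form_def sphere_star1_def c_def[symmetric] eta[symmetric]
    by (simp add: sd_frame_def scaleR_add_right sum.distrib)
  then have "sd_form \<eta> x = (\<Sum>m\<in>UNIV. (c m / sqrt 2) *\<^sub>R sd_frame ?u m)"
    unfolding sd_form_eq_cone_form[of x \<eta>, OF assms] by (simp add: scaleR_sum_right)
  then show ?thesis by (rule exI[of _ "\<lambda>m. c m / sqrt 2"])
qed

lemma omega_eps_self_dual:
  assumes "x \<noteq> 0" and "\<eta>p (sgn x) \<bullet> sgn x = 0" and "\<eta>m (sgn x) \<bullet> sgn x = 0"
  shows "self_dual x (omega_eps \<alpha> \<beta> \<eta>p \<eta>m \<epsilon> x)"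
proof -
  obtain c where c: "sd_form \<eta>p x = (\<Sum>m\<in>UNIV. c m *\<^sub>R sd_frame (sgn x) m)"
    using sd_form_frame[of x \<eta>p, OF assms(1,2)] by blast
  obtain d where d: "sd_form \<eta>m x = (\<Sum>m\<in>UNIV. d m *\<^sub>R sd_frame (sgn x) m)"
    using sd_form_frame[of x \<eta>m, OF assms(1,3)] by blast
  have "omega_eps \<alpha> \<beta> \<eta>p \<eta>m \<epsilon> x =
      (\<Sum>m\<in>UNIV. (\<alpha> * \<epsilon>^4 * c m + \<beta> / norm x ^ 4 * d m) *\<^sub>R sd_frame (sgn x) m)"
    by (simp add: omega_eps_def c d scaleR_sum_right scaleR_add_left sum.distrib)
  then show ?thesis unfolding self_dual_iff[OF assms(1)]
    by (rule exI[of _ "\<lambda>m. \<alpha> * \<epsilon>^4 * c m + \<beta> / norm x ^ 4 * d m"])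
qed

theorem proposition3p9:
  fixes \<alpha> \<beta> :: real
    and \<eta>p \<eta>m :: "real^4 \<Rightarrow> real^4"
    and p :: "real \<Rightarrow> real^4"
  assumes form_p: "sphere_form1 \<eta>p" and div_p: "sphere_div_free \<eta>p"
    and eigen_p: "\<And>x. x \<in> sphere 0 1 \<Longrightarrow> sphere_star_d \<eta>p x = 2 *\<^sub>R \<eta>p x"
    and unit_p: "\<And>x. x \<in> sphere 0 1 \<Longrightarrow> norm (\<eta>p x) = 1"
    and form_m: "sphere_form1 \<eta>m" and div_m: "sphere_div_free \<eta>m"
    and eigen_m: "\<And>x. x \<in> sphere 0 1 \<Longrightarrow> sphere_star_d \<eta>m x = (-2) *\<^sub>R \<eta>m x"
    and unit_m: "\<And>x. x \<in> sphere 0 1 \<Longrightarrow> norm (\<eta>m x) = 1"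
    and base_point: "\<And>\<epsilon>. 0 < \<epsilon> \<Longrightarrow> norm (p \<epsilon>) = 1 / \<epsilon>"
  shows
    \<comment> \<open>\<open>\<omega>\<close> is a closed self-dual form\<close>
    "(\<forall>\<epsilon>>0. closed_form2_on punctured_R4 (omega_eps \<alpha> \<beta> \<eta>p \<eta>m \<epsilon>) \<and>
            (\<forall>x\<in>punctured_R4. self_dual x (omega_eps \<alpha> \<beta> \<eta>p \<eta>m \<epsilon> x)))
     \<and>
     pointed_GH_tendsto (\<lambda>_. punctured_R4) (\<lambda>\<epsilon>. riem_dist punctured_R4 (g_eps \<epsilon>)) p
       wedge_R4 wedge_R4_dist (0, 0) (at_right 0)
     \<and>
     \<comment> \<open>it is realised by maps compatible with the coordinates used on the two copies below\<close>
     (\<exists>f. (\<forall>r>0. \<forall>\<delta>>0. \<forall>\<^sub>F \<epsilon> in at_right 0.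
             GH_approx r \<delta> punctured_R4 (riem_dist punctured_R4 (g_eps \<epsilon>)) (p \<epsilon>)
               wedge_R4 wedge_R4_dist (0, 0) (f \<epsilon>)) \<and>
          (\<forall>y\<in>punctured_R4.
             ((\<lambda>\<epsilon>. f \<epsilon> (chart_infty \<epsilon> y)) \<longlongrightarrow> (y, 0)) (at_right 0) \<and>
             ((\<lambda>\<epsilon>. f \<epsilon> (chart_zero y)) \<longlongrightarrow> (0, y)) (at_right 0)))
     \<and>
     \<comment> \<open>smooth convergence of the metrics away from the join point\<close>
     smooth2_tendsto punctured_R4 (\<lambda>\<epsilon>. pullback2 (chart_infty \<epsilon>) (g_eps \<epsilon>)) flat_metric (at_right 0)
     \<and>
     smooth2_tendsto punctured_R4 (\<lambda>\<epsilon>. pullback2 chart_zero (g_eps \<epsilon>)) flat_metric (at_right 0)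
     \<and>
     \<comment> \<open>the limits of \<open>\<omega>\<close> on the copies from \<open>t \<rightarrow> \<infinity>\<close> and \<open>t \<rightarrow> 0\<close>\<close>
     (\<exists>\<Omega>. parallel_on UNIV flat_metric \<Omega> \<and>
          (\<forall>y. alternating (\<Omega> y) \<and> form2_norm (flat_metric y) (\<Omega> y) = \<bar>\<alpha>\<bar>) \<and>
          smooth2_tendsto punctured_R4
            (\<lambda>\<epsilon>. pullback2 (chart_infty \<epsilon>) (omega_eps \<alpha> \<beta> \<eta>p \<eta>m \<epsilon>)) \<Omega> (at_right 0))
     \<and>
     (\<exists>\<Omega>. parallel_on UNIV flat_metric \<Omega> \<and>
          (\<forall>y. alternating (\<Omega> y) \<and> form2_norm (flat_metric y) (\<Omega> y) = \<bar>\<beta>\<bar>) \<and>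
          smooth2_tendsto punctured_R4
            (\<lambda>\<epsilon>. pullback2 chart_zero (omega_eps \<alpha> \<beta> \<eta>p \<eta>m \<epsilon>)) \<Omega> (at_right 0))
     \<and>
     \<comment> \<open>the \<open>L\<^sup>2\<close> norm of \<open>|\<nabla>\<omega>|\<close> is finite and decreases to 0\<close>
     (\<forall>\<epsilon>>0. integrable (riem_volume punctured_R4 (g_eps \<epsilon>))
              (\<lambda>x. (grad_norm_eps \<alpha> \<beta> \<eta>p \<eta>m \<epsilon> x)\<^sup>2))
     \<and>
     mono_on {0<..} (\<lambda>\<epsilon>. L2_norm (riem_volume punctured_R4 (g_eps \<epsilon>)) (grad_norm_eps \<alpha> \<beta> \<eta>p \<eta>m \<epsilon>))
     \<and>
     ((\<lambda>\<epsilon>. L2_norm (riem_volume punctured_R4 (g_eps \<epsilon>)) (grad_norm_eps \<alpha> \<beta> \<eta>p \<eta>m \<epsilon>)) \<longlongrightarrow> 0)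
       (at_right 0)
     \<and>
     \<comment> \<open>the supremum of \<open>|\<nabla>\<omega>|\<close> is finite and increases to infinity, unless \<open>\<omega>\<close> vanishes identically\<close>
     (\<forall>\<epsilon>>0. bdd_above (grad_norm_eps \<alpha> \<beta> \<eta>p \<eta>m \<epsilon> ` punctured_R4))
     \<and>
     ((\<alpha>, \<beta>) \<noteq> (0, 0) \<longrightarrow>
        strict_mono_on {0<..}
          (\<lambda>\<epsilon>. L2_norm (riem_volume punctured_R4 (g_eps \<epsilon>)) (grad_norm_eps \<alpha> \<beta> \<eta>p \<eta>m \<epsilon>)) \<and>
        strict_antimono_on {0<..} (\<lambda>\<epsilon>. SUP x\<in>punctured_R4. grad_norm_eps \<alpha> \<beta> \<eta>p \<eta>m \<epsilon> x) \<and>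
        filterlim (\<lambda>\<epsilon>. SUP x\<in>punctured_R4. grad_norm_eps \<alpha> \<beta> \<eta>p \<eta>m \<epsilon> x) at_top (at_right 0))"
proof -
  obtain A where A: "dual_form 1 A" "len_sq A = 1" "\<And>x. x \<noteq> 0 \<Longrightarrow> sd_form \<eta>p x = A"
    using sd_form_plus[OF form_p eigen_p unit_p] by blast
  obtain B where B: "dual_form (-1) B" "len_sq B = 1"
    "\<And>x. x \<noteq> 0 \<Longrightarrow> sd_form \<eta>m x = reflect x B"
    "\<And>x. x \<noteq> 0 \<Longrightarrow> dual_form 1 (reflect x B)" "\<And>x. x \<noteq> 0 \<Longrightarrow> len_sq (reflect x B) = 1"
    using sd_form_minus[OF form_m eigen_m unit_m] by blast
  have alt: "alternating A" "alternating B" using A(1) B(1) by (simp_all add: dual_form_def)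
  let ?\<omega> = "omega_eps \<alpha> \<beta> \<eta>p \<eta>m" and ?M = "model_form \<alpha> A \<beta> B"
  have \<omega>: "?\<omega> \<epsilon> x = ?M \<epsilon> x" if "x \<noteq> 0" for \<epsilon> x
    using that by (simp add: omega_eps_def model_form_def inverted_def A(3) B(3))
  have tang: "\<eta>p u \<bullet> u = 0" "\<eta>m u \<bullet> u = 0" if "norm u = 1" for u
    using form_p form_m that by (auto simp: sphere_form1_def)
  have closed: "closed_form2_on punctured_R4 (?\<omega> \<epsilon>)" for \<epsilon>
    by (rule closed_form2_on_cong[OF open_punctured _ model_form_closed[OF alt]]) (simp add: \<omega>)
  have sd: "self_dual x (?\<omega> \<epsilon> x)" if "x \<noteq> 0" for \<epsilon> x
    using that tang by (intro omega_eps_self_dual) (simp_all add: norm_sgn)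
  have pull: "pullback2 f (?\<omega> \<epsilon>) y = pullback2 f (?M \<epsilon>) y" if "f y \<noteq> 0" for f \<epsilon> y
    using \<omega>[OF that] by (simp add: pullback2_def)
  have infty: "smooth2_tendsto punctured_R4 (\<lambda>\<epsilon>. pullback2 (chart_infty \<epsilon>) (?\<omega> \<epsilon>)) (\<lambda>_. \<alpha> *\<^sub>R A) (at_right 0)"
  proof (rule smooth2_tendsto_form)
    fix \<epsilon> :: real and y :: "real^4" assume "\<epsilon> > 0" "y \<noteq> 0"
    then show "pullback2 (chart_infty \<epsilon>) (?\<omega> \<epsilon>) y = \<alpha> *\<^sub>R A + (\<beta> * \<epsilon>^4) *\<^sub>R inverted B y"
      by (subst pull) (simp_all add: chart_infty_def[of \<epsilon> y] pullback2_model_infty)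
  qed
  have zero: "smooth2_tendsto punctured_R4 (\<lambda>\<epsilon>. pullback2 chart_zero (?\<omega> \<epsilon>)) (\<lambda>_. \<beta> *\<^sub>R B) (at_right 0)"
  proof (rule smooth2_tendsto_form)
    fix \<epsilon> :: real and y :: "real^4" assume "\<epsilon> > 0" "y \<noteq> 0"
    then show "pullback2 chart_zero (?\<omega> \<epsilon>) y = \<beta> *\<^sub>R B + (\<alpha> * \<epsilon>^4) *\<^sub>R inverted A y"
      by (subst pull) (simp_all add: chart_zero_def[of y] pullback2_model_zero alt)
  qed
  have limit: "parallel_on UNIV flat_metric (\<lambda>_. c *\<^sub>R w) \<and>
      (\<forall>y::real^4. alternating (c *\<^sub>R w) \<and> form2_norm (flat_metric y) (c *\<^sub>R w) = \<bar>c\<bar>)"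
    if "dual_form s w" "len_sq w = 1" for c s w
    using dual_form_scale[OF that(1), of c] that(2)
    by (simp add: parallel_const form2_norm_flat len_sq_scale dual_form_def)
  have h: "grad_norm_eps \<alpha> \<beta> \<eta>p \<eta>m \<epsilon> x = form2_deriv_norm (g_eps \<epsilon> x) (cov_deriv2 (g_eps \<epsilon>) (?M \<epsilon>) x)"
    if "x \<noteq> 0" for \<epsilon> x
    unfolding grad_norm_eps_def
    by (rule arg_cong[where f = "form2_deriv_norm _"], rule cov_deriv2_cong[OF open_punctured])
      (use that \<omega> in simp_all)
  interpret scaled_profile "grad_norm_eps \<alpha> \<beta> \<eta>p \<eta>m" "profile \<alpha> A \<beta> B" "48 * (\<alpha>\<^sup>2 + \<beta>\<^sup>2)"
    by (rule profile_scaled[OF A(1) alt(2) B(4) h A(2) B(5)])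
  have pos: "energy_norm > 0 \<and> profile_sup > 0" if "(\<alpha>, \<beta>) \<noteq> (0, 0)"
    using profile_positive[of \<alpha> \<beta> A B] that A(2) B(5) positive_profile by blast
  show ?thesis
  proof (intro conjI allI impI ballI)
    show "\<exists>f. (\<forall>r>0. \<forall>\<delta>>0. \<forall>\<^sub>F \<epsilon> in at_right 0.
             GH_approx r \<delta> punctured_R4 (riem_dist punctured_R4 (g_eps \<epsilon>)) (p \<epsilon>)
               wedge_R4 wedge_R4_dist (0, 0) (f \<epsilon>)) \<and>
          (\<forall>y\<in>punctured_R4.
             ((\<lambda>\<epsilon>. f \<epsilon> (chart_infty \<epsilon> y)) \<longlongrightarrow> (y, 0)) (at_right 0) \<and>
             ((\<lambda>\<epsilon>. f \<epsilon> (chart_zero y)) \<longlongrightarrow> (0, y)) (at_right 0))"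
      using GH_approx_wedge_map[OF _ _ base_point] wedge_map_charts
      by (intro exI[of _ wedge_map]) simp
    show "\<exists>\<Omega>. parallel_on UNIV flat_metric \<Omega> \<and>
          (\<forall>y. alternating (\<Omega> y) \<and> form2_norm (flat_metric y) (\<Omega> y) = \<bar>\<alpha>\<bar>) \<and>
          smooth2_tendsto punctured_R4
            (\<lambda>\<epsilon>. pullback2 (chart_infty \<epsilon>) (?\<omega> \<epsilon>)) \<Omega> (at_right 0)"
      using limit[OF A(1,2), of \<alpha>] infty by (intro exI[of _ "\<lambda>_. \<alpha> *\<^sub>R A"]) blast
    show "\<exists>\<Omega>. parallel_on UNIV flat_metric \<Omega> \<and>
          (\<forall>y. alternating (\<Omega> y) \<and> form2_norm (flat_metric y) (\<Omega> y) = \<bar>\<beta>\<bar>) \<and>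
          smooth2_tendsto punctured_R4
            (\<lambda>\<epsilon>. pullback2 chart_zero (?\<omega> \<epsilon>)) \<Omega> (at_right 0)"
      using limit[OF B(1,2), of \<beta>] zero by (intro exI[of _ "\<lambda>_. \<beta> *\<^sub>R B"]) blast
    show "smooth2_tendsto punctured_R4 (\<lambda>\<epsilon>. pullback2 (chart_infty \<epsilon>) (g_eps \<epsilon>)) flat_metric (at_right 0)"
      by (rule smooth2_tendsto_metric) (simp add: pullback2_metric_infty)
    show "smooth2_tendsto punctured_R4 (\<lambda>\<epsilon>. pullback2 chart_zero (g_eps \<epsilon>)) flat_metric (at_right 0)"
      by (rule smooth2_tendsto_metric) (simp add: pullback2_metric_zero)
    show "pointed_GH_tendsto (\<lambda>_. punctured_R4) (\<lambda>\<epsilon>. riem_dist punctured_R4 (g_eps \<epsilon>)) p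
       wedge_R4 wedge_R4_dist (0, 0) (at_right 0)"
      by (rule pointed_GH_wedge[OF base_point])
  qed (use closed sd integrable_h mono_L2 lim_L2 bdd_h pos strict_L2 strict_SUP lim_SUP in simp_all)
qed

end
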